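(* Let $G$ be a connected Lie group with Lie algebra $\mathfrak{g}=T_eG$, endowed with a left invariant spray structure $\mathbf{G}$ with spray vector field $\eta:\mathfrak{g}\backslash\{0\}\to\mathfrak{g}$ and connection operator $N$. Let $c(t)$ be a smooth curve on $G$ with nowhere vanishing $\dot c(t)$, and let $W(t)$ be a smooth vector field along $c(t)$. Denote $y(t)=(L_{c(t)^{-1}})_*(\dot c(t))\in\mathfrak{g}\backslash\{0\}$ and $w(t)=(L_{c(t)^{-1}})_*(W(t))\in\mathfrak{g}$. Then $W(t)$ is linearly parallel along $c(t)$ (with respect to $\mathbf{G}$) if and only if $w(t)$ is a solution of $$\tfrac{\mathrm{d}}{\mathrm{d}t}w(t)+N(y(t),w(t))+[y(t),w(t)]_{\mathfrak{g}}=0.$$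
   Context: Summation convention is used. A spray structure on a smooth manifold $M$ is a smooth vector field $\mathbf{G}$ on the slit tangent bundle $TM\backslash 0$ which, in every standard local coordinate system $(x^i,y^i)$ of $TM$ (i.e. $x=(x^i)\in M$, $y=y^i\partial_{x^i}\in T_xM$), has the form $\mathbf{G}=y^i\partial_{x^i}-2\mathbf{G}^i\partial_{y^i}$ with $\mathbf{G}^i=\mathbf{G}^i(x,y)$ positively 2-homogeneous in $y$. Put $N^i_j=\partial\mathbf{G}^i/\partial y^j$. Linear parallelism: for a smooth curve $c(t)$ with nowhere vanishing $\dot c(t)$ and a smooth vector field $W(t)=z^i(t)\partial_{x^i}|_{c(t)}$ along it, the linearly covariant derivative is $D_{\dot c(t)}W(t)=\big(\tfrac{\mathrm{d}z^i(t)}{\mathrm{d}t}+z^j(t)N^i_j(c(t),\dot c(t))\big)\partial_{x^i}|_{c(t)}$, and $W(t)$ is linearly parallel along $c(t)$ if $D_{\dot c(t)}W(t)\equiv 0$. Lie group notation: $L_g(g')=gg'$; $[\cdot,\cdot]_{\mathfrak{g}}$ is the Lie bracket of $\mathfrak{g}$ (defined through left invariant vector fields). Fix a basis $e_1,\dots,e_n$ of $\mathfrak{g}$ and let $U_i(g)=(L_g)_*(e_i)$ be the left invariant vector fields. Let $\widetilde U_i$ be the complete lift of $U_i$ to $TG$ (the complete lift of $X=X^i\partial_{x^i}$ is $X^i\partial_{x^i}+y^j\tfrac{\partial X^i}{\partial x^j}\partial_{y^i}$). Writing $y=u^iU_i(g)\in T_gG$ defines functions $u^i$ on $TG$, and $\partial_{u^i}$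 denotes the vector field on $TG$ tangent to each $T_gG$ and equal there to the coordinate field of the linear coordinate $u^i$. Left invariant sprays: $\mathbf{G}$ on $G$ is left invariant if it is preserved by (the maps on $TG\backslash 0$ induced by) all left translations. Put $\mathbf{G}_0=u^i\widetilde U_i$. Every left invariant spray structure can be written $\mathbf{G}=\mathbf{G}_0-\mathbf{H}^i\partial_{u^i}$, where the $\mathbf{H}^i$ are left invariant smooth functions on $TG\backslash 0$, positively 2-homogeneous on each $T_gG$. The spray vector field of $\mathbf{G}$ is the smooth map $\eta:\mathfrak{g}\backslash\{0\}\to\mathfrak{g}$, $\eta(y)=\mathbf{H}^i(e,y)e_i$. The connection operator is $N:(\mathfrak{g}\backslash\{0\})\times\mathfrak{g}\to\mathfrak{g}$, $N(y,w)=\tfrac12D\eta(y,w)-\tfrac12[y,w]_{\mathfrak{g}}$, where $D\eta(y,w)$ is the derivative of $\eta$ at $y$ in the direction $w$. *)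

theory Defs
  imports "HOL-Analysis.Analysis" "HOL-Algebra.Group"
begin

section \<open>Smooth functions between Euclidean spaces\<close>

text \<open>
  Derivatives are taken within \<open>S\<close>, so that besides open sets one may also use (relatively open
  subsets of) nondegenerate real intervals that contain an endpoint; on these two kinds of sets
  derivatives within \<open>S\<close> are unique, and no other sets occur below.
\<close>

primrec Ck_on :: "nat \<Rightarrow> 'v::real_normed_vector set \<Rightarrow> ('v \<Rightarrow> 'w::real_normed_vector) \<Rightarrow> bool" where
  "Ck_on 0 S f \<longleftrightarrow> continuous_on S f"
| "Ck_on (Suc k) S f \<longleftrightarrow>
     f differentiable_on S \<and> (\<forall>v. Ck_on k S (\<lambda>x. frechet_derivative f (at x within S) v))"

definition smooth_on :: "'v::real_normed_vector set \<Rightarrow> ('v \<Rightarrow> 'w::real_normed_vector) \<Rightarrow> bool" where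
  "smooth_on S f \<longleftrightarrow> (\<forall>k. Ck_on k S f)"


section \<open>Smooth manifolds\<close>

text \<open>
  A chart is a pair of its domain and its coordinate map (whose values outside the domain are
  irrelevant). A manifold is a topology together with a smooth atlas. The atlas may be, but need
  not be, maximal: with a maximal atlas ``for every chart of the atlas'' means ``in every local
  coordinate system''.
\<close>

type_synonym ('a, 'e) chart = "'a set \<times> ('a \<Rightarrow> 'e)"

definition chart_inv :: "('a, 'e) chart \<Rightarrow> 'e \<Rightarrow> 'a" where
  "chart_inv \<kappa> = inv_into (fst \<kappa>) (snd \<kappa>)"

definition charts_at :: "('a, 'e) chart set \<Rightarrow> 'a \<Rightarrow> ('a, 'e) chart set" where
  "charts_at A p = {\<kappa> \<in> A. p \<in> fst \<kappa>}"

definition some_chart :: "('a, 'e) chart set \<Rightarrow> 'a \<Rightarrow> ('a, 'e) chart" where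
  "some_chart A p = (SOME \<kappa>. \<kappa> \<in> charts_at A p)"

definition smooth_atlas :: "'a topology \<Rightarrow> ('a, 'e::euclidean_space) chart set \<Rightarrow> bool" where
  "smooth_atlas X A \<longleftrightarrow>
     (\<Union>\<kappa>\<in>A. fst \<kappa>) = topspace X \<and>
     (\<forall>\<kappa>\<in>A. openin X (fst \<kappa>) \<and> open (snd \<kappa> ` fst \<kappa>) \<and>
        homeomorphic_map (subtopology X (fst \<kappa>)) (top_of_set (snd \<kappa> ` fst \<kappa>)) (snd \<kappa>)) \<and>
     (\<forall>\<kappa>\<in>A. \<forall>\<kappa>'\<in>A. smooth_on (snd \<kappa> ` (fst \<kappa> \<inter> fst \<kappa>')) (snd \<kappa>' \<circ> chart_inv \<kappa>))"

definition smooth_manifold :: "'a topology \<Rightarrow> ('a, 'e::euclidean_space) chart set \<Rightarrow> bool" where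
  "smooth_manifold X A \<longleftrightarrow> Hausdorff_space X \<and> second_countable X \<and> smooth_atlas X A"

definition smooth_map ::
  "'a topology \<Rightarrow> ('a, 'e::euclidean_space) chart set \<Rightarrow>
   'b topology \<Rightarrow> ('b, 'f::euclidean_space) chart set \<Rightarrow> ('a \<Rightarrow> 'b) \<Rightarrow> bool" where
  "smooth_map X A Y B F \<longleftrightarrow>
     continuous_map X Y F \<and>
     (\<forall>\<kappa>\<in>A. \<forall>\<kappa>'\<in>B.
        smooth_on (snd \<kappa> ` {p \<in> fst \<kappa>. F p \<in> fst \<kappa>'}) (snd \<kappa>' \<circ> F \<circ> chart_inv \<kappa>))"

definition product_atlas ::
  "('a, 'e) chart set \<Rightarrow> ('b, 'f) chart set \<Rightarrow> ('a \<times> 'b, 'e \<times> 'f) chart set" where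
  "product_atlas A B =
     (\<lambda>(\<kappa>, \<kappa>'). (fst \<kappa> \<times> fst \<kappa>', map_prod (snd \<kappa>) (snd \<kappa>'))) ` (A \<times> B)"


section \<open>Tangent vectors and the tangent bundle\<close>

text \<open>
  A tangent vector at \<open>p\<close> is a pair of its base point \<open>p\<close> and the family of its coordinate
  vectors \<open>v \<kappa> = (y\<^sup>1,\<dots>,y\<^sup>n)\<close>, one for each chart \<open>\<kappa>\<close> at \<open>p\<close>, subject to the transformation law
  under coordinate changes. The family is set to \<open>0\<close> on all other charts, so that equality of
  tangent vectors is plain equality.
\<close>

type_synonym ('a, 'e) tvec = "'a \<times> (('a, 'e) chart \<Rightarrow> 'e)"

definition tangent_space :: "('a, 'e::euclidean_space) chart set \<Rightarrow> 'a \<Rightarrow> ('a, 'e) tvec set" where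
  "tangent_space A p =
     {(p, v) | v.
        (\<forall>\<kappa>. \<kappa> \<notin> charts_at A p \<longrightarrow> v \<kappa> = 0) \<and>
        (\<forall>\<kappa>\<in>charts_at A p. \<forall>\<kappa>'\<in>charts_at A p.
           v \<kappa>' = frechet_derivative (snd \<kappa>' \<circ> chart_inv \<kappa>) (at (snd \<kappa> p)) (v \<kappa>))}"

text \<open>The tangent vector \<open>a\<^sup>i \<partial>/\<partial>x\<^sup>i\<close> at \<open>p\<close>, where \<open>x\<^sup>i\<close> are the coordinates of the chart \<open>\<kappa>\<close>.\<close>

definition coord_vector ::
  "('a, 'e::euclidean_space) chart set \<Rightarrow> 'a \<Rightarrow> ('a, 'e) chart \<Rightarrow> 'e \<Rightarrow> ('a, 'e) tvec" where
  "coord_vector A p \<kappa> a =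
     (p, \<lambda>\<kappa>'. if \<kappa>' \<in> charts_at A p
              then frechet_derivative (snd \<kappa>' \<circ> chart_inv \<kappa>) (at (snd \<kappa> p)) a else 0)"

definition tzero :: "'a \<Rightarrow> ('a, 'e::real_vector) tvec" where
  "tzero p = (p, \<lambda>\<kappa>. 0)"

definition tadd :: "('a, 'e::real_vector) tvec \<Rightarrow> ('a, 'e) tvec \<Rightarrow> ('a, 'e) tvec" where
  "tadd \<xi> \<zeta> = (fst \<xi>, \<lambda>\<kappa>. snd \<xi> \<kappa> + snd \<zeta> \<kappa>)"

definition tscale :: "real \<Rightarrow> ('a, 'e::real_vector) tvec \<Rightarrow> ('a, 'e) tvec" where
  "tscale r \<xi> = (fst \<xi>, \<lambda>\<kappa>. r *\<^sub>R snd \<xi> \<kappa>)"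

definition tdiff :: "('a, 'e::real_vector) tvec \<Rightarrow> ('a, 'e) tvec \<Rightarrow> ('a, 'e) tvec" where
  "tdiff \<xi> \<zeta> = tadd \<xi> (tscale (-1) \<zeta>)"

text \<open>The linear combination \<open>\<Sum>i<n. a\<^sub>i E\<^sub>i\<close> of tangent vectors at \<open>p\<close>.\<close>

definition tlincomb ::
  "'a \<Rightarrow> nat \<Rightarrow> (nat \<Rightarrow> real) \<Rightarrow> (nat \<Rightarrow> ('a, 'e::real_vector) tvec) \<Rightarrow> ('a, 'e) tvec" where
  "tlincomb p n a E = (p, \<lambda>\<kappa>. \<Sum>i<n. a i *\<^sub>R snd (E i) \<kappa>)"

definition tangent_basis ::
  "('a, 'e::euclidean_space) chart set \<Rightarrow> 'a \<Rightarrow> (nat \<Rightarrow> ('a, 'e) tvec) \<Rightarrow> bool" where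
  "tangent_basis A p E \<longleftrightarrow>
     (\<forall>i<DIM('e). E i \<in> tangent_space A p) \<and>
     (\<forall>\<xi>\<in>tangent_space A p.
        \<exists>!a. (\<forall>i\<ge>DIM('e). a i = 0) \<and> \<xi> = tlincomb p DIM('e) a E)"

definition tangent_bundle :: "('a, 'e::euclidean_space) chart set \<Rightarrow> ('a, 'e) tvec set" where
  "tangent_bundle A = (\<Union>p\<in>(\<Union>\<kappa>\<in>A. fst \<kappa>). tangent_space A p)"

definition slit_tangent_bundle :: "('a, 'e::euclidean_space) chart set \<Rightarrow> ('a, 'e) tvec set" where
  "slit_tangent_bundle A = {\<xi> \<in> tangent_bundle A. \<xi> \<noteq> tzero (fst \<xi>)}"

text \<open>The standard local coordinates \<open>(x\<^sup>i, y\<^sup>i)\<close> of the tangent bundle.\<close>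

definition standard_chart ::
  "('a, 'e::euclidean_space) chart set \<Rightarrow> ('a, 'e) chart \<Rightarrow> (('a, 'e) tvec, 'e \<times> 'e) chart" where
  "standard_chart A \<kappa> =
     ({\<xi> \<in> tangent_bundle A. fst \<xi> \<in> fst \<kappa>}, \<lambda>\<xi>. (snd \<kappa> (fst \<xi>), snd \<xi> \<kappa>))"

definition tangent_atlas ::
  "('a, 'e::euclidean_space) chart set \<Rightarrow> (('a, 'e) tvec, 'e \<times> 'e) chart set" where
  "tangent_atlas A = standard_chart A ` A"

definition tangent_topology ::
  "('a, 'e::euclidean_space) chart set \<Rightarrow> ('a, 'e) tvec topology" where
  "tangent_topology A =
     topology_generated_by
       {{\<xi> \<in> fst (standard_chart A \<kappa>). snd (standard_chart A \<kappa>) \<xi> \<in> O'} | \<kappa> O'. \<kappa> \<in> A \<and> open O'}"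

text \<open>
  The tangent map of \<open>F\<close>. For smooth \<open>F\<close> the result does not depend on the chart chosen at the base
  point.
\<close>

definition pushforward ::
  "('a, 'e::euclidean_space) chart set \<Rightarrow> ('b, 'f::euclidean_space) chart set \<Rightarrow>
   ('a \<Rightarrow> 'b) \<Rightarrow> ('a, 'e) tvec \<Rightarrow> ('b, 'f) tvec" where
  "pushforward A B F \<xi> =
     (let p = fst \<xi>; \<kappa> = some_chart A p in
      (F p, \<lambda>\<kappa>'. if \<kappa>' \<in> charts_at B (F p)
         then frechet_derivative (snd \<kappa>' \<circ> F \<circ> chart_inv \<kappa>) (at (snd \<kappa> p)) (snd \<xi> \<kappa>) else 0))"


section \<open>Vector fields and curves\<close>

text \<open>Smooth vector fields on an open subset \<open>S\<close> of the manifold with atlas \<open>A\<close>.\<close>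

definition smooth_vector_field_on ::
  "('a, 'e::euclidean_space) chart set \<Rightarrow> 'a set \<Rightarrow> ('a \<Rightarrow> ('a, 'e) tvec) \<Rightarrow> bool" where
  "smooth_vector_field_on A S V \<longleftrightarrow>
     (\<forall>p\<in>S. V p \<in> tangent_space A p) \<and>
     (\<forall>\<kappa>\<in>A. smooth_on (snd \<kappa> ` (fst \<kappa> \<inter> S)) (\<lambda>x. snd (V (chart_inv \<kappa> x)) \<kappa>))"

text \<open>\<open>[V, W]\<^sup>i = V\<^sup>j \<partial>\<^sub>j W\<^sup>i - W\<^sup>j \<partial>\<^sub>j V\<^sup>i\<close>\<close>

definition lie_bracket ::
  "('a, 'e::euclidean_space) chart set \<Rightarrow> ('a \<Rightarrow> ('a, 'e) tvec) \<Rightarrow> ('a \<Rightarrow> ('a, 'e) tvec) \<Rightarrow>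
   'a \<Rightarrow> ('a, 'e) tvec" where
  "lie_bracket A V W p =
     (p, \<lambda>\<kappa>. if \<kappa> \<in> charts_at A p
        then frechet_derivative (\<lambda>x. snd (W (chart_inv \<kappa> x)) \<kappa>) (at (snd \<kappa> p)) (snd (V p) \<kappa>)
           - frechet_derivative (\<lambda>x. snd (V (chart_inv \<kappa> x)) \<kappa>) (at (snd \<kappa> p)) (snd (W p) \<kappa>)
        else 0)"

text \<open>
  The complete lift, \<open>X\<^sup>i \<partial>\<^bsub>x\<^sup>i\<^esub> + y\<^sup>j (\<partial>X\<^sup>i/\<partial>x\<^sup>j) \<partial>\<^bsub>y\<^sup>i\<^esub>\<close> in the standard coordinates of some (equivalently,
  for smooth \<open>V\<close>, of any) chart at the base point.
\<close>

definition complete_lift ::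
  "('a, 'e::euclidean_space) chart set \<Rightarrow> ('a \<Rightarrow> ('a, 'e) tvec) \<Rightarrow>
   ('a, 'e) tvec \<Rightarrow> (('a, 'e) tvec, 'e \<times> 'e) tvec" where
  "complete_lift A V \<xi> =
     (let p = fst \<xi>; \<kappa> = some_chart A p in
      coord_vector (tangent_atlas A) \<xi> (standard_chart A \<kappa>)
        (snd (V p) \<kappa>,
         frechet_derivative (\<lambda>x. snd (V (chart_inv \<kappa> x)) \<kappa>) (at (snd \<kappa> p)) (snd \<xi> \<kappa>)))"

definition smooth_curve_on ::
  "'a topology \<Rightarrow> ('a, 'e::euclidean_space) chart set \<Rightarrow> real set \<Rightarrow> (real \<Rightarrow> 'a) \<Rightarrow> bool" where
  "smooth_curve_on X A J c \<longleftrightarrow>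
     continuous_map (top_of_set J) X c \<and>
     (\<forall>\<kappa>\<in>A. smooth_on {t \<in> J. c t \<in> fst \<kappa>} (snd \<kappa> \<circ> c))"

definition velocity ::
  "('a, 'e::euclidean_space) chart set \<Rightarrow> real set \<Rightarrow> (real \<Rightarrow> 'a) \<Rightarrow> real \<Rightarrow> ('a, 'e) tvec" where
  "velocity A J c t =
     (c t, \<lambda>\<kappa>. if \<kappa> \<in> charts_at A (c t) then vector_derivative (snd \<kappa> \<circ> c) (at t within J) else 0)"

definition smooth_vector_field_along ::
  "('a, 'e::euclidean_space) chart set \<Rightarrow> real set \<Rightarrow> (real \<Rightarrow> 'a) \<Rightarrow>
   (real \<Rightarrow> ('a, 'e) tvec) \<Rightarrow> bool" where
  "smooth_vector_field_along A J c W \<longleftrightarrow>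
     (\<forall>t\<in>J. W t \<in> tangent_space A (c t)) \<and>
     smooth_curve_on (tangent_topology A) (tangent_atlas A) J W"

text \<open>
  The ordinary derivative of a curve \<open>f\<close> in a fixed tangent space (as a finite dimensional vector
  space), as opposed to \<open>velocity\<close>, which lies in the tangent bundle of the tangent bundle.
\<close>

definition fibre_derivative ::
  "real set \<Rightarrow> (real \<Rightarrow> ('a, 'e::euclidean_space) tvec) \<Rightarrow> real \<Rightarrow> ('a, 'e) tvec" where
  "fibre_derivative J f t =
     (fst (f t), \<lambda>\<kappa>. vector_derivative (\<lambda>s. snd (f s) \<kappa>) (at t within J))"

definition fibre_differentiable ::
  "real set \<Rightarrow> (real \<Rightarrow> ('a, 'e::euclidean_space) tvec) \<Rightarrow> real \<Rightarrow> bool" where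
  "fibre_differentiable J f t \<longleftrightarrow> (\<forall>\<kappa>. (\<lambda>s. snd (f s) \<kappa>) differentiable (at t within J))"


section \<open>Sprays and linear parallelism\<close>

text \<open>
  The functions \<open>G\<^sup>i(x,y)\<close> of \<open>S = y\<^sup>i \<partial>\<^bsub>x\<^sup>i\<^esub> - 2 G\<^sup>i \<partial>\<^bsub>y\<^sup>i\<^esub>\<close> in the standard coordinates of \<open>\<kappa>\<close>, as one
  vector-valued function.
\<close>

definition spray_coeff ::
  "('a, 'e::euclidean_space) chart set \<Rightarrow> (('a, 'e) tvec \<Rightarrow> (('a, 'e) tvec, 'e \<times> 'e) tvec) \<Rightarrow>
   ('a, 'e) chart \<Rightarrow> 'e \<Rightarrow> 'e \<Rightarrow> 'e" where
  "spray_coeff A S \<kappa> x y =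
     - (1/2) *\<^sub>R snd (snd (S (coord_vector A (chart_inv \<kappa> x) \<kappa> y)) (standard_chart A \<kappa>))"

definition spray_structure ::
  "('a, 'e::euclidean_space) chart set \<Rightarrow>
   (('a, 'e) tvec \<Rightarrow> (('a, 'e) tvec, 'e \<times> 'e) tvec) \<Rightarrow> bool" where
  "spray_structure A S \<longleftrightarrow>
     smooth_vector_field_on (tangent_atlas A) (slit_tangent_bundle A) S \<and>
     (\<forall>\<kappa>\<in>A. \<forall>x\<in>snd \<kappa> ` fst \<kappa>. \<forall>y. y \<noteq> 0 \<longrightarrow>
        snd (S (coord_vector A (chart_inv \<kappa> x) \<kappa> y)) (standard_chart A \<kappa>)
          = (y, - 2 *\<^sub>R spray_coeff A S \<kappa> x y) \<and>
        (\<forall>r>0. spray_coeff A S \<kappa> x (r *\<^sub>R y) = r\<^sup>2 *\<^sub>R spray_coeff A S \<kappa> x y))"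

text \<open>
  \<open>N\<^sup>i\<^sub>j = \<partial>G\<^sup>i/\<partial>y\<^sup>j\<close>, as the linear map \<open>z \<mapsto> z\<^sup>j N\<^sup>i\<^sub>j(x,y)\<close>.
\<close>

definition spray_N ::
  "('a, 'e::euclidean_space) chart set \<Rightarrow> (('a, 'e) tvec \<Rightarrow> (('a, 'e) tvec, 'e \<times> 'e) tvec) \<Rightarrow>
   ('a, 'e) chart \<Rightarrow> 'e \<Rightarrow> 'e \<Rightarrow> 'e \<Rightarrow> 'e" where
  "spray_N A S \<kappa> x y = frechet_derivative (spray_coeff A S \<kappa> x) (at y)"

definition linear_covariant_derivative ::
  "('a, 'e::euclidean_space) chart set \<Rightarrow> (('a, 'e) tvec \<Rightarrow> (('a, 'e) tvec, 'e \<times> 'e) tvec) \<Rightarrow>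
   real set \<Rightarrow> (real \<Rightarrow> 'a) \<Rightarrow> (real \<Rightarrow> ('a, 'e) tvec) \<Rightarrow> real \<Rightarrow> ('a, 'e) tvec" where
  "linear_covariant_derivative A S J c W t =
     (c t, \<lambda>\<kappa>. if \<kappa> \<in> charts_at A (c t)
        then vector_derivative (\<lambda>s. snd (W s) \<kappa>) (at t within J)
           + spray_N A S \<kappa> (snd \<kappa> (c t)) (snd (velocity A J c t) \<kappa>) (snd (W t) \<kappa>)
        else 0)"

definition linearly_parallel ::
  "('a, 'e::euclidean_space) chart set \<Rightarrow> (('a, 'e) tvec \<Rightarrow> (('a, 'e) tvec, 'e \<times> 'e) tvec) \<Rightarrow>
   real set \<Rightarrow> (real \<Rightarrow> 'a) \<Rightarrow> (real \<Rightarrow> ('a, 'e) tvec) \<Rightarrow> bool" where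
  "linearly_parallel A S J c W \<longleftrightarrow>
     (\<forall>t\<in>J. linear_covariant_derivative A S J c W t = tzero (c t))"


section \<open>Lie groups\<close>

definition lie_group ::
  "('a, 'b) monoid_scheme \<Rightarrow> 'a topology \<Rightarrow> ('a, 'e::euclidean_space) chart set \<Rightarrow> bool" where
  "lie_group G X A \<longleftrightarrow>
     group G \<and> topspace X = carrier G \<and> smooth_manifold X A \<and>
     smooth_map (prod_topology X X) (product_atlas A A) X A (\<lambda>(g, h). g \<otimes>\<^bsub>G\<^esub> h) \<and>
     smooth_map X A X A (\<lambda>g. inv\<^bsub>G\<^esub> g)"

definition left_push ::
  "('a, 'b) monoid_scheme \<Rightarrow> ('a, 'e::euclidean_space) chart set \<Rightarrow> 'a \<Rightarrow>
   ('a, 'e) tvec \<Rightarrow> ('a, 'e) tvec" where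
  "left_push G A g = pushforward A A (\<lambda>h. g \<otimes>\<^bsub>G\<^esub> h)"

definition left_invariant_field ::
  "('a, 'b) monoid_scheme \<Rightarrow> ('a, 'e::euclidean_space) chart set \<Rightarrow> ('a, 'e) tvec \<Rightarrow>
   'a \<Rightarrow> ('a, 'e) tvec" where
  "left_invariant_field G A v g = left_push G A g v"

definition lie_algebra_bracket ::
  "('a, 'b) monoid_scheme \<Rightarrow> ('a, 'e::euclidean_space) chart set \<Rightarrow> ('a, 'e) tvec \<Rightarrow>
   ('a, 'e) tvec \<Rightarrow> ('a, 'e) tvec" where
  "lie_algebra_bracket G A v w =
     lie_bracket A (left_invariant_field G A v) (left_invariant_field G A w) \<one>\<^bsub>G\<^esub>"


section \<open>Left invariant sprays\<close>

definition left_invariant_spray ::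
  "('a, 'b) monoid_scheme \<Rightarrow> ('a, 'e::euclidean_space) chart set \<Rightarrow>
   (('a, 'e) tvec \<Rightarrow> (('a, 'e) tvec, 'e \<times> 'e) tvec) \<Rightarrow> bool" where
  "left_invariant_spray G A S \<longleftrightarrow>
     spray_structure A S \<and>
     (\<forall>g\<in>carrier G. \<forall>\<xi>\<in>slit_tangent_bundle A.
        pushforward (tangent_atlas A) (tangent_atlas A) (left_push G A g) (S \<xi>)
          = S (left_push G A g \<xi>))"

text \<open>Below \<open>E 0, \<dots>, E (n - 1)\<close> with \<open>n = DIM('e)\<close> is a basis of the Lie algebra.\<close>

definition frame_coord ::
  "('a, 'b) monoid_scheme \<Rightarrow> ('a, 'e::euclidean_space) chart set \<Rightarrow> (nat \<Rightarrow> ('a, 'e) tvec) \<Rightarrow>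
   ('a, 'e) tvec \<Rightarrow> nat \<Rightarrow> real" where
  "frame_coord G A E \<xi> =
     (THE u. (\<forall>i\<ge>DIM('e). u i = 0) \<and>
        \<xi> = tlincomb (fst \<xi>) DIM('e) u (\<lambda>i. left_invariant_field G A (E i) (fst \<xi>)))"

text \<open>
  The vector field \<open>\<partial>\<^bsub>u\<^sup>i\<^esub>\<close> on the tangent bundle: the coordinate lines of \<open>u\<^sup>i\<close> in a fibre are the lines
  \<open>s \<mapsto> \<xi> + s U\<^sub>i\<close>.
\<close>

definition frame_vertical ::
  "('a, 'b) monoid_scheme \<Rightarrow> ('a, 'e::euclidean_space) chart set \<Rightarrow> (nat \<Rightarrow> ('a, 'e) tvec) \<Rightarrow>
   nat \<Rightarrow> ('a, 'e) tvec \<Rightarrow> (('a, 'e) tvec, 'e \<times> 'e) tvec" where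
  "frame_vertical G A E i \<xi> =
     velocity (tangent_atlas A) UNIV
       (\<lambda>s. tadd \<xi> (tscale s (left_invariant_field G A (E i) (fst \<xi>)))) 0"

text \<open>\<open>G\<^sub>0 = u\<^sup>i U\<^sub>i\<^sup>c\<close>, where \<open>U\<^sub>i\<^sup>c\<close> is the complete lift of \<open>U\<^sub>i\<close>\<close>

definition canonical_spray ::
  "('a, 'b) monoid_scheme \<Rightarrow> ('a, 'e::euclidean_space) chart set \<Rightarrow> (nat \<Rightarrow> ('a, 'e) tvec) \<Rightarrow>
   ('a, 'e) tvec \<Rightarrow> (('a, 'e) tvec, 'e \<times> 'e) tvec" where
  "canonical_spray G A E \<xi> =
     tlincomb \<xi> DIM('e) (frame_coord G A E \<xi>)
       (\<lambda>i. complete_lift A (left_invariant_field G A (E i)) \<xi>)"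

text \<open>
  The functions \<open>H\<^sup>i\<close> in \<open>S = G\<^sub>0 - H\<^sup>i \<partial>\<^bsub>u\<^sup>i\<^esub>\<close>. Since the \<open>\<partial>\<^bsub>u\<^sup>i\<^esub>\<close> are pointwise linearly independent, this
  equation at \<open>\<xi>\<close> alone determines the numbers \<open>H\<^sup>i(\<xi>)\<close>; left invariance, smoothness and homogeneity of
  \<open>H\<^sup>i\<close> are then properties to be derived from those of \<open>S\<close>.
\<close>

definition spray_H ::
  "('a, 'b) monoid_scheme \<Rightarrow> ('a, 'e::euclidean_space) chart set \<Rightarrow> (nat \<Rightarrow> ('a, 'e) tvec) \<Rightarrow>
   (('a, 'e) tvec \<Rightarrow> (('a, 'e) tvec, 'e \<times> 'e) tvec) \<Rightarrow> ('a, 'e) tvec \<Rightarrow> nat \<Rightarrow> real" where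
  "spray_H G A E S \<xi> =
     (THE h. (\<forall>i\<ge>DIM('e). h i = 0) \<and>
        S \<xi> = tdiff (canonical_spray G A E \<xi>)
                (tlincomb \<xi> DIM('e) h (\<lambda>i. frame_vertical G A E i \<xi>)))"

text \<open>\<open>\<eta>(y) = H\<^sup>i(e,y) e\<^sub>i\<close>; here \<open>y\<close> is a tangent vector at the identity and includes its base point.\<close>

definition spray_vector_field ::
  "('a, 'b) monoid_scheme \<Rightarrow> ('a, 'e::euclidean_space) chart set \<Rightarrow> (nat \<Rightarrow> ('a, 'e) tvec) \<Rightarrow>
   (('a, 'e) tvec \<Rightarrow> (('a, 'e) tvec, 'e \<times> 'e) tvec) \<Rightarrow> ('a, 'e) tvec \<Rightarrow> ('a, 'e) tvec" where
  "spray_vector_field G A E S y = tlincomb \<one>\<^bsub>G\<^esub> DIM('e) (spray_H G A E S y) E"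

text \<open>\<open>N(y,w) = 1/2 D\<eta>(y,w) - 1/2 [y,w]\<close>, where \<open>D\<eta>(y,w)\<close> is the derivative of \<open>\<eta>\<close> at \<open>y\<close> in direction \<open>w\<close>\<close>

definition connection_operator ::
  "('a, 'b) monoid_scheme \<Rightarrow> ('a, 'e::euclidean_space) chart set \<Rightarrow>
   (('a, 'e) tvec \<Rightarrow> ('a, 'e) tvec) \<Rightarrow> ('a, 'e) tvec \<Rightarrow> ('a, 'e) tvec \<Rightarrow> ('a, 'e) tvec" where
  "connection_operator G A \<eta> y w =
     tdiff (tscale (1/2) (fibre_derivative UNIV (\<lambda>s. \<eta> (tadd y (tscale s w))) 0))
           (tscale (1/2) (lie_algebra_bracket G A y w))"

end

theory Submission
  imports Defs
begin

text \<open>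
  In a chart at \<open>g\<close> with coordinates \<open>x\<close>, let \<open>a(x)\<close> be the linear map that sends the coordinates of
  \<open>v \<in> T\<^sub>eG\<close> to those of \<open>(L\<^sub>g)\<^sub>* v\<close>, and let \<open>Q\<close> be the Hessian of the coordinate expression of \<open>L\<^sub>g\<close>
  at the identity. Differentiating the associativity law twice gives
  \<open>Da(x)(a v) w = Q(v,w) + a(b(v,w))\<close>, where \<open>b\<close> is the derivative of \<open>a\<close> at the identity. As \<open>Q\<close> is symmetric,
  \<open>[v,w] = b(v,w) - b(w,v)\<close>. Comparing the coordinates of \<open>S\<close> at \<open>e\<close> with the definition of \<open>\<eta>\<close> gives
  \<open>\<eta>(v) = b(v,v) + 2 G\<^sub>e(v)\<close>, while left invariance of \<open>S\<close> amounts to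
  \<open>G(x, a v) = a(G\<^sub>e(v)) - Q(v,v)/2\<close>. With \<open>W = a w\<close> and \<open>c' = a y\<close> the terms with \<open>Q\<close> cancel, and the
  covariant derivative of \<open>W\<close> is \<open>a(w' + b(y,w) + DG\<^sub>e(y)w) = a(w' + N(y,w) + [y,w])\<close>.
\<close>

section \<open>Calculus\<close>

text \<open>In the code \<open>a(x)\<close> is \<open>frame \<kappa> x\<close>, \<open>b\<close> is
  \<open>frame_deriv base origin\<close>, \<open>Q\<close> is
  \<open>translate_hessian \<kappa> x\<close> and \<open>G\<^sub>e\<close> is
  \<open>spray_coeff A S base origin\<close>. The quadratic term in the law for \<open>G\<close>
  arises because the map induced by \<open>L_g\<close> on the tangent bundle contains a first
  derivative of \<open>L_g\<close>; its own derivative therefore contains \<open>Q\<close>,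
  evaluated on the fibre coordinate \<open>v\<close> and on the horizontal component of
  \<open>S\<close> at \<open>v\<close>, which is again \<open>v\<close>. The factor 1/2 is the right
  one: by symmetry \<open>Q(v,v)/2\<close> has derivative \<open>Q(v,w)\<close> in direction
  \<open>w\<close>, which is the term that \<open>Da\<close> produces. Three obstacles shape the
  development. Smoothness is available only through derivatives in fixed directions, so moving
  directions are expanded in a basis. Left invariance of \<open>S\<close> is a statement on the
  double tangent bundle, so the tangent bundle needs an atlas of its own. Finally, differentiability
  of \<open>w\<close> is part of the claim although only \<open>W\<close> is assumed smooth; it is
  extracted from the linear equation \<open>a w = W\<close> along the curve.\<close>

lemma frechet_derivative_within_cong:
  assumes "x \<in> S" "\<And>y. y \<in> S \<Longrightarrow> f y = g y"
  shows "frechet_derivative f (at x within S) = frechet_derivative g (at x within S)"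
proof -
  \<comment> \<open>\<open>frechet_derivative\<close> is a choice among all \<open>d\<close>
    satisfying \<open>has_derivative\<close>. Equivalence for every \<open>d\<close> makes the two
    choices equal even where no derivative exists.\<close>
  have "(f has_derivative d) (at x within S) \<longleftrightarrow> (g has_derivative d) (at x within S)" for d
  proof
    assume "(f has_derivative d) (at x within S)"
    then show "(g has_derivative d) (at x within S)"
      by (rule has_derivative_transform[OF assms(1), rotated]) (simp add: assms(2))
  next
    assume "(g has_derivative d) (at x within S)"
    then show "(f has_derivative d) (at x within S)"
      by (rule has_derivative_transform[OF assms(1), rotated]) (simp add: assms(2))
  qed
  then show ?thesis unfolding frechet_derivative_def by simp
qed

lemma frechet_derivative_cong_open:
  assumes "open S" "x \<in> S" "\<And>y. y \<in> S \<Longrightarrow> f y = g y"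
  shows "frechet_derivative f (at x) = frechet_derivative g (at x)"
  using frechet_derivative_within_cong[of x S f g, OF assms(2,3)] assms(1,2)
  by (simp add: at_within_open_NO_MATCH)

lemma Ck_on_cong:
  assumes "\<And>x. x \<in> S \<Longrightarrow> f x = g x"
  shows "Ck_on k S f \<longleftrightarrow> Ck_on k S g"
  using assms
proof (induction k arbitrary: f g)
  case 0
  then show ?case using continuous_on_cong[of S S f g] by simp
next
  case (Suc k)
  have "f differentiable_on S \<longleftrightarrow> g differentiable_on S"
    unfolding differentiable_on_def
  proof (intro ball_cong refl iffI)
    fix x assume x: "x \<in> S"
    show "g differentiable at x within S" if "f differentiable at x within S"
      by (rule differentiable_transform_within[OF that zero_less_one x]) (simp add: Suc.prems)
    show "f differentiable at x within S" if "g differentiable at x within S"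
      by (rule differentiable_transform_within[OF that zero_less_one x]) (simp add: Suc.prems)
  qed
  moreover have "Ck_on k S (\<lambda>x. frechet_derivative f (at x within S) v) \<longleftrightarrow>
      Ck_on k S (\<lambda>x. frechet_derivative g (at x within S) v)" for v
    by (rule Suc.IH) (simp add: frechet_derivative_within_cong[OF _ Suc.prems])
  ultimately show ?case by simp
qed

lemma smooth_on_imp_differentiable_on: "smooth_on S f \<Longrightarrow> f differentiable_on S"
  using Ck_on.simps(2)[of 0 S f] unfolding smooth_on_def by blast

lemma smooth_on_differentiable_at:
  assumes "smooth_on S f" "open S" "x \<in> S"
  shows "f differentiable at x"
  using smooth_on_imp_differentiable_on[OF assms(1)] assms(2,3)
  by (simp add: differentiable_on_eq_differentiable_at)

lemma smooth_on_cong: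
  "(\<And>x. x \<in> S \<Longrightarrow> f x = g x) \<Longrightarrow> smooth_on S f \<longleftrightarrow> smooth_on S g"
  unfolding smooth_on_def using Ck_on_cong[of S f g] by simp

lemma smooth_on_frechet_derivative:
  assumes "smooth_on S f" "open S"
  shows "smooth_on S (\<lambda>x. frechet_derivative f (at x) v)"
proof -
  have "smooth_on S (\<lambda>x. frechet_derivative f (at x within S) v)"
    using assms(1) unfolding smooth_on_def
  proof (intro allI)
    fix k assume "\<forall>k. Ck_on k S f"
    then have "Ck_on (Suc k) S f" by blast
    then show "Ck_on k S (\<lambda>x. frechet_derivative f (at x within S) v)" by simp
  qed
  then show ?thesis
    using smooth_on_cong[of S "\<lambda>x. frechet_derivative f (at x within S) v"
      "\<lambda>x. frechet_derivative f (at x) v"] assms(2)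
    by (simp add: at_within_open_NO_MATCH)
qed

section \<open>Second derivatives: product rule and symmetry\<close>

lemma linear_euclidean_expansion:
  assumes "linear L"
  shows "L (x::'v::euclidean_space) = (\<Sum>b\<in>Basis. (x \<bullet> b) *\<^sub>R L b)"
proof -
  have "L x = L (\<Sum>b\<in>Basis. (x \<bullet> b) *\<^sub>R b)" by (simp add: euclidean_representation)
  then show ?thesis using assms by (simp add: linear_sum linear_scale)
qed

text \<open>The inner differentiation is in direction \<open>w\<close>, the outer one in direction
  \<open>v\<close>.\<close>

abbreviation second_derivative ::
  "('v::real_normed_vector \<Rightarrow> 'w::real_normed_vector) \<Rightarrow> 'v \<Rightarrow> 'v \<Rightarrow> 'v \<Rightarrow> 'w" where
  "second_derivative f p v w \<equiv> frechet_derivative (\<lambda>q. frechet_derivative f (at q) w) (at p) v"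

text \<open>Smoothness controls \<open>q \<mapsto> Df(q) v\<close> only for each fixed
  \<open>v\<close>. Expanding the moving direction in the standard basis leaves a finite sum of
  products of differentiable functions, so no topology on linear maps is involved.\<close>

lemma has_derivative_frechet_derivative_apply:
  fixes f :: "'v::euclidean_space \<Rightarrow> 'w::real_normed_vector"
  assumes f: "smooth_on S f" "open S" "u t \<in> S" and t: "t \<in> T"
    and u: "(u has_derivative u') (at t within T)"
    and \<phi>: "(\<phi> has_derivative \<phi>') (at t within T)"
  shows "((\<lambda>s. frechet_derivative f (at (u s)) (\<phi> s)) has_derivative
    (\<lambda>h. second_derivative f (u t) (u' h) (\<phi> t) + frechet_derivative f (at (u t)) (\<phi>' h)))
    (at t within T)"
proof -
  define D where "D q = frechet_derivative f (at q)" for q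
  have lin: "linear (D q)" if "q \<in> S" for q
    unfolding D_def using smooth_on_differentiable_at[OF f(1,2) that]
    by (rule linear_frechet_derivative)
  have D': "((\<lambda>q. D q v) has_derivative (\<lambda>h. second_derivative f (u t) h v)) (at (u t))" for v
    using smooth_on_differentiable_at[OF smooth_on_frechet_derivative[OF f(1,2)] f(2,3), of v]
    by (simp add: frechet_derivative_works D_def)
  have Du: "((\<lambda>s. D (u s) v) has_derivative (\<lambda>h. second_derivative f (u t) (u' h) v)) (at t within T)"
    for v
    using has_derivative_compose[OF u, of "\<lambda>q. D q v", OF D'] by (simp add: o_def)
  have "((\<lambda>s. \<Sum>b\<in>Basis. (\<phi> s \<bullet> b) *\<^sub>R D (u s) b) has_derivative
      (\<lambda>h. \<Sum>b\<in>Basis. (\<phi> t \<bullet> b) *\<^sub>R second_derivative f (u t) (u' h) b + (\<phi>' h \<bullet> b) *\<^sub>R D (u t) b))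
      (at t within T)"
    by (intro has_derivative_sum has_derivative_scaleR Du has_derivative_inner_left \<phi>)
  moreover have "(\<Sum>b\<in>Basis. (\<phi> t \<bullet> b) *\<^sub>R second_derivative f (u t) (u' h) b) =
      second_derivative f (u t) (u' h) (\<phi> t)" for h
  proof -
    have "((\<lambda>q. \<Sum>b\<in>Basis. (\<phi> t \<bullet> b) *\<^sub>R D q b) has_derivative
      (\<lambda>h. \<Sum>b\<in>Basis. (\<phi> t \<bullet> b) *\<^sub>R second_derivative f (u t) h b)) (at (u t))"
      by (intro has_derivative_sum has_derivative_scaleR_right D')
    then have "((\<lambda>q. D q (\<phi> t)) has_derivative
      (\<lambda>h. \<Sum>b\<in>Basis. (\<phi> t \<bullet> b) *\<^sub>R second_derivative f (u t) h b)) (at (u t))"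
      by (rule has_derivative_transform_within_open[OF _ f(2,3)])
        (simp add: linear_euclidean_expansion[OF lin, of _ "\<phi> t"])
    from has_derivative_unique[OF this D'[of "\<phi> t"]] show ?thesis by metis
  qed
  ultimately have *: "((\<lambda>s. \<Sum>b\<in>Basis. (\<phi> s \<bullet> b) *\<^sub>R D (u s) b) has_derivative
      (\<lambda>h. second_derivative f (u t) (u' h) (\<phi> t) + D (u t) (\<phi>' h))) (at t within T)"
    by (simp add: sum.distrib linear_euclidean_expansion[OF lin[OF f(3)], symmetric])
  \<comment> \<open>The basis expansion of \<open>D (u s)\<close> is justified only inside
    \<open>S\<close>, hence only for \<open>s\<close> near \<open>t\<close>.\<close>
  have "\<forall>\<^sub>F s in at t within T. u s \<in> S"
    using has_derivative_continuous[OF u] f(2,3)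
    by (simp add: continuous_within topological_tendstoD)
  then have "\<forall>\<^sub>F s in at t within T. (\<Sum>b\<in>Basis. (\<phi> s \<bullet> b) *\<^sub>R D (u s) b) = D (u s) (\<phi> s)"
    by eventually_elim (simp add: linear_euclidean_expansion[OF lin, symmetric])
  from has_derivative_transform_eventually[OF * this _ t]
  show ?thesis
    by (simp add: D_def[symmetric] linear_euclidean_expansion[OF lin[OF f(3)], symmetric])
qed

text \<open>Only differentiability of \<open>f'\<close> at \<open>p\<close> is needed; applying this with the two directions
  exchanged gives the symmetry of second derivatives.\<close>

lemma second_difference_tendsto:
  fixes f :: "'v::real_normed_vector \<Rightarrow> 'w::real_normed_vector"
  assumes S: "open S" "p \<in> S"
    and f': "\<And>q. q \<in> S \<Longrightarrow> (f has_derivative f' q) (at q)"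
    and B: "((\<lambda>q. f' q w) has_derivative B) (at p)"
  shows "((\<lambda>t. (f (p + t *\<^sub>R v + t *\<^sub>R w) - f (p + t *\<^sub>R v) - f (p + t *\<^sub>R w) + f p) /\<^sub>R t\<^sup>2)
    \<longlongrightarrow> B v) (at_right 0)"
proof (rule tendstoI)
  fix \<epsilon>' :: real assume "\<epsilon>' > 0"
  \<comment> \<open>\<open>t * K\<close> bounds the displacements \<open>t (v + s w)\<close> and
    \<open>t s w\<close> for \<open>0 \<le> s \<le> 1\<close>; the summand 1 keeps \<open>K\<close>
    positive. The mean value bound below is \<open>2 * \<epsilon> * K * t\<^sup>2\<close>, which the
    4 in \<open>\<epsilon>\<close> turns into \<open>t\<^sup>2 * \<epsilon>' / 2\<close>.\<close>
  define K where "K = norm v + norm w + 1"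
  define \<epsilon> where "\<epsilon> = \<epsilon>' / (4 * K)"
  have K: "K > 0" unfolding K_def by (smt (verit) norm_ge_zero)
  then have \<epsilon>: "\<epsilon> > 0" using \<open>\<epsilon>' > 0\<close> by (simp add: \<epsilon>_def)
  interpret B: bounded_linear B using B by (rule has_derivative_bounded_linear)
  obtain d1 where d1: "d1 > 0"
    "\<And>q. norm (q - p) < d1 \<Longrightarrow> norm (f' q w - f' p w - B (q - p)) \<le> \<epsilon> * norm (q - p)"
    using B \<epsilon> unfolding has_derivative_at_alt by meson
  obtain d2 where d2: "d2 > 0" "\<And>q. dist q p < d2 \<Longrightarrow> q \<in> S"
    using S unfolding open_dist by blast
  define \<delta> where "\<delta> = min d1 d2 / K"
  have "\<delta> > 0" using d1 d2 K by (simp add: \<delta>_def)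
  have "dist ((f (p + t *\<^sub>R v + t *\<^sub>R w) - f (p + t *\<^sub>R v) - f (p + t *\<^sub>R w) + f p) /\<^sub>R t\<^sup>2) (B v) < \<epsilon>'"
    if t: "0 < t" "t < \<delta>" for t
  proof -
    have tK: "t * K < min d1 d2" using t K by (simp add: \<delta>_def pos_less_divide_eq)
    have small: "norm (t *\<^sub>R x) \<le> t * K" if "norm x \<le> norm v + norm w" for x :: 'v
      using that t by (auto simp: K_def intro!: mult_left_mono)
    have le1: "norm (v + s *\<^sub>R w) \<le> norm v + norm w" "norm (s *\<^sub>R w) \<le> norm v + norm w"
      if "0 \<le> s" "s \<le> 1" for s
    proof -
      have "norm (s *\<^sub>R w) \<le> norm w" using that by (simp add: mult_left_le_one_le)
      then show "norm (v + s *\<^sub>R w) \<le> norm v + norm w" "norm (s *\<^sub>R w) \<le> norm v + norm w"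
        using norm_triangle_ineq[of v "s *\<^sub>R w"] norm_ge_zero[of v] by linarith+
    qed
    have inS: "p + t *\<^sub>R x \<in> S" if "norm x \<le> norm v + norm w" for x
      using small[OF that] tK by (intro d2) (simp add: dist_norm)
    have est: "norm (f' (p + t *\<^sub>R x) w - f' p w - B (t *\<^sub>R x)) \<le> \<epsilon> * (t * K)"
      if "norm x \<le> norm v + norm w" for x
    proof -
      have "norm (f' (p + t *\<^sub>R x) w - f' p w - B (t *\<^sub>R x)) \<le> \<epsilon> * norm (t *\<^sub>R x)"
        using d1(2)[of "p + t *\<^sub>R x"] small[OF that] tK by simp
      also have "\<dots> \<le> \<epsilon> * (t * K)" using small[OF that] \<epsilon> by (simp add: mult_left_mono)
      finally show ?thesis .
    qed
    \<comment> \<open>Between \<open>s = 0\<close> and \<open>s = 1\<close> this increases by the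
      second difference minus \<open>t\<^sup>2 B v\<close>. It compares \<open>f\<close> on two
      segments parallel to \<open>w\<close>, so only derivatives in direction \<open>w\<close>
      occur, and these are what \<open>B\<close> controls.\<close>
    define \<psi> where "\<psi> s = f (p + t *\<^sub>R (v + s *\<^sub>R w)) - f (p + t *\<^sub>R (s *\<^sub>R w)) - s *\<^sub>R (t\<^sup>2 *\<^sub>R B v)" for s
    define \<psi>' where "\<psi>' s = t *\<^sub>R (f' (p + t *\<^sub>R (v + s *\<^sub>R w)) w - f' (p + t *\<^sub>R (s *\<^sub>R w)) w) - t\<^sup>2 *\<^sub>R B v" for s
    have \<psi>: "(\<psi> has_vector_derivative \<psi>' s) (at s)" if s: "0 \<le> s" "s \<le> 1" for s
    proof -
      have *: "((\<lambda>s. f (p + t *\<^sub>R (x + s *\<^sub>R w))) has_vector_derivative t *\<^sub>R f' (p + t *\<^sub>R (x + s *\<^sub>R w)) w) (at s)"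
        if "p + t *\<^sub>R (x + s *\<^sub>R w) \<in> S" for x
      proof -
        have "((\<lambda>s. p + t *\<^sub>R (x + s *\<^sub>R w)) has_derivative (\<lambda>h. t *\<^sub>R (h *\<^sub>R w))) (at s)"
          by (auto intro!: derivative_eq_intros)
        from has_derivative_compose[OF this f'[OF that]] show ?thesis
          using has_derivative_linear[OF f'[OF that]]
          by (simp add: has_vector_derivative_def linear_scale mult.commute)
      qed
      show ?thesis unfolding \<psi>_def \<psi>'_def
        using *[of v] *[of 0] inS[OF le1(1)[OF s]] inS[OF le1(2)[OF s]]
        by (auto intro!: derivative_eq_intros simp: algebra_simps)
    qed
    have bnd: "norm (\<psi>' s) \<le> t * (2 * (\<epsilon> * (t * K)))" if s: "0 \<le> s" "s \<le> 1" for s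
    proof -
      define a where "a = f' (p + t *\<^sub>R (v + s *\<^sub>R w)) w - f' p w - B (t *\<^sub>R (v + s *\<^sub>R w))"
      define b where "b = f' (p + t *\<^sub>R (s *\<^sub>R w)) w - f' p w - B (t *\<^sub>R (s *\<^sub>R w))"
      \<comment> \<open>By linearity of \<open>B\<close> the linear parts at the two points differ
        by \<open>t B v\<close>, which the last term of \<open>\<psi>'\<close> removes; only the two
        remainders are left.\<close>
      have "\<psi>' s = t *\<^sub>R (a - b)"
        unfolding \<psi>'_def a_def b_def
        by (simp add: B.add B.scaleR algebra_simps power2_eq_square)
      moreover have "norm (a - b) \<le> \<epsilon> * (t * K) + \<epsilon> * (t * K)"
        using norm_triangle_ineq4[of a b] est[OF le1(1)[OF s]] est[OF le1(2)[OF s]]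
        unfolding a_def b_def by linarith
      ultimately have "norm (\<psi>' s) \<le> t * (\<epsilon> * (t * K) + \<epsilon> * (t * K))"
        using t by (simp del: scaleR_diff_right add: mult_left_mono)
      then show ?thesis by (simp only: mult_2)
    qed
    define C where "C = t * (2 * (\<epsilon> * (t * K)))"
    have "norm (\<psi> 1 - \<psi> 0) \<le> C * 1 - C * 0"
    proof (rule differentiable_bound_general[of 0 1 \<psi> "\<lambda>s. C * s" \<psi>' "\<lambda>_. C"])
      show "continuous_on {0..1} \<psi>"
      proof (rule continuous_at_imp_continuous_on, rule ballI)
        show "isCont \<psi> x" if "x \<in> {0..1}" for x
          by (rule has_vector_derivative_continuous[OF \<psi>]) (use that in auto)
      qed
      show "((\<lambda>s. C * s) has_vector_derivative C) (at x)" for x :: real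
        by (auto intro!: derivative_eq_intros)
      show "continuous_on {0..1} (\<lambda>s. C * s)" by (intro continuous_intros)
    qed (use \<psi> bnd in \<open>simp_all add: C_def\<close>)
    moreover have "\<psi> 1 - \<psi> 0 = (f (p + t *\<^sub>R v + t *\<^sub>R w) - f (p + t *\<^sub>R v) - f (p + t *\<^sub>R w) + f p) - t\<^sup>2 *\<^sub>R B v"
      by (simp add: \<psi>_def algebra_simps)
    ultimately have "norm ((f (p + t *\<^sub>R v + t *\<^sub>R w) - f (p + t *\<^sub>R v) - f (p + t *\<^sub>R w) + f p) - t\<^sup>2 *\<^sub>R B v) \<le> C"
      by simp
    moreover have "C = t\<^sup>2 * (\<epsilon>' / 2)"
      using K by (simp add: C_def \<epsilon>_def power2_eq_square)
    moreover have "norm (x /\<^sub>R t\<^sup>2 - y) = norm (x - t\<^sup>2 *\<^sub>R y) / t\<^sup>2" for x y :: 'w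
    proof -
      have "x /\<^sub>R t\<^sup>2 - y = (x - t\<^sup>2 *\<^sub>R y) /\<^sub>R t\<^sup>2" using t by (simp add: algebra_simps)
      then show ?thesis by (simp add: divide_inverse mult.commute)
    qed
    ultimately have "dist ((f (p + t *\<^sub>R v + t *\<^sub>R w) - f (p + t *\<^sub>R v) - f (p + t *\<^sub>R w) + f p) /\<^sub>R t\<^sup>2) (B v)
        \<le> \<epsilon>' / 2"
      using t by (simp add: dist_norm divide_le_eq mult.commute)
    then show ?thesis using \<open>\<epsilon>' > 0\<close> by linarith
  qed
  then show "\<forall>\<^sub>F t in at_right 0. dist ((f (p + t *\<^sub>R v + t *\<^sub>R w) - f (p + t *\<^sub>R v) - f (p + t *\<^sub>R w) + f p) /\<^sub>R t\<^sup>2) (B v) < \<epsilon>'"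
    using \<open>\<delta> > 0\<close> unfolding eventually_at_right_field by auto
qed

lemma second_derivative_commute:
  assumes "smooth_on S f" "open S" "p \<in> S"
  shows "second_derivative f p v w = second_derivative f p w v"
proof -
  have f': "(f has_derivative frechet_derivative f (at q)) (at q)" if "q \<in> S" for q
    using smooth_on_differentiable_at[OF assms(1,2) that] by (simp add: frechet_derivative_works)
  have *: "((\<lambda>t. (f (p + t *\<^sub>R v + t *\<^sub>R w) - f (p + t *\<^sub>R v) - f (p + t *\<^sub>R w) + f p) /\<^sub>R t\<^sup>2)
    \<longlongrightarrow> second_derivative f p v w) (at_right 0)" for v w
    using smooth_on_differentiable_at[OF smooth_on_frechet_derivative[OF assms(1,2)] assms(2,3), of w]
    by (intro second_difference_tendsto[OF assms(2,3) f']) (simp_all add: frechet_derivative_works)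
  have "((\<lambda>t. (f (p + t *\<^sub>R v + t *\<^sub>R w) - f (p + t *\<^sub>R v) - f (p + t *\<^sub>R w) + f p) /\<^sub>R t\<^sup>2)
    \<longlongrightarrow> second_derivative f p w v) (at_right 0)"
    using *[of w v] by (simp add: algebra_simps)
  then show ?thesis using * tendsto_unique trivial_limit_at_right_real by blast
qed

lemma linear_second_derivative_left:
  assumes "smooth_on S f" "open S" "p \<in> S"
  shows "linear (\<lambda>v. second_derivative f p v w)"
  using smooth_on_differentiable_at[OF smooth_on_frechet_derivative[OF assms(1,2)] assms(2,3), of w]
  by (rule linear_frechet_derivative)

text \<open>Symmetry transfers linearity from the outer direction, where it is linearity of a
  derivative, to the inner one.\<close>

lemma linear_second_derivative_right:
  assumes "smooth_on S f" "open S" "p \<in> S"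
  shows "linear (second_derivative f p v)"
proof -
  have "second_derivative f p v = (\<lambda>w. second_derivative f p w v)"
    by (rule ext) (rule second_derivative_commute[OF assms])
  then show ?thesis using linear_second_derivative_left[OF assms] by simp
qed

text \<open>With a left inverse \<open>L\<close> of \<open>a t\<close> the equation becomes
  \<open>w s = \<zeta> s\<close> minus the sum of \<open>(w s \<bullet> b) \<beta> b s\<close> over
  the basis, where each \<open>\<beta> b\<close> vanishes at \<open>t\<close>. This yields in turn
  boundedness of \<open>w\<close> near \<open>t\<close>, continuity at \<open>t\<close> and
  convergence of the difference quotients. The coefficients have to be differentiable only argument
  by argument.\<close>

lemma differentiable_solution_of_linear_system:
  fixes a :: "real \<Rightarrow> 'v::euclidean_space \<Rightarrow> 'w::euclidean_space"
  assumes t: "t \<in> J"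
    and lin: "\<forall>\<^sub>F s in at t within J. linear (a s)" "linear (a t)"
    and a': "\<And>v. (\<lambda>s. a s v) differentiable (at t within J)"
    and inj: "inj (a t)"
    and eq: "\<forall>\<^sub>F s in at t within J. a s (w s) = z s" "a t (w t) = z t"
    and z: "z differentiable (at t within J)"
  shows "w differentiable (at t within J)"
proof -
  obtain L where L: "linear L" "L \<circ> a t = id"
    using linear_injective_left_inverse[OF lin(2) inj] by blast
  have Lb: "bounded_linear L" using L(1) by (rule linear_conv_bounded_linear[THEN iffD1])
  have La: "L (a t v) = v" for v using L(2) by (metis comp_apply id_apply)
  \<comment> \<open>The deviation of \<open>L \<circ> a s\<close> from the identity on the vector
    \<open>b\<close>.\<close>
  define \<beta> where "\<beta> b s = L (a s b) - b" for b s
  define \<zeta> where "\<zeta> s = L (z s)" for s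
  have comp: "(\<lambda>s. L (g s)) differentiable (at t within J)"
    if "g differentiable (at t within J)" for g :: "real \<Rightarrow> 'w"
    using bounded_linear.has_derivative[OF Lb] that unfolding differentiable_def by blast
  have \<beta>': "\<beta> b differentiable (at t within J)" for b
    unfolding \<beta>_def by (intro differentiable_diff differentiable_const comp a')
  have \<zeta>': "\<zeta> differentiable (at t within J)"
    unfolding \<zeta>_def by (rule comp[OF z])
  have \<beta>0: "(\<beta> b \<longlongrightarrow> 0) (at t within J)" for b
    using differentiable_imp_continuous_within[OF \<beta>'[of b]]
    by (simp add: continuous_within \<beta>_def La)
  have \<zeta>0: "(\<zeta> \<longlongrightarrow> w t) (at t within J)"
    using differentiable_imp_continuous_within[OF \<zeta>'] eq(2)
    by (metis continuous_within \<zeta>_def La)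
  have weq: "w s = \<zeta> s - (\<Sum>b\<in>Basis. (w s \<bullet> b) *\<^sub>R \<beta> b s)" if "linear (a s)" "a s (w s) = z s" for s
  proof -
    have "linear (\<lambda>v. L (a s v))" using that L(1) linear_compose[of "a s" L] by (simp add: o_def)
    then have "\<zeta> s = (\<Sum>b\<in>Basis. (w s \<bullet> b) *\<^sub>R L (a s b))"
      unfolding \<zeta>_def that(2)[symmetric] by (rule linear_euclidean_expansion)
    then show ?thesis
      by (simp add: \<beta>_def scaleR_diff_right sum_subtractf euclidean_representation)
  qed
  have ev: "\<forall>\<^sub>F s in at t within J. w s = \<zeta> s - (\<Sum>b\<in>Basis. (w s \<bullet> b) *\<^sub>R \<beta> b s)"
    using lin(1) eq(1) by eventually_elim (rule weq)
  have "((\<lambda>s. \<Sum>b\<in>Basis. norm (\<beta> b s)) \<longlongrightarrow> (\<Sum>b\<in>(Basis::'v set). 0)) (at t within J)"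
    by (intro tendsto_sum tendsto_norm_zero \<beta>0)
  \<comment> \<open>Below 1/2 the sum containing \<open>w s\<close> can be absorbed into the left
    side: \<open>norm (w s) \<le> norm (\<zeta> s) + norm (w s) / 2\<close>.\<close>
  then have "\<forall>\<^sub>F s in at t within J. (\<Sum>b\<in>(Basis::'v set). norm (\<beta> b s)) < 1/2"
    by (rule order_tendstoD(2)) simp
  moreover have "\<forall>\<^sub>F s in at t within J. norm (\<zeta> s) < norm (w t) + 1"
    using tendsto_norm[OF \<zeta>0] by (auto intro: order_tendstoD(2))
  ultimately have bdd: "\<forall>\<^sub>F s in at t within J. norm (w s) \<le> 2 * (norm (w t) + 1)"
    using ev
  proof eventually_elim
    case (elim s)
    have "norm (\<Sum>b\<in>Basis. (w s \<bullet> b) *\<^sub>R \<beta> b s) \<le> (\<Sum>b\<in>Basis. norm (w s) * norm (\<beta> b s))"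
      by (rule sum_norm_le) (auto intro!: mult_right_mono simp: Basis_le_norm)
    also have "\<dots> = norm (w s) * (\<Sum>b\<in>Basis. norm (\<beta> b s))" by (simp add: sum_distrib_left)
    also have "\<dots> \<le> norm (w s) * (1/2)" using elim(1) by (intro mult_left_mono) auto
    finally have "norm (w s) \<le> norm (\<zeta> s) + norm (w s) * (1/2)"
      using norm_triangle_ineq4[of "\<zeta> s" "\<Sum>b\<in>Basis. (w s \<bullet> b) *\<^sub>R \<beta> b s"] elim(3) by simp
    then show ?case using elim(2) by simp
  qed
  have "((\<lambda>s. (w s \<bullet> b) *\<^sub>R \<beta> b s) \<longlongrightarrow> 0) (at t within J)" if "b \<in> Basis" for b
  proof (rule Lim_null_comparison)
    show "\<forall>\<^sub>F s in at t within J. norm ((w s \<bullet> b) *\<^sub>R \<beta> b s) \<le> 2 * (norm (w t) + 1) * norm (\<beta> b s)"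
      using bdd
    proof eventually_elim
      case (elim s)
      then have "\<bar>w s \<bullet> b\<bar> \<le> 2 * (norm (w t) + 1)" using Basis_le_norm[OF that, of "w s"] by linarith
      then show ?case by (simp add: mult_right_mono)
    qed
    show "((\<lambda>s. 2 * (norm (w t) + 1) * norm (\<beta> b s)) \<longlongrightarrow> 0) (at t within J)"
      by (intro tendsto_mult_right_zero tendsto_norm_zero \<beta>0)
  qed
  then have "((\<lambda>s. \<zeta> s - (\<Sum>b\<in>Basis. (w s \<bullet> b) *\<^sub>R \<beta> b s)) \<longlongrightarrow> w t - (\<Sum>b\<in>(Basis::'v set). 0)) (at t within J)"
    by (intro tendsto_diff tendsto_sum \<zeta>0)
  then have w0: "(w \<longlongrightarrow> w t) (at t within J)"
    using tendsto_cong[OF ev] by simp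
  have quot: "(f has_vector_derivative d) (at t within J) \<longleftrightarrow>
      ((\<lambda>s. (f s - f t) /\<^sub>R (s - t)) \<longlongrightarrow> d) (at t within J)" for f :: "real \<Rightarrow> 'v" and d
  proof -
    have "((\<lambda>s. norm (f s - f t - (s - t) *\<^sub>R d) / norm (s - t)) \<longlongrightarrow> 0) (at t within J) \<longleftrightarrow>
        ((\<lambda>s. norm ((f s - f t) /\<^sub>R (s - t) - d)) \<longlongrightarrow> 0) (at t within J)"
    proof (rule tendsto_cong, unfold eventually_at_filter, rule always_eventually, intro allI impI)
      fix s assume "s \<noteq> t"
      then have "f s - f t - (s - t) *\<^sub>R d = (s - t) *\<^sub>R ((f s - f t) /\<^sub>R (s - t) - d)"
        by (simp add: scaleR_diff_right)
      then show "norm (f s - f t - (s - t) *\<^sub>R d) / norm (s - t) = norm ((f s - f t) /\<^sub>R (s - t) - d)"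
        using \<open>s \<noteq> t\<close> by simp
    qed
    then show ?thesis
      unfolding has_vector_derivative_def has_derivative_iff_norm
      by (simp add: bounded_linear_scaleR_left tendsto_norm_zero_iff LIM_zero_iff)
  qed
  obtain \<zeta>1 where \<zeta>1: "((\<lambda>s. (\<zeta> s - \<zeta> t) /\<^sub>R (s - t)) \<longlongrightarrow> \<zeta>1) (at t within J)"
    using \<zeta>'[unfolded vector_derivative_works quot] by blast
  obtain \<beta>1 where \<beta>1: "\<And>b. ((\<lambda>s. (\<beta> b s - \<beta> b t) /\<^sub>R (s - t)) \<longlongrightarrow> \<beta>1 b) (at t within J)"
    by (rule that[OF \<beta>'[unfolded vector_derivative_works quot]])
  \<comment> \<open>Since \<open>\<beta> b t = 0\<close>, dividing
    \<open>(w s \<bullet> b) \<beta> b s\<close> by \<open>s - t\<close> leaves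
    \<open>w s \<bullet> b\<close> times a difference quotient of \<open>\<beta> b\<close>.
    Continuity of \<open>w\<close> at \<open>t\<close> is therefore enough to pass to the
    limit.\<close>
  have "((\<lambda>s. (\<zeta> s - \<zeta> t) /\<^sub>R (s - t) - (\<Sum>b\<in>Basis. (w s \<bullet> b) *\<^sub>R ((\<beta> b s - \<beta> b t) /\<^sub>R (s - t))))
      \<longlongrightarrow> \<zeta>1 - (\<Sum>b\<in>Basis. (w t \<bullet> b) *\<^sub>R \<beta>1 b)) (at t within J)"
    by (intro tendsto_diff tendsto_sum tendsto_scaleR tendsto_inner tendsto_const w0 \<zeta>1 \<beta>1)
  moreover have "\<forall>\<^sub>F s in at t within J. (\<zeta> s - \<zeta> t) /\<^sub>R (s - t) -
      (\<Sum>b\<in>Basis. (w s \<bullet> b) *\<^sub>R ((\<beta> b s - \<beta> b t) /\<^sub>R (s - t))) = (w s - w t) /\<^sub>R (s - t)"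
    using ev
  proof eventually_elim
    case (elim s)
    have "\<beta> b t = 0" for b by (simp add: \<beta>_def La)
    moreover have "w s - w t = \<zeta> s - \<zeta> t - (\<Sum>b\<in>Basis. (w s \<bullet> b) *\<^sub>R \<beta> b s)"
      using arg_cong[OF elim, of "\<lambda>x. x - w t"] eq(2) La[of "w t"] by (simp add: \<zeta>_def)
    ultimately show ?case
      by (simp only:) (simp add: scaleR_diff_right scaleR_sum_right mult.commute)
  qed
  ultimately have "(w has_vector_derivative \<zeta>1 - (\<Sum>b\<in>Basis. (w t \<bullet> b) *\<^sub>R \<beta>1 b)) (at t within J)"
    unfolding quot by (rule Lim_transform_eventually)
  then show ?thesis by (rule differentiableI_vector)
qed

section \<open>Charts and tangent vectors\<close>

lemma chart_inv_chart: "inj_on (snd \<kappa>) (fst \<kappa>) \<Longrightarrow> p \<in> fst \<kappa> \<Longrightarrow> chart_inv \<kappa> (snd \<kappa> p) = p"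
  unfolding chart_inv_def by (rule inv_into_f_f)

lemma chart_chart_inv: "x \<in> snd \<kappa> ` fst \<kappa> \<Longrightarrow> snd \<kappa> (chart_inv \<kappa> x) = x"
  unfolding chart_inv_def by (rule f_inv_into_f)

lemma chart_inv_in_domain: "x \<in> snd \<kappa> ` fst \<kappa> \<Longrightarrow> chart_inv \<kappa> x \<in> fst \<kappa>"
  unfolding chart_inv_def by (rule inv_into_into)

lemma charts_atD: "\<kappa> \<in> charts_at A p \<Longrightarrow> \<kappa> \<in> A" "\<kappa> \<in> charts_at A p \<Longrightarrow> p \<in> fst \<kappa>"
  by (auto simp: charts_at_def)

lemma some_chart_in_charts_at: "\<kappa> \<in> charts_at A p \<Longrightarrow> some_chart A p \<in> charts_at A p"
  unfolding some_chart_def by (rule someI[of "\<lambda>\<kappa>. \<kappa> \<in> charts_at A p"])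

lemma in_tangent_space_iff:
  "\<xi> \<in> tangent_space A p \<longleftrightarrow> fst \<xi> = p \<and>
    (\<forall>\<kappa>. \<kappa> \<notin> charts_at A p \<longrightarrow> snd \<xi> \<kappa> = 0) \<and>
    (\<forall>\<kappa>\<in>charts_at A p. \<forall>\<kappa>'\<in>charts_at A p.
      snd \<xi> \<kappa>' = frechet_derivative (snd \<kappa>' \<circ> chart_inv \<kappa>) (at (snd \<kappa> p)) (snd \<xi> \<kappa>))"
proof (cases \<xi>)
  case (Pair a b)
  show ?thesis
    unfolding tangent_space_def mem_Collect_eq Pair prod.inject fst_conv snd_conv by blast
qed

lemma tangent_spaceD:
  assumes "\<xi> \<in> tangent_space A p"
  shows "fst \<xi> = p" "\<kappa> \<notin> charts_at A p \<Longrightarrow> snd \<xi> \<kappa> = 0"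
    "\<kappa> \<in> charts_at A p \<Longrightarrow> \<kappa>' \<in> charts_at A p \<Longrightarrow>
      snd \<xi> \<kappa>' = frechet_derivative (snd \<kappa>' \<circ> chart_inv \<kappa>) (at (snd \<kappa> p)) (snd \<xi> \<kappa>)"
  using assms unfolding in_tangent_space_iff by blast+

lemma tangent_spaceI:
  assumes "fst \<xi> = p" "\<And>\<kappa>. \<kappa> \<notin> charts_at A p \<Longrightarrow> snd \<xi> \<kappa> = 0"
    "\<And>\<kappa> \<kappa>'. \<kappa> \<in> charts_at A p \<Longrightarrow> \<kappa>' \<in> charts_at A p \<Longrightarrow>
      snd \<xi> \<kappa>' = frechet_derivative (snd \<kappa>' \<circ> chart_inv \<kappa>) (at (snd \<kappa> p)) (snd \<xi> \<kappa>)"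
  shows "\<xi> \<in> tangent_space A p"
  using assms unfolding in_tangent_space_iff by blast

text \<open>The transformation law recovers all coordinates from those in one chart, so equations
  between tangent vectors can be checked in a convenient chart.\<close>

lemma tangent_space_eqI:
  assumes "\<xi> \<in> tangent_space A p" "\<zeta> \<in> tangent_space A p" "\<kappa> \<in> charts_at A p"
    and "snd \<xi> \<kappa> = snd \<zeta> \<kappa>"
  shows "\<xi> = \<zeta>"
proof (rule prod_eqI)
  show "fst \<xi> = fst \<zeta>" using assms(1,2) by (simp add: tangent_spaceD(1))
  show "snd \<xi> = snd \<zeta>"
  proof
    fix \<kappa>'
    show "snd \<xi> \<kappa>' = snd \<zeta> \<kappa>'"
    proof (cases "\<kappa>' \<in> charts_at A p")
      case True
      then show ?thesis
        using tangent_spaceD(3)[OF assms(1,3) True] tangent_spaceD(3)[OF assms(2,3) True] assms(4) by simp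
    next
      case False
      then show ?thesis using tangent_spaceD(2)[OF assms(1)] tangent_spaceD(2)[OF assms(2)] by simp
    qed
  qed
qed

lemma tzero_simps [simp]: "fst (tzero p) = p" "snd (tzero p) \<kappa> = 0"
  by (simp_all add: tzero_def)

lemma tadd_simps [simp]: "fst (tadd \<xi> \<zeta>) = fst \<xi>" "snd (tadd \<xi> \<zeta>) \<kappa> = snd \<xi> \<kappa> + snd \<zeta> \<kappa>"
  by (simp_all add: tadd_def)

lemma tscale_simps [simp]: "fst (tscale r \<xi>) = fst \<xi>" "snd (tscale r \<xi>) \<kappa> = r *\<^sub>R snd \<xi> \<kappa>"
  by (simp_all add: tscale_def)

lemma tdiff_simps [simp]: "fst (tdiff \<xi> \<zeta>) = fst \<xi>" "snd (tdiff \<xi> \<zeta>) \<kappa> = snd \<xi> \<kappa> - snd \<zeta> \<kappa>"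
  by (simp_all add: tdiff_def)

lemma tlincomb_simps [simp]: "fst (tlincomb p n a E) = p"
  "snd (tlincomb p n a E) \<kappa> = (\<Sum>i<n. a i *\<^sub>R snd (E i) \<kappa>)"
  by (simp_all add: tlincomb_def)

text \<open>Kept weaker than \<open>smooth_charts\<close> so that it also applies to the atlas of
  the tangent bundle, for which only differentiable transition maps are established. Everything
  about vectors tangent to the tangent bundle is then an instance of the lemmas below.\<close>

locale differentiable_atlas =
  fixes A :: "('a, 'e::euclidean_space) chart set"
  assumes chart_inj: "\<kappa> \<in> A \<Longrightarrow> inj_on (snd \<kappa>) (fst \<kappa>)"
    and open_overlap: "\<kappa> \<in> A \<Longrightarrow> \<kappa>' \<in> A \<Longrightarrow> open (snd \<kappa> ` (fst \<kappa> \<inter> fst \<kappa>'))"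
    and transition_differentiable_on: "\<kappa> \<in> A \<Longrightarrow> \<kappa>' \<in> A \<Longrightarrow>
      (snd \<kappa>' \<circ> chart_inv \<kappa>) differentiable_on snd \<kappa> ` (fst \<kappa> \<inter> fst \<kappa>')"
begin

lemma chart_inv_chart_at: "\<kappa> \<in> charts_at A p \<Longrightarrow> chart_inv \<kappa> (snd \<kappa> p) = p"
  using chart_inj by (auto simp: charts_at_def intro: chart_inv_chart)

lemma transition_differentiable:
  assumes "\<kappa> \<in> charts_at A p" "\<kappa>' \<in> charts_at A p"
  shows "(snd \<kappa>' \<circ> chart_inv \<kappa>) differentiable at (snd \<kappa> p)"
  using transition_differentiable_on[of \<kappa> \<kappa>'] open_overlap[of \<kappa> \<kappa>'] assms
  by (auto simp: charts_at_def differentiable_on_eq_differentiable_at)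

lemma transition_self:
  assumes "\<kappa> \<in> charts_at A p"
  shows "frechet_derivative (snd \<kappa> \<circ> chart_inv \<kappa>) (at (snd \<kappa> p)) = (\<lambda>v. v)"
proof -
  have "frechet_derivative (snd \<kappa> \<circ> chart_inv \<kappa>) (at (snd \<kappa> p)) = frechet_derivative (\<lambda>v. v) (at (snd \<kappa> p))"
    using charts_atD[OF assms] open_overlap[of \<kappa> \<kappa>]
    by (intro frechet_derivative_cong_open[of "snd \<kappa> ` fst \<kappa>"]) (auto simp: chart_inv_chart chart_inj)
  then show ?thesis by simp
qed

text \<open>The chain rule through the coordinate change. The composite agrees with
  \<open>f \<circ> chart_inv \<kappa>\<close> only on the image of the overlap, which is an open
  neighbourhood of the point.\<close>

lemma has_derivative_change_chart:
  fixes f :: "'a \<Rightarrow> 'w::real_normed_vector"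
  assumes \<kappa>: "\<kappa> \<in> charts_at A p" "\<kappa>' \<in> charts_at A p"
    and f: "(f \<circ> chart_inv \<kappa>') differentiable at (snd \<kappa>' p)"
  shows "((f \<circ> chart_inv \<kappa>) has_derivative
    (\<lambda>v. frechet_derivative (f \<circ> chart_inv \<kappa>') (at (snd \<kappa>' p))
      (frechet_derivative (snd \<kappa>' \<circ> chart_inv \<kappa>) (at (snd \<kappa> p)) v))) (at (snd \<kappa> p))"
proof -
  have "((snd \<kappa>' \<circ> chart_inv \<kappa>) has_derivative
      frechet_derivative (snd \<kappa>' \<circ> chart_inv \<kappa>) (at (snd \<kappa> p))) (at (snd \<kappa> p))"
    using transition_differentiable[OF \<kappa>] frechet_derivative_works by blast
  moreover have "((f \<circ> chart_inv \<kappa>') has_derivative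
      frechet_derivative (f \<circ> chart_inv \<kappa>') (at (snd \<kappa>' p))) (at ((snd \<kappa>' \<circ> chart_inv \<kappa>) (snd \<kappa> p)))"
    using f by (simp add: chart_inv_chart_at[OF \<kappa>(1)] flip: frechet_derivative_works)
  ultimately have "(((f \<circ> chart_inv \<kappa>') \<circ> (snd \<kappa>' \<circ> chart_inv \<kappa>)) has_derivative
    (\<lambda>v. frechet_derivative (f \<circ> chart_inv \<kappa>') (at (snd \<kappa>' p))
      (frechet_derivative (snd \<kappa>' \<circ> chart_inv \<kappa>) (at (snd \<kappa> p)) v))) (at (snd \<kappa> p))"
    by (drule_tac diff_chain_at) (simp_all add: comp_def)
  then show ?thesis
  proof (rule has_derivative_transform_within_open)
    show "open (snd \<kappa> ` (fst \<kappa> \<inter> fst \<kappa>'))" "snd \<kappa> p \<in> snd \<kappa> ` (fst \<kappa> \<inter> fst \<kappa>')"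
      using \<kappa> open_overlap by (auto simp: charts_at_def)
    show "(f \<circ> chart_inv \<kappa>' \<circ> (snd \<kappa>' \<circ> chart_inv \<kappa>)) x = (f \<circ> chart_inv \<kappa>) x"
      if "x \<in> snd \<kappa> ` (fst \<kappa> \<inter> fst \<kappa>')" for x
      using that charts_atD(1)[OF \<kappa>(1)] charts_atD(1)[OF \<kappa>(2)]
      by (auto simp: chart_inv_chart chart_inj)
  qed
qed

lemma transition_transition:
  assumes "\<kappa> \<in> charts_at A p" "\<kappa>' \<in> charts_at A p" "\<kappa>'' \<in> charts_at A p"
  shows "frechet_derivative (snd \<kappa>'' \<circ> chart_inv \<kappa>') (at (snd \<kappa>' p))
      (frechet_derivative (snd \<kappa>' \<circ> chart_inv \<kappa>) (at (snd \<kappa> p)) v)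
    = frechet_derivative (snd \<kappa>'' \<circ> chart_inv \<kappa>) (at (snd \<kappa> p)) v"
  using frechet_derivative_at[OF has_derivative_change_chart[OF assms(1,2)
      transition_differentiable[OF assms(2,3)]]] by (simp add: fun_eq_iff)

lemma coord_vector_in_tangent_space:
  "\<kappa> \<in> charts_at A p \<Longrightarrow> coord_vector A p \<kappa> a \<in> tangent_space A p"
  by (rule tangent_spaceI) (simp_all add: coord_vector_def transition_transition)

lemma coord_vector_component: "\<kappa> \<in> charts_at A p \<Longrightarrow> snd (coord_vector A p \<kappa> a) \<kappa> = a"
  by (simp add: coord_vector_def transition_self)

lemma coord_vector_of_component:
  assumes "\<xi> \<in> tangent_space A p" "\<kappa> \<in> charts_at A p"
  shows "coord_vector A p \<kappa> (snd \<xi> \<kappa>) = \<xi>"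
  using assms
  by (intro tangent_space_eqI[of _ A p _ \<kappa>])
    (simp_all add: coord_vector_in_tangent_space coord_vector_component)

lemma linear_transition:
  "\<kappa> \<in> charts_at A p \<Longrightarrow> \<kappa>' \<in> charts_at A p \<Longrightarrow>
    linear (frechet_derivative (snd \<kappa>' \<circ> chart_inv \<kappa>) (at (snd \<kappa> p)))"
  by (intro linear_frechet_derivative transition_differentiable)

lemma tangent_space_tadd:
  "\<xi> \<in> tangent_space A p \<Longrightarrow> \<zeta> \<in> tangent_space A p \<Longrightarrow> tadd \<xi> \<zeta> \<in> tangent_space A p"
  by (rule tangent_spaceI)
    (simp_all add: tangent_spaceD(1,2) linear_add[OF linear_transition] flip: tangent_spaceD(3))

lemma tangent_space_tscale: "\<xi> \<in> tangent_space A p \<Longrightarrow> tscale r \<xi> \<in> tangent_space A p"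
  by (rule tangent_spaceI)
    (simp_all add: tangent_spaceD(1,2) linear_scale[OF linear_transition] flip: tangent_spaceD(3))

lemma tangent_space_tdiff:
  "\<xi> \<in> tangent_space A p \<Longrightarrow> \<zeta> \<in> tangent_space A p \<Longrightarrow> tdiff \<xi> \<zeta> \<in> tangent_space A p"
  unfolding tdiff_def by (intro tangent_space_tadd tangent_space_tscale)

lemma tangent_space_tlincomb:
  assumes "\<And>i. i < n \<Longrightarrow> E i \<in> tangent_space A p"
  shows "tlincomb p n a E \<in> tangent_space A p"
proof (rule tangent_spaceI)
  show "snd (tlincomb p n a E) \<kappa> = 0" if "\<kappa> \<notin> charts_at A p" for \<kappa>
    using that by (simp add: tangent_spaceD(2)[OF assms])
  fix \<kappa> \<kappa>' assume \<kappa>: "\<kappa> \<in> charts_at A p" "\<kappa>' \<in> charts_at A p"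
  show "snd (tlincomb p n a E) \<kappa>' =
      frechet_derivative (snd \<kappa>' \<circ> chart_inv \<kappa>) (at (snd \<kappa> p)) (snd (tlincomb p n a E) \<kappa>)"
    by (simp add: linear_sum[OF linear_transition[OF \<kappa>]] linear_scale[OF linear_transition[OF \<kappa>]]
        flip: tangent_spaceD(3)[OF assms \<kappa>])
qed simp

text \<open>\<open>pushforward\<close> computes in \<open>some_chart\<close>; the transformation law
  of \<open>\<xi>\<close> compensates the change to any other chart at \<open>p\<close>.\<close>

lemma pushforward_component:
  assumes "\<xi> \<in> tangent_space A p" "\<kappa> \<in> charts_at A p" "\<kappa>' \<in> charts_at B (F p)"
    and "(snd \<kappa>' \<circ> F \<circ> chart_inv \<kappa>) differentiable at (snd \<kappa> p)"
  shows "snd (pushforward A B F \<xi>) \<kappa>' =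
    frechet_derivative (snd \<kappa>' \<circ> F \<circ> chart_inv \<kappa>) (at (snd \<kappa> p)) (snd \<xi> \<kappa>)"
proof -
  define \<kappa>0 where "\<kappa>0 = some_chart A p"
  have \<kappa>0: "\<kappa>0 \<in> charts_at A p" using assms(2) by (simp add: \<kappa>0_def some_chart_in_charts_at)
  have "snd (pushforward A B F \<xi>) \<kappa>' =
      frechet_derivative (snd \<kappa>' \<circ> F \<circ> chart_inv \<kappa>0) (at (snd \<kappa>0 p)) (snd \<xi> \<kappa>0)"
    using assms(3) by (simp add: pushforward_def Let_def tangent_spaceD(1)[OF assms(1)] \<kappa>0_def)
  also have "\<dots> = frechet_derivative (snd \<kappa>' \<circ> F \<circ> chart_inv \<kappa>) (at (snd \<kappa> p))
      (frechet_derivative (snd \<kappa> \<circ> chart_inv \<kappa>0) (at (snd \<kappa>0 p)) (snd \<xi> \<kappa>0))"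
    using frechet_derivative_at[OF has_derivative_change_chart[OF \<kappa>0 assms(2,4)]]
    by (simp add: fun_eq_iff)
  finally show ?thesis using tangent_spaceD(3)[OF assms(1) \<kappa>0 assms(2)] by simp
qed

lemma velocity_component:
  "\<kappa> \<in> charts_at A (c t) \<Longrightarrow> snd (velocity A J c t) \<kappa> = vector_derivative (snd \<kappa> \<circ> c) (at t within J)"
  by (simp add: velocity_def)

text \<open>The hypotheses are local and chart by chart so that the lemma serves both for curves on
  an interval in the group and for lines in a fibre of the tangent bundle. The filter must be
  nontrivial for \<open>vector_derivative\<close> to be unique.\<close>

lemma velocity_in_tangent_space:
  assumes t: "t \<in> J" "at t within J \<noteq> bot"
    and diff: "\<And>\<kappa>. \<kappa> \<in> charts_at A (c t) \<Longrightarrow> (snd \<kappa> \<circ> c) differentiable (at t within J)"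
    and ev: "\<And>\<kappa>. \<kappa> \<in> charts_at A (c t) \<Longrightarrow> \<forall>\<^sub>F s in at t within J. c s \<in> fst \<kappa>"
  shows "velocity A J c t \<in> tangent_space A (c t)"
proof (rule tangent_spaceI)
  fix \<kappa> \<kappa>' assume \<kappa>: "\<kappa> \<in> charts_at A (c t)" "\<kappa>' \<in> charts_at A (c t)"
  let ?v = "vector_derivative (snd \<kappa> \<circ> c) (at t within J)"
  let ?T = "frechet_derivative (snd \<kappa>' \<circ> chart_inv \<kappa>) (at (snd \<kappa> (c t)))"
  have "((snd \<kappa> \<circ> c) has_derivative (\<lambda>h. h *\<^sub>R ?v)) (at t within J)"
    using diff[OF \<kappa>(1)] by (simp add: vector_derivative_works has_vector_derivative_def)
  moreover have T: "((snd \<kappa>' \<circ> chart_inv \<kappa>) has_derivative ?T) (at ((snd \<kappa> \<circ> c) t))"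
    using transition_differentiable[OF \<kappa>] by (simp add: frechet_derivative_works)
  ultimately have "((\<lambda>s. (snd \<kappa>' \<circ> chart_inv \<kappa>) ((snd \<kappa> \<circ> c) s)) has_derivative (\<lambda>h. ?T (h *\<^sub>R ?v)))
      (at t within J)"
    by (rule has_derivative_compose)
  moreover have "\<forall>\<^sub>F s in at t within J. (snd \<kappa>' \<circ> chart_inv \<kappa>) ((snd \<kappa> \<circ> c) s) = (snd \<kappa>' \<circ> c) s"
    using ev[OF \<kappa>(1)]
    by eventually_elim (simp add: chart_inv_chart chart_inj charts_atD(1)[OF \<kappa>(1)])
  moreover have "(snd \<kappa>' \<circ> chart_inv \<kappa>) ((snd \<kappa> \<circ> c) t) = (snd \<kappa>' \<circ> c) t"
    by (simp add: chart_inv_chart_at[OF \<kappa>(1)])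
  ultimately have "((snd \<kappa>' \<circ> c) has_derivative (\<lambda>h. ?T (h *\<^sub>R ?v))) (at t within J)"
    using t(1) by (rule has_derivative_transform_eventually)
  then have "((snd \<kappa>' \<circ> c) has_vector_derivative ?T ?v) (at t within J)"
    using linear_transition[OF \<kappa>] by (simp add: has_vector_derivative_def linear_scale)
  from vector_derivative_within[OF t(2) this]
  show "snd (velocity A J c t) \<kappa>' = ?T (snd (velocity A J c t) \<kappa>)"
    using \<kappa> by (simp add: velocity_component)
qed (simp_all add: velocity_def)

end

locale smooth_charts =
  fixes A :: "('a, 'e::euclidean_space) chart set"
  assumes chart_inj: "\<kappa> \<in> A \<Longrightarrow> inj_on (snd \<kappa>) (fst \<kappa>)"
    and open_overlap: "\<kappa> \<in> A \<Longrightarrow> \<kappa>' \<in> A \<Longrightarrow> open (snd \<kappa> ` (fst \<kappa> \<inter> fst \<kappa>'))"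
    and smooth_transition: "\<kappa> \<in> A \<Longrightarrow> \<kappa>' \<in> A \<Longrightarrow>
      smooth_on (snd \<kappa> ` (fst \<kappa> \<inter> fst \<kappa>')) (snd \<kappa>' \<circ> chart_inv \<kappa>)"
begin

sublocale differentiable_atlas A
  by unfold_locales
    (simp_all add: chart_inj open_overlap smooth_transition smooth_on_imp_differentiable_on)

lemma open_chart_image: "\<kappa> \<in> A \<Longrightarrow> open (snd \<kappa> ` fst \<kappa>)"
  using open_overlap[of \<kappa> \<kappa>] by simp

section \<open>Standard charts of the tangent bundle\<close>

lemma coord_vector_in_standard_chart:
  assumes "\<kappa> \<in> A" "x \<in> snd \<kappa> ` fst \<kappa>"
  shows "coord_vector A (chart_inv \<kappa> x) \<kappa> y \<in> fst (standard_chart A \<kappa>)"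
    "snd (standard_chart A \<kappa>) (coord_vector A (chart_inv \<kappa> x) \<kappa> y) = (x, y)"
proof -
  have \<kappa>: "\<kappa> \<in> charts_at A (chart_inv \<kappa> x)"
    using assms by (simp add: charts_at_def chart_inv_in_domain)
  show "coord_vector A (chart_inv \<kappa> x) \<kappa> y \<in> fst (standard_chart A \<kappa>)"
    using coord_vector_in_tangent_space[OF \<kappa>, of y] chart_inv_in_domain[OF assms(2)] assms(1)
    by (auto simp: standard_chart_def tangent_bundle_def coord_vector_def)
  show "snd (standard_chart A \<kappa>) (coord_vector A (chart_inv \<kappa> x) \<kappa> y) = (x, y)"
    using coord_vector_component[OF \<kappa>, of y] assms
    by (simp add: standard_chart_def chart_chart_inv) (simp add: coord_vector_def chart_chart_inv)
qed

lemma in_standard_chart_iff: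
  assumes "\<kappa> \<in> A"
  shows "\<xi> \<in> fst (standard_chart A \<kappa>) \<longleftrightarrow> fst \<xi> \<in> fst \<kappa> \<and> \<xi> \<in> tangent_space A (fst \<xi>)"
  using assms tangent_spaceD(1) by (fastforce simp: standard_chart_def tangent_bundle_def)

lemma inj_standard_chart:
  assumes "\<kappa> \<in> A"
  shows "inj_on (snd (standard_chart A \<kappa>)) (fst (standard_chart A \<kappa>))"
proof (rule inj_onI)
  fix \<xi> \<zeta> assume *: "\<xi> \<in> fst (standard_chart A \<kappa>)" "\<zeta> \<in> fst (standard_chart A \<kappa>)"
    "snd (standard_chart A \<kappa>) \<xi> = snd (standard_chart A \<kappa>) \<zeta>"
  then have "snd \<kappa> (fst \<xi>) = snd \<kappa> (fst \<zeta>)" and eq: "snd \<xi> \<kappa> = snd \<zeta> \<kappa>"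
    by (simp_all add: standard_chart_def)
  moreover have "fst \<xi> \<in> fst \<kappa>" "fst \<zeta> \<in> fst \<kappa>"
    using *(1,2) assms by (simp_all add: in_standard_chart_iff)
  ultimately have p: "fst \<zeta> = fst \<xi>"
    using chart_inj[OF assms] by (metis inj_onD)
  show "\<xi> = \<zeta>"
  proof (rule tangent_space_eqI)
    show "\<xi> \<in> tangent_space A (fst \<xi>)" "\<zeta> \<in> tangent_space A (fst \<xi>)" "\<kappa> \<in> charts_at A (fst \<xi>)"
      using *(1,2) assms by (simp_all add: in_standard_chart_iff charts_at_def flip: p)
  qed (rule eq)
qed

lemma chart_inv_standard_chart:
  assumes "\<kappa> \<in> A" "x \<in> snd \<kappa> ` fst \<kappa>"
  shows "chart_inv (standard_chart A \<kappa>) (x, y) = coord_vector A (chart_inv \<kappa> x) \<kappa> y"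
  using chart_inv_chart[OF inj_standard_chart[OF assms(1)] coord_vector_in_standard_chart(1)[OF assms]]
    coord_vector_in_standard_chart(2)[OF assms] by simp

lemma standard_chart_overlap:
  assumes "\<kappa> \<in> A" "\<kappa>' \<in> A"
  shows "snd (standard_chart A \<kappa>) ` (fst (standard_chart A \<kappa>) \<inter> fst (standard_chart A \<kappa>')) =
    (snd \<kappa> ` (fst \<kappa> \<inter> fst \<kappa>')) \<times> UNIV"
proof (intro equalityI subsetI)
  fix q assume "q \<in> snd (standard_chart A \<kappa>) ` (fst (standard_chart A \<kappa>) \<inter> fst (standard_chart A \<kappa>'))"
  then obtain \<xi> where \<xi>: "q = snd (standard_chart A \<kappa>) \<xi>"
    "\<xi> \<in> fst (standard_chart A \<kappa>)" "\<xi> \<in> fst (standard_chart A \<kappa>')" by blast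
  then show "q \<in> (snd \<kappa> ` (fst \<kappa> \<inter> fst \<kappa>')) \<times> UNIV"
    by (simp add: standard_chart_def)
next
  fix q assume "q \<in> (snd \<kappa> ` (fst \<kappa> \<inter> fst \<kappa>')) \<times> (UNIV :: 'e set)"
  then obtain p y where q: "q = (snd \<kappa> p, y)" "p \<in> fst \<kappa>" "p \<in> fst \<kappa>'" by auto
  have inv: "chart_inv \<kappa> (snd \<kappa> p) = p" using q assms by (simp add: chart_inv_chart chart_inj)
  let ?\<xi> = "coord_vector A p \<kappa> y"
  have "?\<xi> \<in> fst (standard_chart A \<kappa>)" "snd (standard_chart A \<kappa>) ?\<xi> = q"
    using coord_vector_in_standard_chart[OF assms(1), of "snd \<kappa> p" y] q inv by simp_all
  moreover have "?\<xi> \<in> fst (standard_chart A \<kappa>')"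
    using calculation(1) q assms by (simp add: in_standard_chart_iff) (simp add: coord_vector_def)
  ultimately show "q \<in> snd (standard_chart A \<kappa>) ` (fst (standard_chart A \<kappa>) \<inter> fst (standard_chart A \<kappa>'))"
    by blast
qed

lemma standard_chart_transition:
  assumes "\<kappa> \<in> A" "\<kappa>' \<in> A" "x \<in> snd \<kappa> ` (fst \<kappa> \<inter> fst \<kappa>')"
  shows "(snd (standard_chart A \<kappa>') \<circ> chart_inv (standard_chart A \<kappa>)) (x, y) =
    ((snd \<kappa>' \<circ> chart_inv \<kappa>) x, frechet_derivative (snd \<kappa>' \<circ> chart_inv \<kappa>) (at x) y)"
proof -
  have x: "x \<in> snd \<kappa> ` fst \<kappa>" using assms(3) by blast
  have "chart_inv \<kappa> x \<in> fst \<kappa>'"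
    using assms by (auto simp: chart_inv_chart chart_inj)
  then have "\<kappa>' \<in> charts_at A (chart_inv \<kappa> x)" using assms(2) by (simp add: charts_at_def)
  then show ?thesis
    using x assms
    by (simp add: chart_inv_standard_chart) (simp add: standard_chart_def coord_vector_def chart_chart_inv)
qed

text \<open>The transition maps are \<open>(x, y) \<mapsto> (\<tau> x, D\<tau>(x) y)\<close>. The
  moving point in the second component brings in the second derivative of \<open>\<tau>\<close>, and
  the product rule for moving directions applies.\<close>

lemma differentiable_tangent_atlas: "differentiable_atlas (tangent_atlas A)"
proof (unfold_locales)
  fix \<kappa>1 assume "\<kappa>1 \<in> tangent_atlas A"
  then show "inj_on (snd \<kappa>1) (fst \<kappa>1)"
    by (auto simp: tangent_atlas_def inj_standard_chart)
next
  fix \<kappa>1 \<kappa>2 assume "\<kappa>1 \<in> tangent_atlas A" "\<kappa>2 \<in> tangent_atlas A"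
  then obtain \<kappa> \<kappa>' where \<kappa>: "\<kappa> \<in> A" "\<kappa>' \<in> A" "\<kappa>1 = standard_chart A \<kappa>" "\<kappa>2 = standard_chart A \<kappa>'"
    by (auto simp: tangent_atlas_def)
  let ?U = "snd \<kappa> ` (fst \<kappa> \<inter> fst \<kappa>')"
  let ?\<tau> = "snd \<kappa>' \<circ> chart_inv \<kappa>"
  have open': "open (?U \<times> (UNIV :: 'e set))"
    using open_overlap[OF \<kappa>(1,2)] by (simp add: open_Times)
  then show "open (snd \<kappa>1 ` (fst \<kappa>1 \<inter> fst \<kappa>2))"
    by (simp add: \<kappa> standard_chart_overlap)
  have "(snd \<kappa>2 \<circ> chart_inv \<kappa>1) differentiable at (x, y)" if x: "x \<in> ?U" for x y
  proof -
    have "((\<lambda>q. ?\<tau> (fst q)) has_derivative (\<lambda>h. frechet_derivative ?\<tau> (at x) (fst h))) (at (x, y))"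
    proof (rule has_derivative_compose[OF has_derivative_fst[OF has_derivative_ident]])
      show "(?\<tau> has_derivative frechet_derivative ?\<tau> (at x)) (at (fst (x, y)))"
        using smooth_on_differentiable_at[OF smooth_transition[OF \<kappa>(1,2)] open_overlap[OF \<kappa>(1,2)] x]
        by (simp only: frechet_derivative_works fst_conv)
    qed
    moreover have "((\<lambda>q. frechet_derivative ?\<tau> (at (fst q)) (snd q)) has_derivative
      (\<lambda>h. second_derivative ?\<tau> (fst (x, y)) (fst h) (snd (x, y)) +
        frechet_derivative ?\<tau> (at (fst (x, y))) (snd h))) (at (x, y))"
      using x by (intro has_derivative_frechet_derivative_apply[OF smooth_transition[OF \<kappa>(1,2)]
          open_overlap[OF \<kappa>(1,2)]] derivative_intros) simp_all
    ultimately have "((\<lambda>q. (?\<tau> (fst q), frechet_derivative ?\<tau> (at (fst q)) (snd q))) has_derivative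
      (\<lambda>h. (frechet_derivative ?\<tau> (at x) (fst h), second_derivative ?\<tau> x (fst h) y +
        frechet_derivative ?\<tau> (at x) (snd h)))) (at (x, y))"
      by (auto intro: has_derivative_Pair)
    then have "((snd \<kappa>2 \<circ> chart_inv \<kappa>1) has_derivative
      (\<lambda>h. (frechet_derivative ?\<tau> (at x) (fst h), second_derivative ?\<tau> x (fst h) y +
        frechet_derivative ?\<tau> (at x) (snd h)))) (at (x, y))"
    proof (rule has_derivative_transform_within_open[OF _ open'])
      show "(?\<tau> (fst q), frechet_derivative ?\<tau> (at (fst q)) (snd q)) = (snd \<kappa>2 \<circ> chart_inv \<kappa>1) q"
        if "q \<in> ?U \<times> UNIV" for q
        using that standard_chart_transition[OF \<kappa>(1,2), of "fst q" "snd q"]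
        unfolding \<kappa>(3,4) by (metis mem_Times_iff prod.collapse)
    qed (use x in simp)
    then show ?thesis by (rule differentiableI)
  qed
  then show "(snd \<kappa>2 \<circ> chart_inv \<kappa>1) differentiable_on snd \<kappa>1 ` (fst \<kappa>1 \<inter> fst \<kappa>2)"
    using open' by (auto simp: \<kappa>(3,4) standard_chart_overlap[OF \<kappa>(1,2)] differentiable_on_eq_differentiable_at)
qed

lemma standard_chart_in_charts_at:
  assumes "\<xi> \<in> tangent_space A p" "\<kappa> \<in> charts_at A p"
  shows "standard_chart A \<kappa> \<in> charts_at (tangent_atlas A) \<xi>"
  using assms charts_atD[OF assms(2)] tangent_spaceD(1)[OF assms(1)]
  by (auto simp: charts_at_def tangent_atlas_def in_standard_chart_iff)

lemma charts_at_tangent_atlas: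
  assumes "\<xi> \<in> tangent_space A p" "\<kappa>' \<in> charts_at (tangent_atlas A) \<xi>"
  obtains \<kappa> where "\<kappa> \<in> charts_at A p" "\<kappa>' = standard_chart A \<kappa>"
  using assms tangent_spaceD(1)[OF assms(1)] that
  by (auto simp: charts_at_def tangent_atlas_def in_standard_chart_iff)

end

section \<open>Lie groups in charts\<close>

lemma smooth_atlas_chart:
  assumes "smooth_atlas X A" "\<kappa> \<in> A"
  shows "openin X (fst \<kappa>)" "open (snd \<kappa> ` fst \<kappa>)" "inj_on (snd \<kappa>) (fst \<kappa>)"
    "openin X U \<Longrightarrow> U \<subseteq> fst \<kappa> \<Longrightarrow> open (snd \<kappa> ` U)"
    "continuous_map (top_of_set (snd \<kappa> ` fst \<kappa>)) X (chart_inv \<kappa>)"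
proof -
  show op: "openin X (fst \<kappa>)" and im: "open (snd \<kappa> ` fst \<kappa>)"
    using assms by (auto simp: smooth_atlas_def)
  have hom: "homeomorphic_map (subtopology X (fst \<kappa>)) (top_of_set (snd \<kappa> ` fst \<kappa>)) (snd \<kappa>)"
    using assms by (auto simp: smooth_atlas_def)
  have top: "topspace (subtopology X (fst \<kappa>)) = fst \<kappa>"
    using openin_subset[OF op] by auto
  show inj: "inj_on (snd \<kappa>) (fst \<kappa>)"
    using homeomorphic_imp_injective_map[OF hom] by (simp only: top)
  show "open (snd \<kappa> ` U)" if "openin X U" "U \<subseteq> fst \<kappa>"
  proof -
    have "openin (subtopology X (fst \<kappa>)) U"
      using that openin_open_subtopology[OF op] by blast
    then have "openin (top_of_set (snd \<kappa> ` fst \<kappa>)) (snd \<kappa> ` U)"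
      using homeomorphic_imp_open_map[OF hom] by (simp add: open_map_def)
    then show ?thesis using im openin_open_trans by blast
  qed
  obtain g where g: "homeomorphic_maps (subtopology X (fst \<kappa>)) (top_of_set (snd \<kappa> ` fst \<kappa>)) (snd \<kappa>) g"
    using hom unfolding homeomorphic_map_maps by blast
  then have "continuous_map (top_of_set (snd \<kappa> ` fst \<kappa>)) X g"
    by (simp add: homeomorphic_maps_def continuous_map_in_subtopology)
  \<comment> \<open>\<open>chart_inv\<close> is a choice of preimages; on the chart image
    injectivity forces it to be the continuous inverse \<open>g\<close>.\<close>
  moreover have "g x = chart_inv \<kappa> x" if "x \<in> topspace (top_of_set (snd \<kappa> ` fst \<kappa>))" for x
  proof -
    have "x \<in> snd \<kappa> ` fst \<kappa>" using that by simp
    then obtain p where p: "x = snd \<kappa> p" "p \<in> fst \<kappa>" by (rule imageE)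
    have "\<forall>p\<in>fst \<kappa>. g (snd \<kappa> p) = p" using g unfolding homeomorphic_maps_def top by (elim conjE)
    then show ?thesis using p(2) unfolding p(1) by (simp add: chart_inv_chart[OF inj])
  qed
  ultimately show "continuous_map (top_of_set (snd \<kappa> ` fst \<kappa>)) X (chart_inv \<kappa>)"
    by (rule continuous_map_eq)
qed

locale lie_group_atlas =
  fixes G :: "('a, 'b) monoid_scheme" (structure)
    and X :: "'a topology"
    and A :: "('a, 'e::euclidean_space) chart set"
  assumes lie_group: "lie_group G X A"
begin

sublocale group G
  using lie_group by (simp add: lie_group_def)

lemma smooth_atlas: "smooth_atlas X A"
  using lie_group by (simp add: lie_group_def smooth_manifold_def)

sublocale smooth_charts A
proof
  fix \<kappa> \<kappa>' assume \<kappa>: "\<kappa> \<in> A" "\<kappa>' \<in> A"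
  show "inj_on (snd \<kappa>) (fst \<kappa>)" by (rule smooth_atlas_chart[OF smooth_atlas \<kappa>(1)])
  show "open (snd \<kappa> ` (fst \<kappa> \<inter> fst \<kappa>'))"
    using \<kappa> by (intro smooth_atlas_chart(4)[OF smooth_atlas \<kappa>(1)] openin_Int
        smooth_atlas_chart(1)[OF smooth_atlas]) auto
  show "smooth_on (snd \<kappa> ` (fst \<kappa> \<inter> fst \<kappa>')) (snd \<kappa>' \<circ> chart_inv \<kappa>)"
    using \<kappa> smooth_atlas unfolding smooth_atlas_def by blast
qed

lemma topspace_eq_carrier: "topspace X = carrier G"
  using lie_group by (simp add: lie_group_def)

lemma chart_domain_carrier: "\<kappa> \<in> A \<Longrightarrow> p \<in> fst \<kappa> \<Longrightarrow> p \<in> carrier G"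
  using openin_subset[OF smooth_atlas_chart(1)[OF smooth_atlas]] topspace_eq_carrier by blast

lemma charts_at_carrier: "\<kappa> \<in> charts_at A p \<Longrightarrow> p \<in> carrier G"
  by (auto simp: charts_at_def chart_domain_carrier)

lemma some_chart_at:
  assumes "g \<in> carrier G"
  shows "some_chart A g \<in> charts_at A g"
proof -
  have "g \<in> (\<Union>\<kappa>\<in>A. fst \<kappa>)"
    using assms smooth_atlas topspace_eq_carrier unfolding smooth_atlas_def by metis
  then obtain \<kappa> where "\<kappa> \<in> charts_at A g" unfolding charts_at_def by blast
  then show ?thesis by (rule some_chart_in_charts_at)
qed

section \<open>Multiplication and left translations in coordinates\<close>

definition mult_coord :: "('a, 'e) chart \<Rightarrow> ('a, 'e) chart \<Rightarrow> ('a, 'e) chart \<Rightarrow> 'e \<times> 'e \<Rightarrow> 'e" where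
  "mult_coord \<kappa> \<kappa>' \<kappa>'' = (\<lambda>(x, z). snd \<kappa>'' (chart_inv \<kappa> x \<otimes> chart_inv \<kappa>' z))"

definition mult_domain :: "('a, 'e) chart \<Rightarrow> ('a, 'e) chart \<Rightarrow> ('a, 'e) chart \<Rightarrow> ('e \<times> 'e) set" where
  "mult_domain \<kappa> \<kappa>' \<kappa>'' = {(x, z). x \<in> snd \<kappa> ` fst \<kappa> \<and> z \<in> snd \<kappa>' ` fst \<kappa>' \<and>
     chart_inv \<kappa> x \<otimes> chart_inv \<kappa>' z \<in> fst \<kappa>''}"

lemma mult_domain_at:
  assumes "\<kappa> \<in> charts_at A g" "\<kappa>' \<in> charts_at A h" "\<kappa>'' \<in> charts_at A (g \<otimes> h)"
  shows "(snd \<kappa> g, snd \<kappa>' h) \<in> mult_domain \<kappa> \<kappa>' \<kappa>''"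
  using assms by (simp add: mult_domain_def chart_inv_chart_at charts_atD(2))

lemma open_mult_domain:
  assumes "\<kappa> \<in> A" "\<kappa>' \<in> A" "\<kappa>'' \<in> A"
  shows "open (mult_domain \<kappa> \<kappa>' \<kappa>'')"
proof -
  let ?U = "snd \<kappa> ` fst \<kappa>" and ?U' = "snd \<kappa>' ` fst \<kappa>'"
  have "continuous_map (prod_topology X X) X (\<lambda>(g, h). g \<otimes> h)"
    using lie_group by (simp add: lie_group_def smooth_map_def)
  moreover have "continuous_map (prod_topology (top_of_set ?U) (top_of_set ?U')) (prod_topology X X)
      (\<lambda>q. (chart_inv \<kappa> (fst q), chart_inv \<kappa>' (snd q)))"
    using smooth_atlas_chart(5)[OF smooth_atlas assms(1)] smooth_atlas_chart(5)[OF smooth_atlas assms(2)]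
    by (intro continuous_map_pairedI continuous_map_compose[OF continuous_map_fst, unfolded o_def]
        continuous_map_compose[OF continuous_map_snd, unfolded o_def])
  ultimately have "continuous_map (prod_topology (top_of_set ?U) (top_of_set ?U')) X
      ((\<lambda>(g, h). g \<otimes> h) \<circ> (\<lambda>q. (chart_inv \<kappa> (fst q), chart_inv \<kappa>' (snd q))))"
    using continuous_map_compose by blast
  from openin_continuous_map_preimage[OF this smooth_atlas_chart(1)[OF smooth_atlas assms(3)]]
  have "openin (top_of_set (?U \<times> ?U')) {q \<in> ?U \<times> ?U'. chart_inv \<kappa> (fst q) \<otimes> chart_inv \<kappa>' (snd q) \<in> fst \<kappa>''}"
    by (simp add: prod_topology_subtopology_eu)
  moreover have "{q \<in> ?U \<times> ?U'. chart_inv \<kappa> (fst q) \<otimes> chart_inv \<kappa>' (snd q) \<in> fst \<kappa>''} = mult_domain \<kappa> \<kappa>' \<kappa>''"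
    by (auto simp: mult_domain_def)
  moreover have "open (?U \<times> ?U')" using assms by (simp add: open_Times open_chart_image)
  ultimately show ?thesis by (metis openin_open_trans)
qed

lemma smooth_mult_coord:
  assumes "\<kappa> \<in> A" "\<kappa>' \<in> A" "\<kappa>'' \<in> A"
  shows "smooth_on (mult_domain \<kappa> \<kappa>' \<kappa>'') (mult_coord \<kappa> \<kappa>' \<kappa>'')"
proof -
  define \<pi> where "\<pi> = (fst \<kappa> \<times> fst \<kappa>', map_prod (snd \<kappa>) (snd \<kappa>'))"
  have "\<pi> \<in> product_atlas A A" using assms by (force simp: product_atlas_def \<pi>_def)
  then have sm: "smooth_on (snd \<pi> ` {p \<in> fst \<pi>. (case p of (g, h) \<Rightarrow> g \<otimes> h) \<in> fst \<kappa>''})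
      (snd \<kappa>'' \<circ> (\<lambda>(g, h). g \<otimes> h) \<circ> chart_inv \<pi>)"
    using lie_group assms(3) by (simp add: lie_group_def smooth_map_def)
  have "inj_on (snd \<pi>) (fst \<pi>)"
    using assms chart_inj by (simp add: \<pi>_def map_prod_inj_on)
  then have inv: "chart_inv \<pi> (snd \<kappa> g, snd \<kappa>' h) = (g, h)" if "g \<in> fst \<kappa>" "h \<in> fst \<kappa>'" for g h
    using chart_inv_chart[of \<pi> "(g, h)"] that by (simp add: \<pi>_def)
  have dom: "snd \<pi> ` {p \<in> fst \<pi>. (case p of (g, h) \<Rightarrow> g \<otimes> h) \<in> fst \<kappa>''} = mult_domain \<kappa> \<kappa>' \<kappa>''"
    using assms by (force simp: \<pi>_def mult_domain_def chart_inv_chart chart_inj)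
  have "(snd \<kappa>'' \<circ> (\<lambda>(g, h). g \<otimes> h) \<circ> chart_inv \<pi>) q = mult_coord \<kappa> \<kappa>' \<kappa>'' q"
    if "q \<in> mult_domain \<kappa> \<kappa>' \<kappa>''" for q
    using that assms by (auto simp: mult_domain_def mult_coord_def inv chart_inv_chart chart_inj)
  then show ?thesis using sm smooth_on_cong unfolding dom by blast
qed

lemma mult_coord_has_derivative:
  assumes "\<kappa> \<in> charts_at A g" "\<kappa>' \<in> charts_at A h" "\<kappa>'' \<in> charts_at A (g \<otimes> h)"
  shows "(mult_coord \<kappa> \<kappa>' \<kappa>'' has_derivative
    frechet_derivative (mult_coord \<kappa> \<kappa>' \<kappa>'') (at (snd \<kappa> g, snd \<kappa>' h))) (at (snd \<kappa> g, snd \<kappa>' h))"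
  using smooth_on_differentiable_at[OF smooth_mult_coord open_mult_domain mult_domain_at[OF assms]]
    charts_atD(1)[OF assms(1)] charts_atD(1)[OF assms(2)] charts_atD(1)[OF assms(3)]
  by (simp add: frechet_derivative_works)

text \<open>A left translation is the multiplication restricted to a slice with fixed first factor,
  so its derivative is a partial derivative of \<open>mult_coord\<close>.\<close>

lemma left_translation_has_derivative:
  assumes "\<kappa> \<in> charts_at A g" "\<kappa>' \<in> charts_at A h" "\<kappa>'' \<in> charts_at A (g \<otimes> h)"
  shows "((snd \<kappa>'' \<circ> (\<lambda>h. g \<otimes> h) \<circ> chart_inv \<kappa>') has_derivative
    (\<lambda>v. frechet_derivative (mult_coord \<kappa> \<kappa>' \<kappa>'') (at (snd \<kappa> g, snd \<kappa>' h)) (0, v))) (at (snd \<kappa>' h))"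
proof -
  have "((\<lambda>z. (snd \<kappa> g, z)) has_derivative (\<lambda>v. (0, v))) (at (snd \<kappa>' h))"
    by (auto intro!: derivative_eq_intros)
  from has_derivative_compose[OF this mult_coord_has_derivative[OF assms]]
  show ?thesis by (simp add: mult_coord_def chart_inv_chart_at[OF assms(1)] o_def)
qed

lemma left_translation_differentiable:
  assumes "g \<in> carrier G" "\<kappa>' \<in> charts_at A h" "\<kappa>'' \<in> charts_at A (g \<otimes> h)"
  shows "(snd \<kappa>'' \<circ> (\<lambda>h. g \<otimes> h) \<circ> chart_inv \<kappa>') differentiable at (snd \<kappa>' h)"
  using left_translation_has_derivative[OF some_chart_at[OF assms(1)] assms(2,3)]
  by (rule differentiableI)

lemma left_push_component:
  assumes "g \<in> carrier G" "\<xi> \<in> tangent_space A h" "\<kappa>' \<in> charts_at A h" "\<kappa>'' \<in> charts_at A (g \<otimes> h)"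
  shows "snd (left_push G A g \<xi>) \<kappa>'' =
    frechet_derivative (snd \<kappa>'' \<circ> (\<lambda>h. g \<otimes> h) \<circ> chart_inv \<kappa>') (at (snd \<kappa>' h)) (snd \<xi> \<kappa>')"
  unfolding left_push_def
  by (rule pushforward_component[OF assms(2-4) left_translation_differentiable[OF assms(1,3,4)]])

lemma fst_left_push [simp]: "fst (left_push G A g \<xi>) = g \<otimes> fst \<xi>"
  by (simp add: left_push_def pushforward_def Let_def)

lemma left_translation_chain:
  fixes f :: "'a \<Rightarrow> 'w::real_normed_vector"
  assumes g: "g \<in> carrier G" and \<kappa>': "\<kappa>' \<in> charts_at A h" and \<kappa>'': "\<kappa>'' \<in> charts_at A (g \<otimes> h)"
    and f: "(f \<circ> chart_inv \<kappa>'') differentiable at (snd \<kappa>'' (g \<otimes> h))"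
  shows "frechet_derivative (f \<circ> (\<lambda>h. g \<otimes> h) \<circ> chart_inv \<kappa>') (at (snd \<kappa>' h)) v =
    frechet_derivative (f \<circ> chart_inv \<kappa>'') (at (snd \<kappa>'' (g \<otimes> h)))
      (frechet_derivative (snd \<kappa>'' \<circ> (\<lambda>h. g \<otimes> h) \<circ> chart_inv \<kappa>') (at (snd \<kappa>' h)) v)"
proof -
  define \<kappa> where "\<kappa> = some_chart A g"
  have \<kappa>: "\<kappa> \<in> charts_at A g" using g by (simp add: \<kappa>_def some_chart_at)
  let ?L = "snd \<kappa>'' \<circ> (\<lambda>h. g \<otimes> h) \<circ> chart_inv \<kappa>'"
  have L: "(?L has_derivative frechet_derivative ?L (at (snd \<kappa>' h))) (at (snd \<kappa>' h))"
    using left_translation_differentiable[OF g \<kappa>' \<kappa>''] by (simp only: frechet_derivative_works)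
  have "((f \<circ> chart_inv \<kappa>'') has_derivative frechet_derivative (f \<circ> chart_inv \<kappa>'') (at (snd \<kappa>'' (g \<otimes> h))))
      (at (?L (snd \<kappa>' h)))"
    using f by (simp only: frechet_derivative_works o_apply chart_inv_chart_at[OF \<kappa>'])
  from has_derivative_compose[OF L this]
  have "((f \<circ> (\<lambda>h. g \<otimes> h) \<circ> chart_inv \<kappa>') has_derivative
      (\<lambda>v. frechet_derivative (f \<circ> chart_inv \<kappa>'') (at (snd \<kappa>'' (g \<otimes> h)))
        (frechet_derivative ?L (at (snd \<kappa>' h)) v))) (at (snd \<kappa>' h))"
  proof (rule has_derivative_transform_within_open)
    \<comment> \<open>On this slice of an open set the product stays in the domain of
      \<open>\<kappa>''\<close>, where inserting \<open>\<kappa>''\<close> and its inverse changes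
      nothing.\<close>
    let ?Z = "(\<lambda>z. (snd \<kappa> g, z)) -` mult_domain \<kappa> \<kappa>' \<kappa>''"
    show "open ?Z"
      using open_mult_domain charts_atD(1)[OF \<kappa>] charts_atD(1)[OF \<kappa>'] charts_atD(1)[OF \<kappa>'']
      by (intro open_vimage continuous_intros)
    show "snd \<kappa>' h \<in> ?Z" using mult_domain_at[OF \<kappa> \<kappa>' \<kappa>''] by simp
    show "(f \<circ> chart_inv \<kappa>'') (?L z) = (f \<circ> (\<lambda>h. g \<otimes> h) \<circ> chart_inv \<kappa>') z" if "z \<in> ?Z" for z
      using that charts_atD(1)[OF \<kappa>'']
      by (simp add: mult_domain_def chart_inv_chart_at[OF \<kappa>] chart_inv_chart chart_inj)
  qed
  from frechet_derivative_at[OF this] show ?thesis by (simp only: fun_eq_iff)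
qed

lemma left_push_in_tangent_space:
  assumes "g \<in> carrier G" "\<xi> \<in> tangent_space A h" "h \<in> carrier G"
  shows "left_push G A g \<xi> \<in> tangent_space A (g \<otimes> h)"
proof (rule tangent_spaceI)
  define \<kappa> where "\<kappa> = some_chart A h"
  have \<kappa>: "\<kappa> \<in> charts_at A h" using assms(3) by (simp add: \<kappa>_def some_chart_at)
  fix \<kappa>' \<kappa>'' assume *: "\<kappa>' \<in> charts_at A (g \<otimes> h)" "\<kappa>'' \<in> charts_at A (g \<otimes> h)"
  show "snd (left_push G A g \<xi>) \<kappa>'' =
    frechet_derivative (snd \<kappa>'' \<circ> chart_inv \<kappa>') (at (snd \<kappa>' (g \<otimes> h))) (snd (left_push G A g \<xi>) \<kappa>')"
    using left_translation_chain[OF assms(1) \<kappa> *(1) transition_differentiable[OF *]]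
    by (simp only: left_push_component[OF assms(1,2) \<kappa> *(1)] left_push_component[OF assms(1,2) \<kappa> *(2)])
next
  show "fst (left_push G A g \<xi>) = g \<otimes> h" using assms(2) by (simp add: tangent_spaceD(1))
  show "snd (left_push G A g \<xi>) \<kappa> = 0" if "\<kappa> \<notin> charts_at A (g \<otimes> h)" for \<kappa>
    using that by (simp add: left_push_def pushforward_def Let_def tangent_spaceD(1)[OF assms(2)])
qed

lemma left_push_left_push:
  assumes "g \<in> carrier G" "h \<in> carrier G" "\<xi> \<in> tangent_space A k" "k \<in> carrier G"
  shows "left_push G A g (left_push G A h \<xi>) = left_push G A (g \<otimes> h) \<xi>"
proof (rule tangent_space_eqI)
  let ?\<kappa> = "some_chart A k" and ?\<kappa>' = "some_chart A (h \<otimes> k)" and ?\<kappa>'' = "some_chart A (g \<otimes> h \<otimes> k)"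
  have \<kappa>: "?\<kappa> \<in> charts_at A k" "?\<kappa>' \<in> charts_at A (h \<otimes> k)" "?\<kappa>'' \<in> charts_at A (g \<otimes> h \<otimes> k)"
    using assms by (auto intro!: some_chart_at)
  then have \<kappa>3: "?\<kappa>'' \<in> charts_at A (g \<otimes> (h \<otimes> k))" using assms by (simp add: m_assoc)
  have h: "left_push G A h \<xi> \<in> tangent_space A (h \<otimes> k)"
    using assms by (simp add: left_push_in_tangent_space)
  show "left_push G A (g \<otimes> h) \<xi> \<in> tangent_space A (g \<otimes> h \<otimes> k)"
    using assms by (simp add: left_push_in_tangent_space)
  show "left_push G A g (left_push G A h \<xi>) \<in> tangent_space A (g \<otimes> h \<otimes> k)"
    using left_push_in_tangent_space[OF assms(1) h] assms by (simp add: m_assoc)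
  show "?\<kappa>'' \<in> charts_at A (g \<otimes> h \<otimes> k)" by (rule \<kappa>)
  have "snd (left_push G A g (left_push G A h \<xi>)) ?\<kappa>'' =
      frechet_derivative (snd ?\<kappa>'' \<circ> (\<lambda>h. g \<otimes> h) \<circ> (\<lambda>k. h \<otimes> k) \<circ> chart_inv ?\<kappa>) (at (snd ?\<kappa> k)) (snd \<xi> ?\<kappa>)"
    unfolding left_push_component[OF assms(1) h \<kappa>(2) \<kappa>3] left_push_component[OF assms(2,3) \<kappa>(1,2)]
    by (rule left_translation_chain[symmetric, OF assms(2) \<kappa>(1,2)
          left_translation_differentiable[OF assms(1) \<kappa>(2) \<kappa>3]])
  also have "\<dots> = frechet_derivative (snd ?\<kappa>'' \<circ> (\<lambda>k. g \<otimes> h \<otimes> k) \<circ> chart_inv ?\<kappa>) (at (snd ?\<kappa> k)) (snd \<xi> ?\<kappa>)"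
  \<comment> \<open>Associativity is available for elements of the carrier only, and
    \<open>chart_inv\<close> is known to land there only on the chart image.\<close>
  proof (rule fun_cong[OF frechet_derivative_cong_open])
    show "open (snd ?\<kappa> ` fst ?\<kappa>)" "snd ?\<kappa> k \<in> snd ?\<kappa> ` fst ?\<kappa>"
      using charts_atD[OF \<kappa>(1)] open_chart_image by auto
    show "(snd ?\<kappa>'' \<circ> (\<lambda>h. g \<otimes> h) \<circ> (\<lambda>k. h \<otimes> k) \<circ> chart_inv ?\<kappa>) x =
        (snd ?\<kappa>'' \<circ> (\<lambda>k. g \<otimes> h \<otimes> k) \<circ> chart_inv ?\<kappa>) x" if "x \<in> snd ?\<kappa> ` fst ?\<kappa>" for x
      using chart_domain_carrier[OF charts_atD(1)[OF \<kappa>(1)] chart_inv_in_domain[OF that]] assms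
      by (simp add: m_assoc)
  qed
  also have "\<dots> = snd (left_push G A (g \<otimes> h) \<xi>) ?\<kappa>''"
    using left_push_component[OF _ assms(3) \<kappa>(1,3)] assms by simp
  finally show "snd (left_push G A g (left_push G A h \<xi>)) ?\<kappa>'' = snd (left_push G A (g \<otimes> h) \<xi>) ?\<kappa>''" .
qed

lemma left_push_one:
  assumes "\<xi> \<in> tangent_space A h" "h \<in> carrier G"
  shows "left_push G A \<one> \<xi> = \<xi>"
proof (rule tangent_space_eqI)
  let ?\<kappa> = "some_chart A h"
  show \<kappa>: "?\<kappa> \<in> charts_at A h" using assms by (simp add: some_chart_at)
  then have \<kappa>1: "?\<kappa> \<in> charts_at A (\<one> \<otimes> h)" using assms by simp
  show "left_push G A \<one> \<xi> \<in> tangent_space A h"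
    using left_push_in_tangent_space[OF _ assms, of \<one>] assms by simp
  have "frechet_derivative (snd ?\<kappa> \<circ> (\<lambda>h. \<one> \<otimes> h) \<circ> chart_inv ?\<kappa>) (at (snd ?\<kappa> h)) =
      frechet_derivative (snd ?\<kappa> \<circ> chart_inv ?\<kappa>) (at (snd ?\<kappa> h))"
    using charts_atD[OF \<kappa>] open_chart_image chart_domain_carrier[OF _ chart_inv_in_domain]
    by (intro frechet_derivative_cong_open[of "snd ?\<kappa> ` fst ?\<kappa>"]) auto
  then show "snd (left_push G A \<one> \<xi>) ?\<kappa> = snd \<xi> ?\<kappa>"
    by (simp add: left_push_component[OF _ assms(1) \<kappa> \<kappa>1] transition_self[OF \<kappa>])
qed (rule assms)

end

lemma tlincomb_cong: "(\<And>i. i < n \<Longrightarrow> E i = E' i) \<Longrightarrow> tlincomb p n a E = tlincomb p n a E'"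
  by (simp add: tlincomb_def)

context lie_group_atlas
begin

text \<open>The coordinate expression of \<open>(g, h) \<mapsto> g h\<close> for \<open>h\<close> near the identity is \<open>translate \<kappa>\<close>; the
  left invariant field with value \<open>v\<close> at the identity is \<open>frame \<kappa> x v\<close> in the coordinates \<open>x\<close> of \<open>\<kappa>\<close>.\<close>

definition base :: "('a, 'e) chart" where "base = some_chart A \<one>"

definition origin :: 'e where "origin = snd base \<one>"

definition translate :: "('a, 'e) chart \<Rightarrow> 'e \<times> 'e \<Rightarrow> 'e" where
  "translate \<kappa> = mult_coord \<kappa> base \<kappa>"

definition frame :: "('a, 'e) chart \<Rightarrow> 'e \<Rightarrow> 'e \<Rightarrow> 'e" where
  "frame \<kappa> x v = frechet_derivative (translate \<kappa>) (at (x, origin)) (0, v)"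

text \<open>The mixed second derivative: the outer direction moves the first factor of the product,
  the inner one is in the second factor. It is the derivative of \<open>frame \<kappa> x w\<close>
  in \<open>x\<close>.\<close>

definition frame_deriv :: "('a, 'e) chart \<Rightarrow> 'e \<Rightarrow> 'e \<Rightarrow> 'e \<Rightarrow> 'e" where
  "frame_deriv \<kappa> x v w = second_derivative (translate \<kappa>) (x, origin) (v, 0) (0, w)"

text \<open>The Hessian in the second factor alone, that is, of the left translation by the point
  with coordinates \<open>x\<close>.\<close>

definition translate_hessian :: "('a, 'e) chart \<Rightarrow> 'e \<Rightarrow> 'e \<Rightarrow> 'e \<Rightarrow> 'e" where
  "translate_hessian \<kappa> x v w = second_derivative (translate \<kappa>) (x, origin) (0, v) (0, w)"

section \<open>The left invariant frame and its derivatives\<close>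

lemma base_at_one: "base \<in> charts_at A \<one>"
  by (simp add: base_def some_chart_at)

lemma base_in_atlas: "base \<in> A"
  using charts_atD(1)[OF base_at_one] .

lemma smooth_translate: "\<kappa> \<in> A \<Longrightarrow> smooth_on (mult_domain \<kappa> base \<kappa>) (translate \<kappa>)"
  unfolding translate_def by (intro smooth_mult_coord base_in_atlas)

lemma open_translate_domain: "\<kappa> \<in> A \<Longrightarrow> open (mult_domain \<kappa> base \<kappa>)"
  by (intro open_mult_domain base_in_atlas)

lemma charts_at_mult_one: "\<kappa> \<in> charts_at A g \<Longrightarrow> \<kappa> \<in> charts_at A (g \<otimes> \<one>)"
  using charts_at_carrier by simp

lemma translate_domain_at:
  assumes "\<kappa> \<in> charts_at A g"
  shows "(snd \<kappa> g, origin) \<in> mult_domain \<kappa> base \<kappa>"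
  unfolding origin_def by (rule mult_domain_at[OF assms base_at_one charts_at_mult_one[OF assms]])

lemma left_push_in_chart:
  assumes "\<kappa> \<in> charts_at A g" "\<kappa>' \<in> charts_at A h" "\<kappa>'' \<in> charts_at A (g \<otimes> h)" "\<xi> \<in> tangent_space A h"
  shows "snd (left_push G A g \<xi>) \<kappa>'' =
    frechet_derivative (mult_coord \<kappa> \<kappa>' \<kappa>'') (at (snd \<kappa> g, snd \<kappa>' h)) (0, snd \<xi> \<kappa>')"
  using left_push_component[OF charts_at_carrier[OF assms(1)] assms(4,2,3)]
    frechet_derivative_at[OF left_translation_has_derivative[OF assms(1-3)]]
  by (simp add: fun_eq_iff)

lemma left_push_frame:
  assumes "\<kappa> \<in> charts_at A g" "\<xi> \<in> tangent_space A \<one>"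
  shows "snd (left_push G A g \<xi>) \<kappa> = frame \<kappa> (snd \<kappa> g) (snd \<xi> base)"
  using left_push_in_chart[OF assms(1) base_at_one charts_at_mult_one[OF assms(1)] assms(2)]
  by (simp add: frame_def translate_def origin_def)

lemma left_push_coord_vector:
  assumes "\<kappa> \<in> charts_at A g"
  shows "left_push G A g (coord_vector A \<one> base v) = coord_vector A g \<kappa> (frame \<kappa> (snd \<kappa> g) v)"
proof (rule tangent_space_eqI)
  have g: "g \<in> carrier G" using charts_at_carrier[OF assms] .
  have \<xi>: "coord_vector A \<one> base v \<in> tangent_space A \<one>"
    by (rule coord_vector_in_tangent_space[OF base_at_one])
  show "left_push G A g (coord_vector A \<one> base v) \<in> tangent_space A g"
    using left_push_in_tangent_space[OF g \<xi>] g by simp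
  show "coord_vector A g \<kappa> (frame \<kappa> (snd \<kappa> g) v) \<in> tangent_space A g"
    by (rule coord_vector_in_tangent_space[OF assms])
  show "snd (left_push G A g (coord_vector A \<one> base v)) \<kappa> =
      snd (coord_vector A g \<kappa> (frame \<kappa> (snd \<kappa> g) v)) \<kappa>"
    by (simp add: left_push_frame[OF assms \<xi>] coord_vector_component[OF assms]
        coord_vector_component[OF base_at_one])
qed (rule assms)

lemma linear_frame:
  assumes "\<kappa> \<in> charts_at A g"
  shows "linear (frame \<kappa> (snd \<kappa> g))"
proof -
  have "linear (frechet_derivative (translate \<kappa>) (at (snd \<kappa> g, origin)))"
    using smooth_on_differentiable_at[OF smooth_translate open_translate_domain translate_domain_at[OF assms]]
      charts_atD(1)[OF assms] by (intro linear_frechet_derivative) simp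
  moreover have "linear (\<lambda>v. (0 :: 'e, v :: 'e))"
    by (rule linearI) simp_all
  ultimately show ?thesis
    using linear_compose[of "\<lambda>v. (0 :: 'e, v :: 'e)"] unfolding frame_def by (simp add: o_def)
qed

text \<open>Translation by the inverse of \<open>g\<close> undoes translation by \<open>g\<close> on
  tangent vectors.\<close>

lemma inj_frame:
  assumes "\<kappa> \<in> charts_at A g"
  shows "inj (frame \<kappa> (snd \<kappa> g))"
proof (rule injI)
  fix v w assume *: "frame \<kappa> (snd \<kappa> g) v = frame \<kappa> (snd \<kappa> g) w"
  have g: "g \<in> carrier G" using charts_at_carrier[OF assms] .
  have inv: "left_push G A (inv g) (left_push G A g (coord_vector A \<one> base u)) = coord_vector A \<one> base u" for u
    using g left_push_left_push[OF inv_closed[OF g] g coord_vector_in_tangent_space[OF base_at_one]]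
      left_push_one[OF coord_vector_in_tangent_space[OF base_at_one]] by simp
  have "coord_vector A \<one> base v = coord_vector A \<one> base w"
    using * inv[of v] inv[of w] by (simp add: left_push_coord_vector[OF assms])
  then show "v = w" using coord_vector_component[OF base_at_one] by metis
qed

lemma frame_base_origin: "frame base origin v = v"
  using left_push_frame[OF base_at_one coord_vector_in_tangent_space[OF base_at_one], of v]
    left_push_one[OF coord_vector_in_tangent_space[OF base_at_one]]
  by (simp add: coord_vector_component[OF base_at_one] origin_def)

lemma linear_frame_deriv:
  assumes "\<kappa> \<in> charts_at A g"
  shows "linear (\<lambda>v. frame_deriv \<kappa> (snd \<kappa> g) v w)" "linear (frame_deriv \<kappa> (snd \<kappa> g) v)"
proof -
  note \<kappa>A = charts_atD(1)[OF assms]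
  note * = smooth_translate[OF \<kappa>A] open_translate_domain[OF \<kappa>A] translate_domain_at[OF assms]
  have 1: "linear (\<lambda>v. (v :: 'e, 0 :: 'e))" and 2: "linear (\<lambda>v. (0 :: 'e, v :: 'e))"
    by (rule linearI, simp_all)+
  from linear_compose[OF 1 linear_second_derivative_left[OF *]]
  show "linear (\<lambda>v. frame_deriv \<kappa> (snd \<kappa> g) v w)"
    unfolding frame_deriv_def o_def .
  from linear_compose[OF 2 linear_second_derivative_right[OF *]]
  show "linear (frame_deriv \<kappa> (snd \<kappa> g) v)"
    unfolding frame_deriv_def[abs_def] o_def .
qed

lemma linear_translate_hessian:
  assumes "\<kappa> \<in> charts_at A g"
  shows "linear (translate_hessian \<kappa> (snd \<kappa> g) v)"
proof -
  note \<kappa>A = charts_atD(1)[OF assms]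
  have "linear (\<lambda>v. (0 :: 'e, v :: 'e))" by (rule linearI) simp_all
  from linear_compose[OF this linear_second_derivative_right[OF smooth_translate[OF \<kappa>A]
      open_translate_domain[OF \<kappa>A] translate_domain_at[OF assms]]]
  show ?thesis unfolding translate_hessian_def[abs_def] o_def .
qed

text \<open>Both differentiations are in the second factor. The mixed derivative
  \<open>frame_deriv\<close> has no such symmetry in general; at the identity its antisymmetric part
  is the Lie bracket.\<close>

lemma translate_hessian_commute:
  assumes "\<kappa> \<in> charts_at A g"
  shows "translate_hessian \<kappa> (snd \<kappa> g) v w = translate_hessian \<kappa> (snd \<kappa> g) w v"
  unfolding translate_hessian_def
  using charts_atD(1)[OF assms]
  by (intro second_derivative_commute[OF smooth_translate open_translate_domain translate_domain_at[OF assms]])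

text \<open>Base point and vector both vary, because the rule is applied to the coordinate itself,
  to \<open>z \<mapsto> translate \<kappa> (x, z)\<close> and to the curve \<open>c\<close>.\<close>

lemma frame_has_derivative:
  assumes "\<kappa> \<in> charts_at A g" "u t = snd \<kappa> g" "t \<in> T"
    and u: "(u has_derivative u') (at t within T)"
    and \<phi>: "(\<phi> has_derivative \<phi>') (at t within T)"
  shows "((\<lambda>s. frame \<kappa> (u s) (\<phi> s)) has_derivative
    (\<lambda>h. frame_deriv \<kappa> (snd \<kappa> g) (u' h) (\<phi> t) + frame \<kappa> (snd \<kappa> g) (\<phi>' h))) (at t within T)"
proof -
  have dom: "(u t, origin) \<in> mult_domain \<kappa> base \<kappa>"
    using translate_domain_at[OF assms(1)] assms(2) by simp
  have 1: "((\<lambda>s. (u s, origin)) has_derivative (\<lambda>h. (u' h, 0))) (at t within T)"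
    and 2: "((\<lambda>s. (0 :: 'e, \<phi> s)) has_derivative (\<lambda>h. (0, \<phi>' h))) (at t within T)"
    using u \<phi> by (auto intro!: has_derivative_Pair)
  show ?thesis
    using has_derivative_frechet_derivative_apply[OF smooth_translate open_translate_domain dom assms(3) 1 2]
      charts_atD(1)[OF assms(1)] assms(2)
    unfolding frame_def frame_deriv_def by simp
qed

text \<open>With \<open>h = chart_inv base z\<close> both sides are coordinates of the translate of
  \<open>w\<close> by \<open>g \<otimes> h\<close>, on the right obtained by translating first by
  \<open>h\<close> and then by \<open>g\<close>. The point \<open>z\<close> is kept general so that
  the equation can be differentiated.\<close>

lemma frame_translate:
  assumes "\<kappa> \<in> charts_at A g" "z \<in> snd base ` fst base" "g \<otimes> chart_inv base z \<in> fst \<kappa>"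
  shows "frame \<kappa> (translate \<kappa> (snd \<kappa> g, z)) w =
    frechet_derivative (translate \<kappa>) (at (snd \<kappa> g, z)) (0, frame base z w)"
proof -
  define h where "h = chart_inv base z"
  have h: "base \<in> charts_at A h" "snd base h = z"
    using assms(2) base_in_atlas by (simp_all add: h_def charts_at_def chart_inv_in_domain chart_chart_inv)
  have gh: "\<kappa> \<in> charts_at A (g \<otimes> h)" using assms(3) charts_atD(1)[OF assms(1)] by (simp add: charts_at_def h_def)
  have carr: "g \<in> carrier G" "h \<in> carrier G"
    using charts_at_carrier assms(1) h(1) by blast+
  let ?\<xi> = "coord_vector A \<one> base w"
  have \<xi>: "?\<xi> \<in> tangent_space A \<one>" by (rule coord_vector_in_tangent_space[OF base_at_one])
  have "left_push G A h ?\<xi> \<in> tangent_space A h"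
    using left_push_in_tangent_space[OF carr(2) \<xi>] carr by simp
  from left_push_in_chart[OF assms(1) h(1) gh this]
  have "snd (left_push G A (g \<otimes> h) ?\<xi>) \<kappa> =
      frechet_derivative (mult_coord \<kappa> base \<kappa>) (at (snd \<kappa> g, snd base h)) (0, snd (left_push G A h ?\<xi>) base)"
    using left_push_left_push[OF carr \<xi>] by simp
  moreover have "translate \<kappa> (snd \<kappa> g, z) = snd \<kappa> (g \<otimes> h)"
    by (simp add: translate_def mult_coord_def h_def chart_inv_chart_at[OF assms(1)])
  ultimately show ?thesis
    by (simp add: left_push_frame[OF gh \<xi>] left_push_frame[OF h(1) \<xi>] coord_vector_component[OF base_at_one]
        translate_def h(2))
qed

text \<open>Differentiating the associativity law \<open>(g h) k = g (h k)\<close> at \<open>k = \<one>\<close> gives \<open>frame_translate\<close>; here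
  it is differentiated once more, at \<open>h = \<one>\<close>.\<close>

lemma frame_deriv_frame:
  assumes "\<kappa> \<in> charts_at A g"
  shows "frame_deriv \<kappa> (snd \<kappa> g) (frame \<kappa> (snd \<kappa> g) v) w =
    translate_hessian \<kappa> (snd \<kappa> g) v w + frame \<kappa> (snd \<kappa> g) (frame_deriv base origin v w)"
proof -
  note dom = translate_domain_at[OF assms] and \<kappa>A = charts_atD(1)[OF assms]
  let ?x = "snd \<kappa> g"
  have trans_origin: "translate \<kappa> (?x, origin) = ?x"
    using charts_at_carrier[OF assms]
    by (simp add: translate_def mult_coord_def origin_def chart_inv_chart_at[OF assms] chart_inv_chart_at[OF base_at_one])
  have pair: "((\<lambda>z. (?x, z)) has_derivative (\<lambda>h. (0, h))) (at origin)"
    by (auto intro!: derivative_eq_intros)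
  have "(translate \<kappa> has_derivative frechet_derivative (translate \<kappa>) (at (?x, origin))) (at (?x, origin))"
    using smooth_on_differentiable_at[OF smooth_translate[OF \<kappa>A] open_translate_domain[OF \<kappa>A] dom]
    by (simp only: frechet_derivative_works)
  from has_derivative_compose[OF pair this]
  have u: "((\<lambda>z. translate \<kappa> (?x, z)) has_derivative (\<lambda>h. frame \<kappa> ?x h)) (at origin)"
    by (simp add: frame_def)
  have lhs: "((\<lambda>z. frame \<kappa> (translate \<kappa> (?x, z)) w) has_derivative (\<lambda>h. frame_deriv \<kappa> ?x (frame \<kappa> ?x h) w)) (at origin)"
    using frame_has_derivative[OF assms _ UNIV_I u has_derivative_const[of w], OF trans_origin]
      linear_0[OF linear_frame[OF assms]] by simp
  have \<phi>: "((\<lambda>z. (0 :: 'e, frame base z w)) has_derivative (\<lambda>h. (0, frame_deriv base origin h w))) (at origin)"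
    using frame_has_derivative[OF base_at_one _ UNIV_I has_derivative_ident has_derivative_const[of w], of "snd base \<one>"]
      linear_0[OF linear_frame[OF base_at_one]]
    by (intro has_derivative_Pair has_derivative_const) (simp add: origin_def)
  \<comment> \<open>The moving point \<open>z\<close> contributes the Hessian and the moving vector
    \<open>frame base z w\<close> contributes \<open>frame_deriv base origin\<close>; at
    \<open>origin\<close> the frame of \<open>base\<close> is the identity.\<close>
  have rhs: "((\<lambda>z. frechet_derivative (translate \<kappa>) (at (?x, z)) (0, frame base z w)) has_derivative
      (\<lambda>h. translate_hessian \<kappa> ?x h w + frame \<kappa> ?x (frame_deriv base origin h w))) (at origin)"
    using has_derivative_frechet_derivative_apply[OF smooth_translate[OF \<kappa>A] open_translate_domain[OF \<kappa>A] dom UNIV_I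
        pair \<phi>]
    by (simp add: translate_hessian_def frame_def[of \<kappa>] frame_base_origin)
  have "((\<lambda>z. frechet_derivative (translate \<kappa>) (at (?x, z)) (0, frame base z w)) has_derivative
      (\<lambda>h. frame_deriv \<kappa> ?x (frame \<kappa> ?x h) w)) (at origin)"
    using lhs
  proof (rule has_derivative_transform_within_open)
    let ?Z = "(\<lambda>z. (?x, z)) -` mult_domain \<kappa> base \<kappa>"
    show "open ?Z" using open_translate_domain[OF \<kappa>A] by (intro open_vimage continuous_intros)
    show "origin \<in> ?Z" using dom by simp
    show "frame \<kappa> (translate \<kappa> (?x, z)) w = frechet_derivative (translate \<kappa>) (at (?x, z)) (0, frame base z w)"
      if "z \<in> ?Z" for z
      using that by (intro frame_translate[OF assms]) (simp_all add: mult_domain_def chart_inv_chart_at[OF assms])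
  qed
  from fun_cong[OF has_derivative_unique[OF this rhs], of v] show ?thesis .
qed

section \<open>Left invariant fields and the Lie bracket\<close>

lemma left_invariant_field_deriv:
  assumes "\<kappa> \<in> charts_at A g" "\<xi> \<in> tangent_space A \<one>"
  shows "frechet_derivative (\<lambda>x. snd (left_invariant_field G A \<xi> (chart_inv \<kappa> x)) \<kappa>) (at (snd \<kappa> g)) v =
    frame_deriv \<kappa> (snd \<kappa> g) v (snd \<xi> base)"
proof -
  have "frechet_derivative (\<lambda>x. snd (left_invariant_field G A \<xi> (chart_inv \<kappa> x)) \<kappa>) (at (snd \<kappa> g)) =
      frechet_derivative (\<lambda>x. frame \<kappa> x (snd \<xi> base)) (at (snd \<kappa> g))"
  proof (rule frechet_derivative_cong_open)
    show "open (snd \<kappa> ` fst \<kappa>)" "snd \<kappa> g \<in> snd \<kappa> ` fst \<kappa>"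
      using charts_atD[OF assms(1)] open_chart_image by auto
    show "snd (left_invariant_field G A \<xi> (chart_inv \<kappa> x)) \<kappa> = frame \<kappa> x (snd \<xi> base)"
      if x: "x \<in> snd \<kappa> ` fst \<kappa>" for x
      using left_push_frame[OF _ assms(2), of \<kappa> "chart_inv \<kappa> x"] charts_atD(1)[OF assms(1)]
      by (simp add: left_invariant_field_def charts_at_def chart_inv_in_domain[OF x] chart_chart_inv[OF x])
  qed
  also have "\<dots> = (\<lambda>h. frame_deriv \<kappa> (snd \<kappa> g) h (snd \<xi> base))"
    using frechet_derivative_at[OF frame_has_derivative[OF assms(1) _ UNIV_I has_derivative_ident
          has_derivative_const[of "snd \<xi> base"], of "snd \<kappa> g"]] linear_0[OF linear_frame[OF assms(1)]]
    by simp
  finally show ?thesis by simp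
qed

lemma lie_algebra_bracket_coord:
  assumes "v \<in> tangent_space A \<one>" "w \<in> tangent_space A \<one>"
  shows "lie_algebra_bracket G A v w = coord_vector A \<one> base
    (frame_deriv base origin (snd v base) (snd w base) - frame_deriv base origin (snd w base) (snd v base))"
    (is "_ = coord_vector A \<one> base ?b")
proof (rule prod_eqI)
  show "fst (lie_algebra_bracket G A v w) = fst (coord_vector A \<one> base ?b)"
    by (simp add: lie_algebra_bracket_def lie_bracket_def coord_vector_def)
  \<comment> \<open>\<open>lie_bracket\<close> is given by a separate formula in each chart and has
    not been shown to obey the transformation law, so the comparison is made in every chart rather
    than in \<open>base\<close> alone.\<close>
  have "snd (lie_algebra_bracket G A v w) \<kappa> = snd (coord_vector A \<one> base ?b) \<kappa>" for \<kappa>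
  proof (cases "\<kappa> \<in> charts_at A \<one>")
    case True
    let ?a = "frame \<kappa> (snd \<kappa> \<one>)"
    have "snd (lie_algebra_bracket G A v w) \<kappa> =
        frame_deriv \<kappa> (snd \<kappa> \<one>) (?a (snd v base)) (snd w base) -
        frame_deriv \<kappa> (snd \<kappa> \<one>) (?a (snd w base)) (snd v base)"
      using True
      by (simp add: lie_algebra_bracket_def lie_bracket_def left_invariant_field_deriv[OF True assms(1)]
          left_invariant_field_deriv[OF True assms(2)])
        (simp add: left_invariant_field_def left_push_frame[OF True assms(1)] left_push_frame[OF True assms(2)])
    also have "\<dots> = ?a ?b"
      by (simp add: frame_deriv_frame[OF True] linear_diff[OF linear_frame[OF True]]
          translate_hessian_commute[OF True, of "snd v base"])
    \<comment> \<open>At the identity \<open>frame \<kappa>\<close> is the coordinate change from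
      \<open>base\<close> to \<open>\<kappa>\<close>, because translation by the identity fixes
      tangent vectors.\<close>
    also have "\<dots> = snd (left_push G A \<one> (coord_vector A \<one> base ?b)) \<kappa>"
      using left_push_frame[OF True coord_vector_in_tangent_space[OF base_at_one]]
      by (simp add: coord_vector_component[OF base_at_one])
    also have "\<dots> = snd (coord_vector A \<one> base ?b) \<kappa>"
      by (simp add: left_push_one[OF coord_vector_in_tangent_space[OF base_at_one]])
    finally show ?thesis .
  next
    case False
    then show ?thesis by (simp add: lie_algebra_bracket_def lie_bracket_def coord_vector_def)
  qed
  then show "snd (lie_algebra_bracket G A v w) = snd (coord_vector A \<one> base ?b)" by blast
qed

end

section \<open>Left invariant sprays in charts\<close>

context lie_group_atlas
begin

section \<open>The slit tangent bundle in standard charts\<close>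

lemma slit_tangent_bundleI:
  assumes "\<xi> \<in> tangent_space A p" "\<kappa> \<in> charts_at A p" "snd \<xi> \<kappa> \<noteq> 0"
  shows "\<xi> \<in> slit_tangent_bundle A"
proof -
  have "\<xi> \<noteq> tzero (fst \<xi>)"
    using assms(3) arg_cong[of \<xi> "tzero (fst \<xi>)" "\<lambda>\<xi>. snd \<xi> \<kappa>"] tzero_simps(2) by metis
  then show ?thesis using assms(1) charts_atD[OF assms(2)]
    unfolding slit_tangent_bundle_def tangent_bundle_def by blast
qed

lemma slit_tangent_bundle_component:
  assumes "\<xi> \<in> slit_tangent_bundle A" "\<kappa> \<in> charts_at A (fst \<xi>)"
  shows "snd \<xi> \<kappa> \<noteq> 0"
proof
  assume 0: "snd \<xi> \<kappa> = 0"
  have \<xi>: "\<xi> \<in> tangent_space A (fst \<xi>)"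
    using assms(1) tangent_spaceD(1) unfolding slit_tangent_bundle_def tangent_bundle_def by fastforce
  have "tzero (fst \<xi>) \<in> tangent_space A (fst \<xi>)"
    using tangent_space_tscale[OF \<xi>, of 0] by (simp add: tscale_def tzero_def)
  then have "\<xi> = tzero (fst \<xi>)"
    using tangent_space_eqI[OF \<xi> _ assms(2)] 0 by simp
  then show False using assms(1) by (simp add: slit_tangent_bundle_def)
qed

lemma coord_vector_slit:
  assumes "\<kappa> \<in> charts_at A p" "y \<noteq> 0"
  shows "coord_vector A p \<kappa> y \<in> slit_tangent_bundle A"
  using assms slit_tangent_bundleI[OF coord_vector_in_tangent_space[OF assms(1)] assms(1)]
  by (simp add: coord_vector_component)

lemma standard_chart_slit:
  assumes "\<kappa> \<in> A"
  shows "snd (standard_chart A \<kappa>) ` (fst (standard_chart A \<kappa>) \<inter> slit_tangent_bundle A) =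
    (snd \<kappa> ` fst \<kappa>) \<times> (- {0})"
proof (intro equalityI subsetI)
  fix q assume "q \<in> snd (standard_chart A \<kappa>) ` (fst (standard_chart A \<kappa>) \<inter> slit_tangent_bundle A)"
  then obtain \<xi> where \<xi>: "q = snd (standard_chart A \<kappa>) \<xi>"
    "\<xi> \<in> fst (standard_chart A \<kappa>)" "\<xi> \<in> slit_tangent_bundle A" by blast
  then have "\<kappa> \<in> charts_at A (fst \<xi>)" using assms by (simp add: standard_chart_def charts_at_def)
  then show "q \<in> (snd \<kappa> ` fst \<kappa>) \<times> (- {0})"
    using slit_tangent_bundle_component[OF \<xi>(3)] \<xi>(1,2) by (simp add: standard_chart_def)
next
  fix q assume "q \<in> (snd \<kappa> ` fst \<kappa>) \<times> (- {0 :: 'e})"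
  then obtain x y where q: "q = (x, y)" "x \<in> snd \<kappa> ` fst \<kappa>" "y \<noteq> 0" by auto
  have "\<kappa> \<in> charts_at A (chart_inv \<kappa> x)"
    using assms chart_inv_in_domain[OF q(2)] by (simp add: charts_at_def)
  from coord_vector_slit[OF this q(3)] coord_vector_in_standard_chart[OF assms q(2), of y]
  show "q \<in> snd (standard_chart A \<kappa>) ` (fst (standard_chart A \<kappa>) \<inter> slit_tangent_bundle A)"
    unfolding q(1) by (metis IntI imageI)
qed

end

locale left_invariant_spray_frame = lie_group_atlas G X A
  for G :: "('a, 'b) monoid_scheme" (structure)
    and X :: "'a topology"
    and A :: "('a, 'e::euclidean_space) chart set" +
  fixes E :: "nat \<Rightarrow> ('a, 'e) tvec"
    and S :: "('a, 'e) tvec \<Rightarrow> (('a, 'e) tvec, 'e \<times> 'e) tvec"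
  assumes basis: "tangent_basis A \<one> E"
    and spray: "left_invariant_spray G A S"
begin

sublocale tangent: differentiable_atlas "tangent_atlas A"
  by (rule differentiable_tangent_atlas)

lemma spray_structure: "spray_structure A S"
  using spray by (simp add: left_invariant_spray_def)

lemma spray_in_tangent_space:
  assumes "\<kappa> \<in> charts_at A p" "y \<noteq> 0"
  shows "S (coord_vector A p \<kappa> y) \<in> tangent_space (tangent_atlas A) (coord_vector A p \<kappa> y)"
  using spray_structure coord_vector_slit[OF assms]
  by (simp add: spray_structure_def smooth_vector_field_on_def)

lemma spray_component:
  assumes "\<kappa> \<in> charts_at A p" "y \<noteq> 0"
  shows "snd (S (coord_vector A p \<kappa> y)) (standard_chart A \<kappa>) =
    (y, - 2 *\<^sub>R spray_coeff A S \<kappa> (snd \<kappa> p) y)"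
proof -
  have "snd \<kappa> p \<in> snd \<kappa> ` fst \<kappa>" using charts_atD(2)[OF assms(1)] by blast
  then have "snd (S (coord_vector A (chart_inv \<kappa> (snd \<kappa> p)) \<kappa> y)) (standard_chart A \<kappa>) =
      (y, - 2 *\<^sub>R spray_coeff A S \<kappa> (snd \<kappa> p) y)"
    using spray_structure charts_atD(1)[OF assms(1)] assms(2) unfolding spray_structure_def by blast
  then show ?thesis by (simp only: chart_inv_chart_at[OF assms(1)])
qed

text \<open>The coordinates of \<open>S\<close> are smooth on the image of the slit bundle, which is
  open; fixing the base point restricts them to a punctured fibre.\<close>

lemma spray_coeff_differentiable:
  assumes "\<kappa> \<in> charts_at A p" "y \<noteq> 0"
  shows "spray_coeff A S \<kappa> (snd \<kappa> p) differentiable at y"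
proof -
  note \<kappa> = charts_atD[OF assms(1)]
  let ?U = "(snd \<kappa> ` fst \<kappa>) \<times> (- {0 :: 'e})"
  let ?\<sigma> = "\<lambda>q. snd (S (chart_inv (standard_chart A \<kappa>) q)) (standard_chart A \<kappa>)"
  have U: "open ?U" using open_chart_image[OF \<kappa>(1)] by (simp add: open_Times open_Compl)
  have "standard_chart A \<kappa> \<in> tangent_atlas A" using \<kappa>(1) by (simp add: tangent_atlas_def)
  then have "smooth_on ?U ?\<sigma>"
    using spray_structure standard_chart_slit[OF \<kappa>(1)]
    unfolding spray_structure_def smooth_vector_field_on_def by metis
  then have "?\<sigma> differentiable at (snd \<kappa> p, y)"
    using U \<kappa>(2) assms(2) by (intro smooth_on_differentiable_at) auto
  then obtain D where D: "(?\<sigma> has_derivative D) (at (snd \<kappa> p, y))" by (auto simp: differentiable_def)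
  have "((\<lambda>z. (snd \<kappa> p, z)) has_derivative (\<lambda>v. (0, v))) (at y)"
    by (auto intro!: derivative_eq_intros)
  from has_derivative_compose[OF this D]
  have "((\<lambda>z. - (1/2) *\<^sub>R snd (?\<sigma> (snd \<kappa> p, z))) has_derivative (\<lambda>v. - (1/2) *\<^sub>R snd (D (0, v)))) (at y)"
    by (intro has_derivative_scaleR_right has_derivative_snd)
  moreover have "- (1/2) *\<^sub>R snd (?\<sigma> (snd \<kappa> p, z)) = spray_coeff A S \<kappa> (snd \<kappa> p) z" for z
    using \<kappa> by (simp add: spray_coeff_def chart_inv_standard_chart)
  ultimately have "(spray_coeff A S \<kappa> (snd \<kappa> p) has_derivative (\<lambda>v. - (1/2) *\<^sub>R snd (D (0, v)))) (at y)"
    by (simp only:)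
  then show ?thesis by (rule differentiableI)
qed

text \<open>With \<open>m = translate \<kappa>\<close> the induced map reads
  \<open>(z, u) \<mapsto> (m(x,z), Dm(x,z)(0,u))\<close>. Its second component depends on
  \<open>z\<close> through a first derivative of \<open>m\<close>, whence the Hessian.\<close>

lemma left_push_standard_chart_has_derivative:
  assumes "\<kappa> \<in> charts_at A g"
  shows "((snd (standard_chart A \<kappa>) \<circ> left_push G A g \<circ> chart_inv (standard_chart A base)) has_derivative
    (\<lambda>h. (frame \<kappa> (snd \<kappa> g) (fst h),
      translate_hessian \<kappa> (snd \<kappa> g) (fst h) v + frame \<kappa> (snd \<kappa> g) (snd h)))) (at (origin, v))"
proof -
  note \<kappa>A = charts_atD(1)[OF assms] and dom = translate_domain_at[OF assms]
  let ?x = "snd \<kappa> g"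
  have pair: "((\<lambda>q. (?x, fst q)) has_derivative (\<lambda>h. (0, fst h))) (at (origin, v))"
    by (auto intro!: derivative_eq_intros)
  have pair2: "((\<lambda>q. (0 :: 'e, snd q)) has_derivative (\<lambda>h. (0, snd h))) (at (origin, v))"
    by (auto intro!: derivative_eq_intros)
  have "(translate \<kappa> has_derivative frechet_derivative (translate \<kappa>) (at (?x, origin))) (at (?x, fst (origin, v)))"
    using smooth_on_differentiable_at[OF smooth_translate[OF \<kappa>A] open_translate_domain[OF \<kappa>A] dom]
    by (simp only: frechet_derivative_works fst_conv)
  from has_derivative_compose[OF pair this]
  have 1: "((\<lambda>q. translate \<kappa> (?x, fst q)) has_derivative (\<lambda>h. frame \<kappa> ?x (fst h))) (at (origin, v))"
    by (simp only: frame_def)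
  have dom': "(?x, fst (origin, v)) \<in> mult_domain \<kappa> base \<kappa>" using dom by simp
  have 2: "((\<lambda>q. frechet_derivative (translate \<kappa>) (at (?x, fst q)) (0, snd q)) has_derivative
      (\<lambda>h. translate_hessian \<kappa> ?x (fst h) v + frame \<kappa> ?x (snd h))) (at (origin, v))"
    using has_derivative_frechet_derivative_apply[OF smooth_translate[OF \<kappa>A] open_translate_domain[OF \<kappa>A] dom'
        UNIV_I pair pair2]
    by (simp only: translate_hessian_def frame_def fst_conv snd_conv)
  from has_derivative_Pair[OF 1 2] show ?thesis
  proof (rule has_derivative_transform_within_open)
    let ?Z = "(\<lambda>q. (?x, fst q)) -` mult_domain \<kappa> base \<kappa>"
    show "open ?Z" using open_translate_domain[OF \<kappa>A] by (intro open_vimage continuous_intros)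
    show "(origin, v) \<in> ?Z" using dom by simp
    fix q :: "'e \<times> 'e" assume "q \<in> ?Z"
    then obtain z u where q: "q = (z, u)" "(?x, z) \<in> mult_domain \<kappa> base \<kappa>" by (cases q) simp
    define h where "h = chart_inv base z"
    have z: "z \<in> snd base ` fst base" "g \<otimes> h \<in> fst \<kappa>"
      using q(2) by (simp_all add: mult_domain_def h_def chart_inv_chart_at[OF assms])
    have h: "base \<in> charts_at A h" "snd base h = z"
      using z(1) base_in_atlas by (simp_all add: h_def charts_at_def chart_inv_in_domain chart_chart_inv)
    have gh: "\<kappa> \<in> charts_at A (g \<otimes> h)" using z(2) \<kappa>A by (simp add: charts_at_def)
    have "snd (left_push G A g (coord_vector A h base u)) \<kappa> =
        frechet_derivative (translate \<kappa>) (at (?x, z)) (0, u)"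
      using left_push_in_chart[OF assms h(1) gh coord_vector_in_tangent_space[OF h(1)], of u]
      by (simp only: coord_vector_component[OF h(1)] h(2) translate_def)
    moreover have "snd \<kappa> (fst (left_push G A g (coord_vector A h base u))) = translate \<kappa> (?x, z)"
      by (simp add: coord_vector_def translate_def mult_coord_def h_def chart_inv_chart_at[OF assms])
    ultimately show "(translate \<kappa> (?x, fst q), frechet_derivative (translate \<kappa>) (at (?x, fst q)) (0, snd q)) =
        (snd (standard_chart A \<kappa>) \<circ> left_push G A g \<circ> chart_inv (standard_chart A base)) q"
      unfolding o_apply q(1) fst_conv snd_conv chart_inv_standard_chart[OF base_in_atlas z(1)] h_def[symmetric]
      by (simp only: standard_chart_def snd_conv)
  qed
qed

text \<open>Left invariance from the identity to \<open>g\<close>, read off in the second component.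
  \<open>S\<close> at \<open>v\<close> has coordinates \<open>(v, -2 G\<^sub>e(v))\<close>, so the
  induced map sends it to a vector with second component \<open>Q(v,v) + a(-2 G\<^sub>e(v))\<close>,
  which has to equal \<open>-2 G(x, a v)\<close>.\<close>

lemma spray_coeff_frame:
  assumes "\<kappa> \<in> charts_at A g" "v \<noteq> 0"
  shows "spray_coeff A S \<kappa> (snd \<kappa> g) (frame \<kappa> (snd \<kappa> g) v) =
    frame \<kappa> (snd \<kappa> g) (spray_coeff A S base origin v) - (1/2) *\<^sub>R translate_hessian \<kappa> (snd \<kappa> g) v v"
proof -
  let ?x = "snd \<kappa> g" and ?\<xi> = "coord_vector A \<one> base v"
  let ?f = "snd (standard_chart A \<kappa>) \<circ> left_push G A g \<circ> chart_inv (standard_chart A base)"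
  note g = charts_at_carrier[OF assms(1)]
  have \<xi>: "?\<xi> \<in> tangent_space A \<one>" by (rule coord_vector_in_tangent_space[OF base_at_one])
  have at1: "standard_chart A base \<in> charts_at (tangent_atlas A) ?\<xi>"
    by (rule standard_chart_in_charts_at[OF \<xi> base_at_one])
  have push: "left_push G A g ?\<xi> = coord_vector A g \<kappa> (frame \<kappa> ?x v)"
    by (rule left_push_coord_vector[OF assms(1)])
  have at2: "standard_chart A \<kappa> \<in> charts_at (tangent_atlas A) (left_push G A g ?\<xi>)"
    unfolding push by (rule standard_chart_in_charts_at[OF coord_vector_in_tangent_space[OF assms(1)] assms(1)])
  have std\<xi>: "snd (standard_chart A base) ?\<xi> = (origin, v)"
    using coord_vector_component[OF base_at_one, of v] by (simp add: standard_chart_def origin_def coord_vector_def)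
  have nz: "frame \<kappa> ?x v \<noteq> 0"
    using assms(2) injD[OF inj_frame[OF assms(1)], of v 0] linear_0[OF linear_frame[OF assms(1)]] by auto
  have "S (left_push G A g ?\<xi>) = pushforward (tangent_atlas A) (tangent_atlas A) (left_push G A g) (S ?\<xi>)"
    using spray g coord_vector_slit[OF base_at_one assms(2)] by (simp add: left_invariant_spray_def)
  moreover have "?f differentiable at (snd (standard_chart A base) ?\<xi>)"
    unfolding std\<xi> using left_push_standard_chart_has_derivative[OF assms(1)] by (rule differentiableI)
  ultimately have "snd (S (coord_vector A g \<kappa> (frame \<kappa> ?x v))) (standard_chart A \<kappa>) =
      frechet_derivative ?f (at (origin, v)) (snd (S ?\<xi>) (standard_chart A base))"
    using tangent.pushforward_component[where F = "left_push G A g" and B = "tangent_atlas A",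
        OF spray_in_tangent_space[OF base_at_one assms(2)] at1 at2]
    by (simp only: push std\<xi>)
  then have "- 2 *\<^sub>R spray_coeff A S \<kappa> ?x (frame \<kappa> ?x v) =
      translate_hessian \<kappa> ?x v v + frame \<kappa> ?x (- 2 *\<^sub>R spray_coeff A S base origin v)"
    unfolding frechet_derivative_at[OF left_push_standard_chart_has_derivative[OF assms(1), of v], symmetric]
      spray_component[OF assms(1) nz] spray_component[OF base_at_one assms(2)]
    by (simp add: origin_def)
  then have "- 2 *\<^sub>R spray_coeff A S \<kappa> ?x (frame \<kappa> ?x v) =
      translate_hessian \<kappa> ?x v v + - 2 *\<^sub>R frame \<kappa> ?x (spray_coeff A S base origin v)"
    by (simp only: linear_scale[OF linear_frame[OF assms(1)]])
  moreover have "a = b - (1/2) *\<^sub>R q" if "- 2 *\<^sub>R a = q + - 2 *\<^sub>R b" for a b q :: 'e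
    using arg_cong[OF that, of "\<lambda>x. (-1/2) *\<^sub>R x"]
    by (simp add: scaleR_add_right scaleR_diff_right)
  ultimately show ?thesis by blast
qed

section \<open>The spray vector field at the identity\<close>

lemma basis_tangent: "i < DIM('e) \<Longrightarrow> E i \<in> tangent_space A \<one>"
  using basis by (simp add: tangent_basis_def)

lemma left_invariant_field_one:
  "i < DIM('e) \<Longrightarrow> left_invariant_field G A (E i) \<one> = E i"
  using left_push_one[OF basis_tangent one_closed] by (simp add: left_invariant_field_def)

lemma frame_coord_one:
  assumes "\<xi> \<in> tangent_space A \<one>"
  shows "\<xi> = tlincomb \<one> DIM('e) (frame_coord G A E \<xi>) E"
proof -
  have eq: "tlincomb (fst \<xi>) DIM('e) u (\<lambda>i. left_invariant_field G A (E i) (fst \<xi>)) = tlincomb \<one> DIM('e) u E" for u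
    unfolding tangent_spaceD(1)[OF assms] by (rule tlincomb_cong) (rule left_invariant_field_one)
  have "\<exists>!u. (\<forall>i\<ge>DIM('e). u i = 0) \<and> \<xi> = tlincomb \<one> DIM('e) u E"
    by (rule bspec[OF conjunct2[OF basis[unfolded tangent_basis_def]] assms])
  from theI'[OF this] show ?thesis unfolding frame_coord_def eq by blast
qed

text \<open>At a vector with coordinate \<open>y\<close> the lift of the i-th field is
  \<open>(e\<^sub>i, b(y, e\<^sub>i))\<close>. Summing with the coefficients of \<open>y\<close> in
  the basis gives \<open>(y, b(y,y))\<close> by linearity in the second argument.\<close>

lemma canonical_spray_one:
  assumes "\<xi> \<in> tangent_space A \<one>"
  shows "canonical_spray G A E \<xi> \<in> tangent_space (tangent_atlas A) \<xi>"
    "snd (canonical_spray G A E \<xi>) (standard_chart A base) = (snd \<xi> base, frame_deriv base origin (snd \<xi> base) (snd \<xi> base))"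
proof -
  note at1 = standard_chart_in_charts_at[OF assms base_at_one]
  have lift: "complete_lift A (left_invariant_field G A (E i)) \<xi> =
      coord_vector (tangent_atlas A) \<xi> (standard_chart A base)
        (snd (E i) base, frame_deriv base origin (snd \<xi> base) (snd (E i) base))" if "i < DIM('e)" for i
    \<comment> \<open>\<open>complete_lift\<close> works in \<open>some_chart A \<one>\<close>,
      which is \<open>base\<close> by definition.\<close>
    using left_invariant_field_deriv[OF base_at_one basis_tangent[OF that], of "snd \<xi> base"]
    by (simp add: complete_lift_def Let_def tangent_spaceD(1)[OF assms] left_invariant_field_one[OF that]
        flip: base_def origin_def)
  show "canonical_spray G A E \<xi> \<in> tangent_space (tangent_atlas A) \<xi>"
    unfolding canonical_spray_def
    by (rule tangent.tangent_space_tlincomb) (simp add: lift tangent.coord_vector_in_tangent_space[OF at1])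
  let ?u = "frame_coord G A E \<xi>"
  have "snd \<xi> base = snd (tlincomb \<one> DIM('e) ?u E) base"
    by (rule arg_cong[OF frame_coord_one[OF assms], of "\<lambda>\<xi>. snd \<xi> base"])
  then have u: "snd \<xi> base = (\<Sum>i<DIM('e). ?u i *\<^sub>R snd (E i) base)" by simp
  have "snd (canonical_spray G A E \<xi>) (standard_chart A base) =
      (\<Sum>i<DIM('e). ?u i *\<^sub>R (snd (E i) base, frame_deriv base origin (snd \<xi> base) (snd (E i) base)))"
    by (simp add: canonical_spray_def lift tangent.coord_vector_component[OF at1])
  also have "\<dots> = (\<Sum>i<DIM('e). ?u i *\<^sub>R snd (E i) base,
      \<Sum>i<DIM('e). ?u i *\<^sub>R frame_deriv base origin (snd \<xi> base) (snd (E i) base))"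
    by (simp add: prod_eq_iff fst_sum snd_sum)
  also have "(\<Sum>i<DIM('e). ?u i *\<^sub>R frame_deriv base origin (snd \<xi> base) (snd (E i) base)) =
      frame_deriv base origin (snd \<xi> base) (\<Sum>i<DIM('e). ?u i *\<^sub>R snd (E i) base)"
    using linear_frame_deriv(2)[OF base_at_one, of "snd \<xi> base"]
    by (simp add: linear_sum linear_scale flip: origin_def)
  finally show "snd (canonical_spray G A E \<xi>) (standard_chart A base) =
      (snd \<xi> base, frame_deriv base origin (snd \<xi> base) (snd \<xi> base))"
    unfolding u[symmetric] .
qed

text \<open>The coordinate line keeps its base point, so it stays in every chart at the identity and
  its first coordinates are constant.\<close>

lemma frame_vertical_one:
  assumes "\<xi> \<in> tangent_space A \<one>" "i < DIM('e)"
  shows "frame_vertical G A E i \<xi> \<in> tangent_space (tangent_atlas A) \<xi>"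
    "snd (frame_vertical G A E i \<xi>) (standard_chart A base) = (0, snd (E i) base)"
proof -
  note at1 = standard_chart_in_charts_at[OF assms(1) base_at_one]
  define c where "c s = tadd \<xi> (tscale s (E i))" for s
  have c0: "c 0 = \<xi>" by (simp add: c_def tadd_def)
  have c: "c s \<in> tangent_space A \<one>" for s
    unfolding c_def by (intro tangent_space_tadd tangent_space_tscale basis_tangent assms)
  have vert: "frame_vertical G A E i \<xi> = velocity (tangent_atlas A) UNIV c 0"
    by (simp add: frame_vertical_def tangent_spaceD(1)[OF assms(1)] left_invariant_field_one[OF assms(2)] c_def[abs_def])
  have deriv: "((snd (standard_chart A \<kappa>) \<circ> c) has_vector_derivative (0, snd (E i) \<kappa>)) (at 0)" for \<kappa>
  proof -
    have "((\<lambda>s. (snd \<kappa> \<one>, snd \<xi> \<kappa> + s *\<^sub>R snd (E i) \<kappa>)) has_vector_derivative (0, snd (E i) \<kappa>)) (at 0)"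
      by (auto intro!: derivative_eq_intros simp: has_vector_derivative_def)
    then show ?thesis by (simp add: c_def standard_chart_def o_def tangent_spaceD(1)[OF assms(1)])
  qed
  have "velocity (tangent_atlas A) UNIV c 0 \<in> tangent_space (tangent_atlas A) (c 0)"
  proof (rule tangent.velocity_in_tangent_space)
    fix \<kappa>' assume \<kappa>': "\<kappa>' \<in> charts_at (tangent_atlas A) (c 0)"
    obtain \<kappa> where \<kappa>: "\<kappa> \<in> charts_at A \<one>" "\<kappa>' = standard_chart A \<kappa>"
      by (rule charts_at_tangent_atlas[OF c \<kappa>'])
    show "(snd \<kappa>' \<circ> c) differentiable (at 0)"
      unfolding \<kappa>(2) by (rule differentiableI_vector[OF deriv])
    show "\<forall>\<^sub>F s in at 0. c s \<in> fst \<kappa>'"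
      using charts_atD(2)[OF standard_chart_in_charts_at[OF c \<kappa>(1)]] by (simp add: \<kappa>(2))
  qed simp_all
  then show "frame_vertical G A E i \<xi> \<in> tangent_space (tangent_atlas A) \<xi>"
    by (simp only: vert c0)
  have "standard_chart A base \<in> charts_at (tangent_atlas A) (c 0)" using at1 by (simp only: c0)
  from tangent.velocity_component[where c = c and t = 0 and J = UNIV, OF this]
  show "snd (frame_vertical G A E i \<xi>) (standard_chart A base) = (0, snd (E i) base)"
    unfolding vert by (simp add: vector_derivative_at[OF deriv])
qed

text \<open>The second components in the defining equation of \<open>H\<close> at \<open>v\<close>
  read \<open>-2 G\<^sub>e(v) = b(v,v) - \<Sum>h\<^sub>i e\<^sub>i\<close>; the remaining sum is the
  value of the spray vector field.\<close>

lemma spray_vector_field_coord: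
  assumes "v \<noteq> 0"
  shows "spray_vector_field G A E S (coord_vector A \<one> base v) =
    coord_vector A \<one> base (frame_deriv base origin v v + 2 *\<^sub>R spray_coeff A S base origin v)"
proof -
  let ?\<xi> = "coord_vector A \<one> base v"
  define \<zeta> where "\<zeta> = coord_vector A \<one> base (frame_deriv base origin v v + 2 *\<^sub>R spray_coeff A S base origin v)"
  have \<xi>: "?\<xi> \<in> tangent_space A \<one>" and \<zeta>: "\<zeta> \<in> tangent_space A \<one>"
    unfolding \<zeta>_def by (rule coord_vector_in_tangent_space[OF base_at_one])+
  note at1 = standard_chart_in_charts_at[OF \<xi> base_at_one]
  note can = canonical_spray_one[OF \<xi>] and vert = frame_vertical_one[OF \<xi>]
  \<comment> \<open>An equivalence for every \<open>h\<close> turns the definite description in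
    \<open>spray_H\<close> into the one for the coefficients of \<open>\<zeta>\<close>, whose unique
    existence is the basis property.\<close>
  have "S ?\<xi> = tdiff (canonical_spray G A E ?\<xi>) (tlincomb ?\<xi> DIM('e) h (\<lambda>i. frame_vertical G A E i ?\<xi>)) \<longleftrightarrow>
      \<zeta> = tlincomb \<one> DIM('e) h E" for h
  proof -
    let ?r = "tdiff (canonical_spray G A E ?\<xi>) (tlincomb ?\<xi> DIM('e) h (\<lambda>i. frame_vertical G A E i ?\<xi>))"
    have r: "?r \<in> tangent_space (tangent_atlas A) ?\<xi>"
      by (intro tangent.tangent_space_tdiff tangent.tangent_space_tlincomb can vert)
    have "snd ?r (standard_chart A base) =
        (v, frame_deriv base origin v v) - (\<Sum>i<DIM('e). h i *\<^sub>R (0, snd (E i) base))"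
      by (simp add: can(2) vert(2) coord_vector_component[OF base_at_one])
    also have "\<dots> = (v, frame_deriv base origin v v - (\<Sum>i<DIM('e). h i *\<^sub>R snd (E i) base))"
      by (simp add: prod_eq_iff fst_sum snd_sum)
    finally have r2: "snd ?r (standard_chart A base) =
        (v, frame_deriv base origin v v - (\<Sum>i<DIM('e). h i *\<^sub>R snd (E i) base))" .
    have "S ?\<xi> = ?r \<longleftrightarrow> snd (S ?\<xi>) (standard_chart A base) = snd ?r (standard_chart A base)"
    proof
      assume "S ?\<xi> = ?r"
      then show "snd (S ?\<xi>) (standard_chart A base) = snd ?r (standard_chart A base)"
        by (rule arg_cong)
    qed (rule tangent_space_eqI[OF spray_in_tangent_space[OF base_at_one assms] r at1])
    also have "\<dots> \<longleftrightarrow> - 2 *\<^sub>R spray_coeff A S base origin v =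
        frame_deriv base origin v v - (\<Sum>i<DIM('e). h i *\<^sub>R snd (E i) base)"
      unfolding r2 spray_component[OF base_at_one assms] by (simp add: origin_def)
    also have "\<dots> \<longleftrightarrow> snd \<zeta> base = snd (tlincomb \<one> DIM('e) h E) base"
    proof -
      have "- 2 *\<^sub>R a - (f - s) = - (f + 2 *\<^sub>R a - s)" for a f s :: 'e by simp
      then have "- 2 *\<^sub>R a = f - s \<longleftrightarrow> f + 2 *\<^sub>R a = s" for a f s :: 'e
        unfolding eq_iff_diff_eq_0[of "- 2 *\<^sub>R a"] eq_iff_diff_eq_0[of "f + 2 *\<^sub>R a"]
        by (simp only: neg_equal_0_iff_equal)
      then show ?thesis by (simp only: \<zeta>_def coord_vector_component[OF base_at_one] tlincomb_simps)
    qed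
    also have "\<dots> \<longleftrightarrow> \<zeta> = tlincomb \<one> DIM('e) h E"
    proof
      assume "\<zeta> = tlincomb \<one> DIM('e) h E"
      then show "snd \<zeta> base = snd (tlincomb \<one> DIM('e) h E) base" by (rule arg_cong)
    qed (rule tangent_space_eqI[OF \<zeta> tangent_space_tlincomb[OF basis_tangent] base_at_one])
    finally show ?thesis .
  qed
  then have H: "spray_H G A E S ?\<xi> = (THE h. (\<forall>i\<ge>DIM('e). h i = 0) \<and> \<zeta> = tlincomb \<one> DIM('e) h E)"
    unfolding spray_H_def by (simp only:)
  have "\<exists>!h. (\<forall>i\<ge>DIM('e). h i = 0) \<and> \<zeta> = tlincomb \<one> DIM('e) h E"
    by (rule bspec[OF conjunct2[OF basis[unfolded tangent_basis_def]] \<zeta>])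
  from theI'[OF this] show ?thesis
    unfolding spray_vector_field_def H \<zeta>_def by simp
qed

end

section \<open>Covariant derivatives along curves\<close>

text \<open>Smoothness of a curve is stated on the times spent in a chart, while velocities and
  covariant derivatives are taken within \<open>J\<close>; near such a time the two filters are the
  same.\<close>

lemma openin_at_within:
  assumes "openin (top_of_set J) U" "t \<in> U"
  shows "at t within U = at t within J" "\<forall>\<^sub>F s in at t within J. s \<in> U"
proof -
  obtain T where T: "open T" "U = J \<inter> T" using assms(1) unfolding openin_open by blast
  have ev: "eventually P (at t within U) \<longleftrightarrow> eventually P (at t within J)" for P
  proof
    assume "eventually P (at t within U)"
    then obtain V where V: "open V" "t \<in> V" "\<forall>x\<in>V. x \<noteq> t \<longrightarrow> x \<in> U \<longrightarrow> P x"
      unfolding eventually_at_topological by blast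
    have "open (V \<inter> T)" "t \<in> V \<inter> T" "\<forall>x\<in>V \<inter> T. x \<noteq> t \<longrightarrow> x \<in> J \<longrightarrow> P x"
      using V T assms(2) by auto
    then show "eventually P (at t within J)" unfolding eventually_at_topological by blast
  next
    assume "eventually P (at t within J)"
    then show "eventually P (at t within U)" unfolding eventually_at_topological T(2) by blast
  qed
  then show "at t within U = at t within J" by (simp add: filter_eq_iff)
  have "eventually (\<lambda>s. s \<in> U) (at t within U)" unfolding eventually_at_topological by blast
  then show "\<forall>\<^sub>F s in at t within J. s \<in> U" by (simp only: ev)
qed

text \<open>A nondegenerate interval has no isolated points, so derivatives within \<open>J\<close>
  are unique at its endpoints too.\<close>

lemma interval_at_within_ne_bot:
  fixes J :: "real set"
  assumes "is_interval J" "interior J \<noteq> {}" "t \<in> J"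
  shows "at t within J \<noteq> bot"
proof -
  have "J \<noteq> {x}" for x using assms(2) by auto
  then have "t islimpt J"
    using assms by (intro connected_imp_perfect is_interval_connected)
  then show ?thesis by (simp add: trivial_limit_within)
qed

lemma smooth_curve_on_chart:
  assumes "smooth_curve_on X A J c" "\<kappa> \<in> charts_at A (c t)" "t \<in> J" "openin X (fst \<kappa>)"
  shows "(snd \<kappa> \<circ> c) differentiable (at t within J)" "\<forall>\<^sub>F s in at t within J. c s \<in> fst \<kappa>"
proof -
  let ?U = "{s \<in> J. c s \<in> fst \<kappa>}"
  have "continuous_map (top_of_set J) X c" using assms(1) by (simp add: smooth_curve_on_def)
  from openin_continuous_map_preimage[OF this assms(4)]
  have U: "openin (top_of_set J) ?U" by simp
  have t: "t \<in> ?U" using assms(2,3) by (simp add: charts_at_def)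
  have "smooth_on ?U (snd \<kappa> \<circ> c)" using assms(1,2) by (simp add: smooth_curve_on_def charts_at_def)
  then show "(snd \<kappa> \<circ> c) differentiable (at t within J)"
    using smooth_on_imp_differentiable_on t openin_at_within(1)[OF U t]
    unfolding differentiable_on_def by metis
  show "\<forall>\<^sub>F s in at t within J. c s \<in> fst \<kappa>"
    using openin_at_within(2)[OF U t] by eventually_elim simp
qed

text \<open>\<open>W s\<close> lies over \<open>c s\<close>, so the standard chart applies exactly
  while \<open>c\<close> is in \<open>\<kappa>\<close>, and its second component is the fibre
  coordinate.\<close>

lemma (in smooth_charts) smooth_vector_field_along_chart:
  assumes W: "smooth_vector_field_along A J c W" and t: "t \<in> J" and \<kappa>: "\<kappa> \<in> charts_at A (c t)"
    and U: "openin (top_of_set J) {s \<in> J. c s \<in> fst \<kappa>}"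
  shows "(\<lambda>s. snd (W s) \<kappa>) differentiable (at t within J)"
proof -
  let ?U = "{s \<in> J. c s \<in> fst \<kappa>}"
  have Wt: "W s \<in> tangent_space A (c s)" if "s \<in> J" for s
    using W that by (simp add: smooth_vector_field_along_def)
  have "{s \<in> J. W s \<in> fst (standard_chart A \<kappa>)} = ?U"
    using Wt tangent_spaceD(1)[OF Wt] by (auto simp: in_standard_chart_iff[OF charts_atD(1)[OF \<kappa>]])
  moreover have "smooth_on {s \<in> J. W s \<in> fst (standard_chart A \<kappa>)} (snd (standard_chart A \<kappa>) \<circ> W)"
    using W charts_atD(1)[OF \<kappa>]
    by (simp add: smooth_vector_field_along_def smooth_curve_on_def tangent_atlas_def)
  ultimately have "(snd (standard_chart A \<kappa>) \<circ> W) differentiable_on ?U"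
    using smooth_on_imp_differentiable_on by metis
  moreover have tU: "t \<in> ?U" using t charts_atD(2)[OF \<kappa>] by simp
  ultimately have "(snd (standard_chart A \<kappa>) \<circ> W) differentiable (at t within J)"
    unfolding differentiable_on_def openin_at_within(1)[OF U tU, symmetric] by blast
  then obtain D where "((snd (standard_chart A \<kappa>) \<circ> W) has_derivative D) (at t within J)"
    by (auto simp: differentiable_def)
  from has_derivative_snd[OF this]
  show ?thesis by (intro differentiableI) (simp add: standard_chart_def)
qed

context differentiable_atlas
begin

section \<open>Linear structure of a fixed tangent space\<close>

lemma linear_coord_vector:
  assumes "\<kappa> \<in> charts_at A p"
  shows "linear (\<lambda>a. snd (coord_vector A p \<kappa> a) \<kappa>')"
proof (cases "\<kappa>' \<in> charts_at A p")
  case True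
  then show ?thesis using linear_transition[OF assms True] by (simp add: coord_vector_def)
next
  case False
  then show ?thesis by (simp add: coord_vector_def linear_zero)
qed

text \<open>A derivative computed in one chart yields the derivatives of all components, including
  those of charts away from \<open>p\<close>, which are constantly 0. This is what
  \<open>fibre_derivative\<close> and \<open>fibre_differentiable\<close> ask for.\<close>

lemma coord_vector_has_vector_derivative:
  assumes "\<kappa> \<in> charts_at A p" "(f has_vector_derivative f') F"
  shows "((\<lambda>s. snd (coord_vector A p \<kappa> (f s)) \<kappa>') has_vector_derivative snd (coord_vector A p \<kappa> f') \<kappa>') F"
  using linear_coord_vector[OF assms(1)]
  by (intro bounded_linear.has_vector_derivative[OF _ assms(2)]) (simp add: linear_conv_bounded_linear)

lemma coord_vector_eq_tzero_iff:
  assumes "\<kappa> \<in> charts_at A p"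
  shows "coord_vector A p \<kappa> a = tzero p \<longleftrightarrow> a = 0"
proof
  assume "coord_vector A p \<kappa> a = tzero p"
  then have "snd (coord_vector A p \<kappa> a) \<kappa> = snd (tzero p) \<kappa>" by (simp only:)
  then show "a = 0" by (simp add: coord_vector_component[OF assms])
next
  assume "a = 0"
  then show "coord_vector A p \<kappa> a = tzero p"
    using linear_0[OF linear_coord_vector[OF assms]]
    by (intro prod_eqI ext) (simp_all add: coord_vector_def[of A p \<kappa> 0, THEN arg_cong, of fst])
qed

lemma tadd_coord_vector:
  assumes "\<kappa> \<in> charts_at A p"
  shows "tadd (coord_vector A p \<kappa> a) (coord_vector A p \<kappa> b) = coord_vector A p \<kappa> (a + b)"
  by (rule tangent_space_eqI[OF _ _ assms])
    (simp_all add: tangent_space_tadd coord_vector_in_tangent_space[OF assms] coord_vector_component[OF assms])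

lemma tscale_coord_vector:
  assumes "\<kappa> \<in> charts_at A p"
  shows "tscale r (coord_vector A p \<kappa> a) = coord_vector A p \<kappa> (r *\<^sub>R a)"
  by (rule tangent_space_eqI[OF _ _ assms])
    (simp_all add: tangent_space_tscale coord_vector_in_tangent_space[OF assms] coord_vector_component[OF assms])

lemma tdiff_coord_vector:
  assumes "\<kappa> \<in> charts_at A p"
  shows "tdiff (coord_vector A p \<kappa> a) (coord_vector A p \<kappa> b) = coord_vector A p \<kappa> (a - b)"
  by (simp add: tdiff_def tadd_coord_vector[OF assms] tscale_coord_vector[OF assms])

end

lemma quadratic_has_derivative:
  fixes B :: "'v::euclidean_space \<Rightarrow> 'v \<Rightarrow> 'w::euclidean_space"
  assumes "\<And>w. linear (\<lambda>v. B v w)" "\<And>v. linear (B v)"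
  shows "((\<lambda>v. B v v) has_derivative (\<lambda>h. B v h + B h v)) (at v)"
proof -
  have "bilinear B" using assms by (simp add: bilinear_def)
  then have "bounded_bilinear B" by (simp add: bilinear_conv_bounded_bilinear)
  from bounded_bilinear.FDERIV[OF this has_derivative_ident has_derivative_ident]
  show ?thesis .
qed

context left_invariant_spray_frame
begin

definition spray_coeff_deriv :: "'e \<Rightarrow> 'e \<Rightarrow> 'e" where
  "spray_coeff_deriv v = frechet_derivative (spray_coeff A S base origin) (at v)"

lemma spray_coeff_base_has_derivative:
  "v \<noteq> 0 \<Longrightarrow> (spray_coeff A S base origin has_derivative spray_coeff_deriv v) (at v)"
  unfolding spray_coeff_deriv_def
  using spray_coeff_differentiable[OF base_at_one] by (simp add: origin_def frechet_derivative_works)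

text \<open>From \<open>\<eta>(v) = b(v,v) + 2 G\<^sub>e(v)\<close> one gets
  \<open>D\<eta>(v,w) = b(v,w) + b(w,v) + 2 DG\<^sub>e(v) w\<close>. Half of this minus half of the
  bracket \<open>b(v,w) - b(w,v)\<close> leaves \<open>b(w,v) + DG\<^sub>e(v) w\<close>.\<close>

lemma connection_operator_coord:
  assumes "v \<noteq> 0"
  shows "connection_operator G A (spray_vector_field G A E S)
      (coord_vector A \<one> base v) (coord_vector A \<one> base w) =
    coord_vector A \<one> base (frame_deriv base origin w v + spray_coeff_deriv v w)"
proof -
  let ?V = "coord_vector A \<one> base" and ?b = "frame_deriv base origin"
  let ?\<eta> = "\<lambda>s. spray_vector_field G A E S (tadd (?V v) (tscale s (?V w)))"
  let ?q = "\<lambda>u. ?b u u + 2 *\<^sub>R spray_coeff A S base origin u"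
  let ?d = "?b v w + ?b w v + 2 *\<^sub>R spray_coeff_deriv v w"
  have "((\<lambda>u. ?b u u) has_derivative (\<lambda>h. ?b v h + ?b h v)) (at v)"
    using linear_frame_deriv[OF base_at_one] by (intro quadratic_has_derivative) (simp_all add: origin_def)
  then have q: "(?q has_derivative (\<lambda>h. ?b v h + ?b h v + 2 *\<^sub>R spray_coeff_deriv v h)) (at (v + 0 *\<^sub>R w))"
    using spray_coeff_base_has_derivative[OF assms]
    by (simp only: scaleR_zero_left add_0_right) (intro has_derivative_add has_derivative_scaleR_right)
  have line: "((\<lambda>s. v + s *\<^sub>R w) has_derivative (\<lambda>s. s *\<^sub>R w)) (at 0)"
    by (auto intro!: derivative_eq_intros)
  have dq: "((\<lambda>s. ?q (v + s *\<^sub>R w)) has_vector_derivative ?d) (at 0)"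
  proof -
    have lin: "linear (\<lambda>h. ?b v h + ?b h v + 2 *\<^sub>R spray_coeff_deriv v h)"
      using q by (rule has_derivative_linear)
    show ?thesis
      using has_derivative_compose[OF line q] linear_scale[OF lin, of _ w]
      by (simp only: has_vector_derivative_def)
  qed
  have ev: "\<forall>\<^sub>F s in at 0. ?\<eta> s = ?V (?q (v + s *\<^sub>R w))"
  proof -
    have "((\<lambda>s. v + s *\<^sub>R w) \<longlongrightarrow> v + 0 *\<^sub>R w) (at 0)"
      by (intro tendsto_intros)
    then have "\<forall>\<^sub>F s in at 0. v + s *\<^sub>R w \<in> - {0}"
      using assms by (intro topological_tendstoD) auto
    then show ?thesis
      by eventually_elim
        (simp add: tscale_coord_vector[OF base_at_one] tadd_coord_vector[OF base_at_one] spray_vector_field_coord)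
  qed
  have \<eta>0: "?\<eta> 0 = ?V (?q (v + 0 *\<^sub>R w))"
    using assms by (simp add: tscale_coord_vector[OF base_at_one] tadd_coord_vector[OF base_at_one] spray_vector_field_coord)
  have fd: "fibre_derivative UNIV ?\<eta> 0 = ?V ?d"
  proof (rule prod_eqI)
    show "fst (fibre_derivative UNIV ?\<eta> 0) = fst (?V ?d)"
      by (simp add: fibre_derivative_def spray_vector_field_def) (simp add: coord_vector_def)
    show "snd (fibre_derivative UNIV ?\<eta> 0) = snd (?V ?d)"
    proof
      fix \<kappa>
      have "\<forall>\<^sub>F s in at 0. snd (?V (?q (v + s *\<^sub>R w))) \<kappa> = snd (?\<eta> s) \<kappa>"
        using ev by eventually_elim (simp only:)
      then have "((\<lambda>s. snd (?\<eta> s) \<kappa>) has_vector_derivative snd (?V ?d) \<kappa>) (at 0)"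
        using coord_vector_has_vector_derivative[OF base_at_one dq, of \<kappa>]
        unfolding has_vector_derivative_def
        by (intro has_derivative_transform_eventually[where g = "\<lambda>s. snd (?\<eta> s) \<kappa>"]) (simp_all only: \<eta>0 UNIV_I)
      from vector_derivative_at[OF this]
      show "snd (fibre_derivative UNIV ?\<eta> 0) \<kappa> = snd (?V ?d) \<kappa>" by (simp add: fibre_derivative_def)
    qed
  qed
  have br: "lie_algebra_bracket G A (?V v) (?V w) = ?V (?b v w - ?b w v)"
    by (simp add: lie_algebra_bracket_coord coord_vector_in_tangent_space[OF base_at_one]
        coord_vector_component[OF base_at_one])
  have half: "(1/2) *\<^sub>R (a + b + 2 *\<^sub>R d) - (1/2) *\<^sub>R (a - b) = b + d" for a b d :: 'e
  proof -
    have "(1/2) *\<^sub>R (a + b + 2 *\<^sub>R d) - (1/2) *\<^sub>R (a - b) = (1/2) *\<^sub>R b + (1/2) *\<^sub>R b + d"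
      by (simp add: scaleR_add_right scaleR_diff_right)
    then show ?thesis by (simp flip: scaleR_add_left)
  qed
  show ?thesis
    unfolding connection_operator_def fd br
    unfolding tscale_coord_vector[OF base_at_one] tdiff_coord_vector[OF base_at_one] half ..
qed

text \<open>The law \<open>spray_coeff_frame\<close> is differentiated in \<open>v\<close>. It holds
  on the open set \<open>v \<noteq> 0\<close>, and symmetry merges the two halves
  \<open>Q(v,w)/2\<close> and \<open>Q(w,v)/2\<close>.\<close>

lemma spray_N_frame:
  assumes "\<kappa> \<in> charts_at A g" "v \<noteq> 0"
  shows "spray_N A S \<kappa> (snd \<kappa> g) (frame \<kappa> (snd \<kappa> g) v) (frame \<kappa> (snd \<kappa> g) w) =
    frame \<kappa> (snd \<kappa> g) (spray_coeff_deriv v w) - translate_hessian \<kappa> (snd \<kappa> g) v w"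
proof -
  let ?a = "frame \<kappa> (snd \<kappa> g)" and ?Q = "translate_hessian \<kappa> (snd \<kappa> g)" and ?c = "spray_coeff A S \<kappa> (snd \<kappa> g)"
  note lin = linear_frame[OF assms(1)]
  have a: "bounded_linear ?a" using lin by (simp add: linear_conv_bounded_linear)
  have nz: "?a v \<noteq> 0"
    using assms(2) injD[OF inj_frame[OF assms(1)], of v 0] linear_0[OF lin] by auto
  have "(?c has_derivative spray_N A S \<kappa> (snd \<kappa> g) (?a v)) (at (?a v))"
    using spray_coeff_differentiable[OF assms(1) nz] unfolding spray_N_def frechet_derivative_works .
  from has_derivative_compose[OF bounded_linear_imp_has_derivative[OF a] this]
  have 1: "((\<lambda>v. ?c (?a v)) has_derivative (\<lambda>w. spray_N A S \<kappa> (snd \<kappa> g) (?a v) (?a w))) (at v)" .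
  have Q: "((\<lambda>v. ?Q v v) has_derivative (\<lambda>h. ?Q v h + ?Q h v)) (at v)"
  proof (rule quadratic_has_derivative)
    show "linear (?Q v)" for v by (rule linear_translate_hessian[OF assms(1)])
    then show "linear (\<lambda>v. ?Q v w)" for w by (simp only: translate_hessian_commute[OF assms(1), of _ w])
  qed
  have "((\<lambda>v. ?a (spray_coeff A S base origin v) - (1/2) *\<^sub>R ?Q v v) has_derivative
      (\<lambda>h. ?a (spray_coeff_deriv v h) - (1/2) *\<^sub>R (?Q v h + ?Q h v))) (at v)"
    by (intro has_derivative_diff has_derivative_scaleR_right Q
        bounded_linear.has_derivative[OF a] spray_coeff_base_has_derivative assms(2))
  then have "((\<lambda>v. ?c (?a v)) has_derivative
      (\<lambda>h. ?a (spray_coeff_deriv v h) - (1/2) *\<^sub>R (?Q v h + ?Q h v))) (at v)"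
    by (rule has_derivative_transform_within_open[of _ _ _ _ "- {0}"])
      (use assms in \<open>auto simp: spray_coeff_frame\<close>)
  from fun_cong[OF has_derivative_unique[OF 1 this], of w]
  have "spray_N A S \<kappa> (snd \<kappa> g) (?a v) (?a w) = ?a (spray_coeff_deriv v w) - (1/2) *\<^sub>R (?Q v w + ?Q v w)"
    by (simp only: translate_hessian_commute[OF assms(1), of w])
  then show ?thesis by (simp flip: scaleR_2)
qed

end

locale spray_curve = left_invariant_spray_frame G X A E S
  for G :: "('a, 'b) monoid_scheme" (structure)
    and X :: "'a topology"
    and A :: "('a, 'e::euclidean_space) chart set"
    and E S +
  fixes J :: "real set"
    and c :: "real \<Rightarrow> 'a"
    and W :: "real \<Rightarrow> ('a, 'e) tvec"
  assumes interval: "is_interval J" "interior J \<noteq> {}"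
    and curve: "smooth_curve_on X A J c"
    and velocity_nonzero: "\<And>t. t \<in> J \<Longrightarrow> velocity A J c t \<noteq> tzero (c t)"
    and field: "smooth_vector_field_along A J c W"
begin

section \<open>Curves and fields translated to the identity\<close>

definition body_velocity :: "real \<Rightarrow> ('a, 'e) tvec" where
  "body_velocity t = left_push G A (inv (c t)) (velocity A J c t)"

definition body_field :: "real \<Rightarrow> ('a, 'e) tvec" where
  "body_field t = left_push G A (inv (c t)) (W t)"

lemma curve_in_carrier: "t \<in> J \<Longrightarrow> c t \<in> carrier G"
  using curve topspace_eq_carrier
  by (auto simp: smooth_curve_on_def continuous_map_def)

lemma curve_chart:
  assumes "t \<in> J" "\<kappa> \<in> charts_at A (c t)"
  shows "(snd \<kappa> \<circ> c) differentiable (at t within J)" "\<forall>\<^sub>F s in at t within J. c s \<in> fst \<kappa>"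
  using smooth_curve_on_chart[OF curve assms(2,1) smooth_atlas_chart(1)[OF smooth_atlas charts_atD(1)[OF assms(2)]]]
  by simp_all

lemma eventually_in_chart:
  assumes "t \<in> J" "\<kappa> \<in> charts_at A (c t)"
  shows "\<forall>\<^sub>F s in at t within J. \<kappa> \<in> charts_at A (c s) \<and> s \<in> J"
proof -
  have "\<forall>\<^sub>F s in at t within J. s \<in> J" unfolding eventually_at_topological by blast
  with curve_chart(2)[OF assms] show ?thesis
    by eventually_elim (simp add: charts_at_def charts_atD(1)[OF assms(2)])
qed

lemma velocity_tangent: "t \<in> J \<Longrightarrow> velocity A J c t \<in> tangent_space A (c t)"
  by (intro velocity_in_tangent_space interval_at_within_ne_bot interval curve_chart)

lemma field_tangent: "t \<in> J \<Longrightarrow> W t \<in> tangent_space A (c t)"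
  using field by (simp add: smooth_vector_field_along_def)

lemma left_push_inv:
  assumes "g \<in> carrier G" "\<xi> \<in> tangent_space A g"
  shows "left_push G A (inv g) \<xi> \<in> tangent_space A \<one>"
    "left_push G A g (left_push G A (inv g) \<xi>) = \<xi>"
proof -
  show "left_push G A (inv g) \<xi> \<in> tangent_space A \<one>"
    using left_push_in_tangent_space[OF inv_closed[OF assms(1)] assms(2,1)] l_inv[OF assms(1)] by simp
  show "left_push G A g (left_push G A (inv g) \<xi>) = \<xi>"
    using left_push_left_push[OF assms(1) inv_closed[OF assms(1)] assms(2,1)] r_inv[OF assms(1)]
      left_push_one[OF assms(2,1)] by simp
qed

lemma body_tangent:
  assumes "t \<in> J"
  shows "body_velocity t \<in> tangent_space A \<one>" "body_field t \<in> tangent_space A \<one>"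
  unfolding body_velocity_def body_field_def
  using left_push_inv(1)[OF curve_in_carrier[OF assms]] velocity_tangent[OF assms] field_tangent[OF assms]
  by blast+

text \<open>The equations \<open>c' = a y\<close> and \<open>W = a w\<close>: translation by
  \<open>c t\<close> undoes translation by its inverse.\<close>

lemma body_frame:
  assumes "t \<in> J" "\<kappa> \<in> charts_at A (c t)"
  shows "snd (velocity A J c t) \<kappa> = frame \<kappa> (snd \<kappa> (c t)) (snd (body_velocity t) base)"
    "snd (W t) \<kappa> = frame \<kappa> (snd \<kappa> (c t)) (snd (body_field t) base)"
  using left_push_frame[OF assms(2) body_tangent(1)[OF assms(1)]]
    left_push_frame[OF assms(2) body_tangent(2)[OF assms(1)]]
    left_push_inv(2)[OF curve_in_carrier[OF assms(1)] velocity_tangent[OF assms(1)]]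
    left_push_inv(2)[OF curve_in_carrier[OF assms(1)] field_tangent[OF assms(1)]]
  by (simp_all add: body_velocity_def body_field_def)

text \<open>The formulas for the spray coefficients and for the connection operator are restricted
  to nonzero vectors.\<close>

lemma body_velocity_nonzero:
  assumes "t \<in> J"
  shows "snd (body_velocity t) base \<noteq> 0"
proof
  assume 0: "snd (body_velocity t) base = 0"
  let ?\<kappa> = "some_chart A (c t)"
  have \<kappa>: "?\<kappa> \<in> charts_at A (c t)" by (rule some_chart_at[OF curve_in_carrier[OF assms]])
  have "snd (velocity A J c t) ?\<kappa> = 0"
    by (simp add: body_frame(1)[OF assms \<kappa>] 0 linear_0[OF linear_frame[OF \<kappa>]])
  then have "velocity A J c t = tzero (c t)"
    using coord_vector_of_component[OF velocity_tangent[OF assms] \<kappa>] coord_vector_eq_tzero_iff[OF \<kappa>, of 0]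
    by simp
  then show False using velocity_nonzero[OF assms] by contradiction
qed

lemma velocity_has_vector_derivative:
  assumes "t \<in> J" "\<kappa> \<in> charts_at A (c t)"
  shows "((\<lambda>s. snd \<kappa> (c s)) has_vector_derivative snd (velocity A J c t) \<kappa>) (at t within J)"
  using curve_chart(1)[OF assms]
  unfolding velocity_component[where c = c and t = t, OF assms(2)] vector_derivative_works by (simp add: o_def)

lemma frame_along_curve_has_derivative:
  assumes "t \<in> J" "\<kappa> \<in> charts_at A (c t)"
    and "(\<phi> has_vector_derivative \<phi>') (at t within J)"
  shows "((\<lambda>s. frame \<kappa> (snd \<kappa> (c s)) (\<phi> s)) has_vector_derivative
    frame_deriv \<kappa> (snd \<kappa> (c t)) (snd (velocity A J c t) \<kappa>) (\<phi> t) + frame \<kappa> (snd \<kappa> (c t)) \<phi>') (at t within J)"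
proof -
  let ?D = "\<lambda>h. frame_deriv \<kappa> (snd \<kappa> (c t)) (h *\<^sub>R snd (velocity A J c t) \<kappa>) (\<phi> t) +
      frame \<kappa> (snd \<kappa> (c t)) (h *\<^sub>R \<phi>')"
  have "((\<lambda>s. frame \<kappa> (snd \<kappa> (c s)) (\<phi> s)) has_derivative ?D) (at t within J)"
    using velocity_has_vector_derivative[OF assms(1,2)] assms(3)
    unfolding has_vector_derivative_def
    by (rule frame_has_derivative[where u = "\<lambda>s. snd \<kappa> (c s)", OF assms(2) refl assms(1)])
  moreover have "?D h = h *\<^sub>R ?D 1" for h
    using linear_scale[OF linear_frame_deriv(1)[OF assms(2)]] linear_scale[OF linear_frame[OF assms(2)]]
    by (simp add: scaleR_add_right)
  ultimately show ?thesis unfolding has_vector_derivative_def by simp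
qed

text \<open>In a fixed chart around \<open>c t\<close> the field solves
  \<open>a(c(s)) w(s) = W(s)\<close>; the coefficients are differentiable along the curve and
  injective at \<open>t\<close>.\<close>

lemma body_field_differentiable:
  assumes "t \<in> J"
  shows "(\<lambda>s. snd (body_field s) base) differentiable (at t within J)"
proof -
  define \<kappa> where "\<kappa> = some_chart A (c t)"
  have \<kappa>: "\<kappa> \<in> charts_at A (c t)" unfolding \<kappa>_def by (rule some_chart_at[OF curve_in_carrier[OF assms]])
  note at = eventually_in_chart[OF assms \<kappa>]
  have "continuous_map (top_of_set J) X c" using curve by (simp add: smooth_curve_on_def)
  from openin_continuous_map_preimage[OF this smooth_atlas_chart(1)[OF smooth_atlas charts_atD(1)[OF \<kappa>]]]
  have U: "openin (top_of_set J) {s \<in> J. c s \<in> fst \<kappa>}" by simp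
  show ?thesis
  proof (rule differentiable_solution_of_linear_system[OF assms])
    show "\<forall>\<^sub>F s in at t within J. linear (frame \<kappa> (snd \<kappa> (c s)))"
      using at by eventually_elim (simp add: linear_frame)
    show "linear (frame \<kappa> (snd \<kappa> (c t)))" "inj (frame \<kappa> (snd \<kappa> (c t)))"
      by (rule linear_frame[OF \<kappa>] inj_frame[OF \<kappa>])+
    show "(\<lambda>s. frame \<kappa> (snd \<kappa> (c s)) v) differentiable (at t within J)" for v
      using frame_along_curve_has_derivative[OF assms \<kappa> has_vector_derivative_const]
      by (rule differentiableI_vector)
    show "\<forall>\<^sub>F s in at t within J. frame \<kappa> (snd \<kappa> (c s)) (snd (body_field s) base) = snd (W s) \<kappa>"
      using at by eventually_elim (simp add: body_frame(2))
    show "frame \<kappa> (snd \<kappa> (c t)) (snd (body_field t) base) = snd (W t) \<kappa>"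
      by (simp add: body_frame(2)[OF assms \<kappa>])
    show "(\<lambda>s. snd (W s) \<kappa>) differentiable (at t within J)"
      by (rule smooth_vector_field_along_chart[OF field assms \<kappa> U])
  qed
qed

text \<open>The left hand side of the equation for \<open>w\<close>, in the chart \<open>base\<close>: the bracket cancels the
  term \<open>frame_deriv base origin w y\<close> of \<open>N(y,w)\<close> and replaces it by \<open>frame_deriv base origin y w\<close>.\<close>

definition body_residual :: "real \<Rightarrow> 'e" where
  "body_residual t = vector_derivative (\<lambda>s. snd (body_field s) base) (at t within J) +
     frame_deriv base origin (snd (body_velocity t) base) (snd (body_field t) base) +
     spray_coeff_deriv (snd (body_velocity t) base) (snd (body_field t) base)"

lemma covariant_derivative_component:
  assumes t: "t \<in> J" and \<kappa>: "\<kappa> \<in> charts_at A (c t)"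
  shows "snd (linear_covariant_derivative A S J c W t) \<kappa> = frame \<kappa> (snd \<kappa> (c t)) (body_residual t)"
proof -
  let ?x = "snd \<kappa> (c t)" and ?y = "snd (body_velocity t) base" and ?w = "snd (body_field t) base"
  let ?w' = "vector_derivative (\<lambda>s. snd (body_field s) base) (at t within J)"
  have bot: "at t within J \<noteq> bot" by (rule interval_at_within_ne_bot[OF interval t])
  have "((\<lambda>s. frame \<kappa> (snd \<kappa> (c s)) (snd (body_field s) base)) has_vector_derivative
      frame_deriv \<kappa> ?x (frame \<kappa> ?x ?y) ?w + frame \<kappa> ?x ?w') (at t within J)"
    using frame_along_curve_has_derivative[OF t \<kappa>, of "\<lambda>s. snd (body_field s) base" ?w']
      body_field_differentiable[OF t]
    by (simp only: vector_derivative_works body_frame(1)[OF t \<kappa>])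
  moreover have "\<forall>\<^sub>F s in at t within J. frame \<kappa> (snd \<kappa> (c s)) (snd (body_field s) base) = snd (W s) \<kappa>"
    using eventually_in_chart[OF t \<kappa>] by eventually_elim (simp add: body_frame(2))
  ultimately have "((\<lambda>s. snd (W s) \<kappa>) has_vector_derivative
      frame_deriv \<kappa> ?x (frame \<kappa> ?x ?y) ?w + frame \<kappa> ?x ?w') (at t within J)"
    unfolding has_vector_derivative_def
    by (rule has_derivative_transform_eventually) (simp_all add: t body_frame(2)[OF t \<kappa>])
  from vector_derivative_within[OF bot this]
  have "snd (linear_covariant_derivative A S J c W t) \<kappa> =
      frame_deriv \<kappa> ?x (frame \<kappa> ?x ?y) ?w + frame \<kappa> ?x ?w' + spray_N A S \<kappa> ?x (frame \<kappa> ?x ?y) (frame \<kappa> ?x ?w)"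
    using \<kappa> by (simp add: linear_covariant_derivative_def body_frame[OF t \<kappa>])
  also have "\<dots> = frame \<kappa> ?x (body_residual t)"
    by (simp add: frame_deriv_frame[OF \<kappa>] spray_N_frame[OF \<kappa> body_velocity_nonzero[OF t]] body_residual_def
        linear_add[OF linear_frame[OF \<kappa>]])
  finally show ?thesis .
qed

lemma linearly_parallel_iff: "linearly_parallel A S J c W \<longleftrightarrow> (\<forall>t\<in>J. body_residual t = 0)"
  unfolding linearly_parallel_def
proof (intro ball_cong refl)
  fix t assume t: "t \<in> J"
  define \<kappa> where "\<kappa> = some_chart A (c t)"
  have \<kappa>: "\<kappa> \<in> charts_at A (c t)" unfolding \<kappa>_def by (rule some_chart_at[OF curve_in_carrier[OF t]])
  show "linear_covariant_derivative A S J c W t = tzero (c t) \<longleftrightarrow> body_residual t = 0"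
  proof
    assume "linear_covariant_derivative A S J c W t = tzero (c t)"
    then have "frame \<kappa> (snd \<kappa> (c t)) (body_residual t) = 0"
      using covariant_derivative_component[OF t \<kappa>] by simp
    then show "body_residual t = 0"
      using injD[OF inj_frame[OF \<kappa>], of "body_residual t" 0] linear_0[OF linear_frame[OF \<kappa>]] by simp
  next
    assume 0: "body_residual t = 0"
    show "linear_covariant_derivative A S J c W t = tzero (c t)"
    \<comment> \<open>The transformation law has not been established for the covariant derivative,
      so vanishing is verified in every chart at \<open>c t\<close>; the converse direction above
      needs only one chart.\<close>
    proof (rule prod_eqI)
      show "snd (linear_covariant_derivative A S J c W t) = snd (tzero (c t))"
      proof
        fix \<kappa>'
        show "snd (linear_covariant_derivative A S J c W t) \<kappa>' = snd (tzero (c t)) \<kappa>'"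
        proof (cases "\<kappa>' \<in> charts_at A (c t)")
          case True
          then show ?thesis by (simp add: covariant_derivative_component[OF t True] 0 linear_0[OF linear_frame[OF True]])
        qed (simp add: linear_covariant_derivative_def)
      qed
    qed (simp add: linear_covariant_derivative_def)
  qed
qed

lemma body_equation:
  assumes t: "t \<in> J"
  shows "fibre_differentiable J body_field t"
    "tadd (tadd (fibre_derivative J body_field t)
        (connection_operator G A (spray_vector_field G A E S) (body_velocity t) (body_field t)))
      (lie_algebra_bracket G A (body_velocity t) (body_field t)) = coord_vector A \<one> base (body_residual t)"
proof -
  let ?w = "\<lambda>s. snd (body_field s) base" and ?V = "coord_vector A \<one> base"
  let ?w' = "vector_derivative ?w (at t within J)" and ?y = "snd (body_velocity t) base"
  have bot: "at t within J \<noteq> bot" by (rule interval_at_within_ne_bot[OF interval t])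
  have w: "body_field s = ?V (?w s)" if "s \<in> J" for s
    using coord_vector_of_component[OF body_tangent(2)[OF that] base_at_one] by simp
  have y: "body_velocity t = ?V ?y"
    using coord_vector_of_component[OF body_tangent(1)[OF t] base_at_one] by simp
  have deriv: "((\<lambda>s. snd (body_field s) \<kappa>) has_vector_derivative snd (?V ?w') \<kappa>) (at t within J)" for \<kappa>
  proof -
    have "((\<lambda>s. snd (?V (?w s)) \<kappa>) has_vector_derivative snd (?V ?w') \<kappa>) (at t within J)"
      using body_field_differentiable[OF t]
      by (intro coord_vector_has_vector_derivative base_at_one) (simp only: vector_derivative_works)
    \<comment> \<open>\<open>w\<close> is recovered from its coordinate in \<open>base\<close> only
      for times in \<open>J\<close>, which suffices for derivatives within \<open>J\<close>.\<close>
    then show ?thesis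
      unfolding has_vector_derivative_def
      by (rule has_derivative_transform[OF t, rotated]) (rule arg_cong[OF w, of _ "\<lambda>\<xi>. snd \<xi> \<kappa>"])
  qed
  show "fibre_differentiable J body_field t"
    unfolding fibre_differentiable_def using differentiableI_vector[OF deriv] by blast
  have fd: "fibre_derivative J body_field t = ?V ?w'"
  proof (rule prod_eqI)
    show "fst (fibre_derivative J body_field t) = fst (?V ?w')"
      using tangent_spaceD(1)[OF body_tangent(2)[OF t]] by (simp add: fibre_derivative_def coord_vector_def)
    show "snd (fibre_derivative J body_field t) = snd (?V ?w')"
      unfolding fibre_derivative_def snd_conv by (rule ext) (rule vector_derivative_within[OF bot deriv])
  qed
  have br: "lie_algebra_bracket G A (body_velocity t) (body_field t) =
      ?V (frame_deriv base origin ?y (?w t) - frame_deriv base origin (?w t) ?y)"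
    by (rule lie_algebra_bracket_coord[OF body_tangent[OF t]])
  have N: "connection_operator G A (spray_vector_field G A E S) (body_velocity t) (body_field t) =
      ?V (frame_deriv base origin (?w t) ?y + spray_coeff_deriv ?y (?w t))"
    using connection_operator_coord[OF body_velocity_nonzero[OF t], of "?w t"]
    by (simp only: y[symmetric] w[OF t, symmetric])
  show "tadd (tadd (fibre_derivative J body_field t)
        (connection_operator G A (spray_vector_field G A E S) (body_velocity t) (body_field t)))
      (lie_algebra_bracket G A (body_velocity t) (body_field t)) = ?V (body_residual t)"
    unfolding fd br N tadd_coord_vector[OF base_at_one] by (simp add: body_residual_def algebra_simps)
qed

end

theorem theorem1p1:
  fixes G :: "('a, 'b) monoid_scheme"
    and X :: "'a topology"
    and A :: "('a, 'e::euclidean_space) chart set"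
    and E :: "nat \<Rightarrow> ('a, 'e) tvec"
    and S :: "('a, 'e) tvec \<Rightarrow> (('a, 'e) tvec, 'e \<times> 'e) tvec"
    and \<eta> :: "('a, 'e) tvec \<Rightarrow> ('a, 'e) tvec"
    and N :: "('a, 'e) tvec \<Rightarrow> ('a, 'e) tvec \<Rightarrow> ('a, 'e) tvec"
    and J :: "real set"
    and c :: "real \<Rightarrow> 'a"
    and W y w :: "real \<Rightarrow> ('a, 'e) tvec"
  assumes "lie_group G X A"
    and "connected_space X"
    and "tangent_basis A \<one>\<^bsub>G\<^esub> E"
    and "left_invariant_spray G A S"
    and "\<eta> = spray_vector_field G A E S"
    and "N = connection_operator G A \<eta>"
    and "is_interval J" and "interior J \<noteq> {}"
    and "smooth_curve_on X A J c"
    and "\<forall>t\<in>J. velocity A J c t \<noteq> tzero (c t)"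
    and "smooth_vector_field_along A J c W"
    and "y = (\<lambda>t. left_push G A (inv\<^bsub>G\<^esub> (c t)) (velocity A J c t))"
    and "w = (\<lambda>t. left_push G A (inv\<^bsub>G\<^esub> (c t)) (W t))"
  shows "linearly_parallel A S J c W \<longleftrightarrow>
    (\<forall>t\<in>J. fibre_differentiable J w t \<and>
       tadd (tadd (fibre_derivative J w t) (N (y t) (w t))) (lie_algebra_bracket G A (y t) (w t))
         = tzero \<one>\<^bsub>G\<^esub>)"
proof -
  interpret spray_curve G X A E S J c W
    using assms(1,3,4,7-11) by unfold_locales blast+
  have y: "y = body_velocity" and w: "w = body_field"
    unfolding assms(12,13) body_velocity_def[abs_def] body_field_def[abs_def] by (rule refl)+
  show ?thesis
    \<comment> \<open>The differentiability conjunct holds throughout \<open>J\<close>, so both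
      sides express that \<open>body_residual\<close> vanishes on \<open>J\<close>.\<close>
    unfolding linearly_parallel_iff y w assms(5,6)
    by (intro ball_cong refl) (simp add: body_equation coord_vector_eq_tzero_iff[OF base_at_one])
qed

end
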